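(* Let $a>\frac12$, $a\neq1$, and $A=\begin{pmatrix}a&1-a\\1-a&a\end{pmatrix}$. The following list contains all $(B,C)$ such that $F_{A,B,C}$ is modular, and for the entries of the list $F_{A,B,C}(q)$, $q=e^{2\pi iz}$, is given by the stated formula: (1) $B=\binom{b}{-b}$, $C=\frac{b^2}{2a}-\frac1{24}$, with $$F_{A,B,C}(q)=\frac1{\eta(z)}\sum_{n\in\mathbb{Z}+\frac ba}q^{an^2/2};$$ (2) $B=\binom{-1/2}{-1/2}$, $C=\frac1{8a}-\frac1{24}$, with $$F_{A,B,C}(q)=\frac2{\eta(z)}\sum_{n\in\mathbb{Z}+\frac1{2a}}q^{an^2/2};$$ (3) $B=\binom{1-\frac a2}{\frac a2}$ and $B=\binom{\frac a2}{1-\frac a2}$, $C=\frac a8-\frac1{24}$, with $$F_{A,B,C}(q)=\frac1{2\,\eta(z)}\sum_{n\in\mathbb{Z}+\frac12}q^{an^2/2}.$$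
   Context: Here $\operatorname{Im}z>0$, $q^x=e^{2\pi ixz}$ for real $x$, $(q)_n=\prod_{k=1}^n(1-q^k)$, $\eta(z)=q^{1/24}\prod_{n\ge1}(1-q^n)$, and for a real positive definite symmetric $r\times r$ matrix $A$, a vector $B$ of length $r$ and a scalar $C$, $$F_{A,B,C}(q)=\sum_{n\in(\mathbb{Z}_{\ge0})^r}\frac{q^{\frac12n^TAn+n^TB+C}}{(q)_{n_1}\cdots(q)_{n_r}}\qquad(\text{here } r=2).$$ In (1), $b$ is a free parameter. "Modular" means that $F_{A,B,C}(e^{2\pi iz})$ is a modular function of some weight for some congruence subgroup. *)

theory Defs
  imports "HOL-Complex_Analysis.Complex_Analysis" "HOL-Algebra.Group" "HOL-Number_Theory.Cong"
begin

text \<open>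
  Real powers of \<open>q = e\<^sup>2\<^sup>\<pi>\<^sup>i\<^sup>z\<close> depend on \<open>z\<close> and not only on \<open>q\<close>, so every
  \<open>q\<close>-series below is a function of \<open>z\<close>, meaningful for \<open>Im z > 0\<close>.
\<close>

definition qpow :: "complex \<Rightarrow> real \<Rightarrow> complex" where
  "qpow z x = exp (2 * of_real pi * \<i> * of_real x * z)"

definition qfact :: "complex \<Rightarrow> nat \<Rightarrow> complex" where
  "qfact z n = (\<Prod>k=1..n. 1 - qpow z (real k))"

definition dedekind_eta :: "complex \<Rightarrow> complex" where
  "dedekind_eta z = qpow z (1/24) * (\<Prod>n. 1 - qpow z (real (n + 1)))"

definition nahm_sum :: "real^'r^'r \<Rightarrow> real^'r \<Rightarrow> real \<Rightarrow> complex \<Rightarrow> complex" where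
  "nahm_sum A B C z =
     (\<Sum>\<^sub>\<infinity>n\<in>(UNIV :: (nat^'r) set).
        (let x = (\<chi> i. real (n $ i)) in
          qpow z (1/2 * (x \<bullet> (A *v x)) + x \<bullet> B + C) / (\<Prod>i\<in>UNIV. qfact z (n $ i))))"

definition upper_half_plane :: "complex set" where
  "upper_half_plane = {z. Im z > 0}"

definition SL2Z :: "(int^2^2) monoid" where
  "SL2Z = \<lparr>carrier = {M. det M = 1}, mult = (**), one = mat 1\<rparr>"

definition principal_congruence_subgroup :: "nat \<Rightarrow> (int^2^2) set" where
  "principal_congruence_subgroup N =
     {M \<in> carrier SL2Z. [M$1$1 = 1] (mod int N) \<and> [M$1$2 = 0] (mod int N) \<and>
                        [M$2$1 = 0] (mod int N) \<and> [M$2$2 = 1] (mod int N)}"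

definition congruence_subgroup :: "(int^2^2) set \<Rightarrow> bool" where
  "congruence_subgroup G \<longleftrightarrow>
     subgroup G SL2Z \<and> (\<exists>N\<ge>1. principal_congruence_subgroup N \<subseteq> G)"

definition Gamma0_4 :: "(int^2^2) set" where
  "Gamma0_4 = {M \<in> carrier SL2Z. 4 dvd M$2$1}"

definition mobius_act :: "int^2^2 \<Rightarrow> complex \<Rightarrow> complex" where
  "mobius_act M z =
     (of_int (M$1$1) * z + of_int (M$1$2)) / (of_int (M$2$1) * z + of_int (M$2$2))"

definition denom :: "int^2^2 \<Rightarrow> complex \<Rightarrow> complex" where
  "denom M z = of_int (M$2$1) * z + of_int (M$2$2)"

definition jacobi_theta :: "complex \<Rightarrow> complex" where
  "jacobi_theta z = (\<Sum>\<^sub>\<infinity>n\<in>(UNIV :: int set). qpow z ((of_int n)\<^sup>2))"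

text \<open>
  Weights are integral or half-integral; the integer \<open>m\<close> is twice the weight. For odd
  \<open>m\<close> the automorphy factor is the usual (Shimura) one, a power of \<open>\<theta>(\<gamma>z)/\<theta>(z)\<close> for
  \<open>\<gamma>\<close> in \<open>\<Gamma>\<^sub>0(4)\<close>.
\<close>

definition automorphy_factor :: "int \<Rightarrow> int^2^2 \<Rightarrow> complex \<Rightarrow> complex" where
  "automorphy_factor m M z =
     (if even m then denom M z powi (m div 2)
      else (jacobi_theta (mobius_act M z) / jacobi_theta z) powi m)"

text \<open>
  Meromorphy at the cusp \<open>M\<infinity>\<close>: near \<open>\<infinity>\<close>, the function \<open>(cz+d)\<^sup>-\<^sup>m\<^sup>/\<^sup>2 f(Mz)\<close> is a
  Laurent series with finite principal part in some \<open>q\<^sup>1\<^sup>/\<^sup>N\<close>. For odd \<open>m\<close> the branch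
  of the square root only affects a constant factor.
\<close>

definition meromorphic_at_cusp :: "int \<Rightarrow> int^2^2 \<Rightarrow> (complex \<Rightarrow> complex) \<Rightarrow> bool" where
  "meromorphic_at_cusp m M f \<longleftrightarrow>
     (\<exists>N::nat. N \<ge> 1 \<and> (\<exists>g. g meromorphic_on {0} \<and>
        (\<exists>Y>0. \<forall>z. Im z > Y \<longrightarrow>
           csqrt (denom M z) powi (-m) * f (mobius_act M z) = g (qpow z (1 / real N)))))"

definition modular_function :: "int \<Rightarrow> (int^2^2) set \<Rightarrow> (complex \<Rightarrow> complex) \<Rightarrow> bool" where
  "modular_function m G f \<longleftrightarrow>
     (odd m \<longrightarrow> G \<subseteq> Gamma0_4) \<and>
     f nicely_meromorphic_on upper_half_plane \<and>
     (\<forall>M\<in>G. \<forall>z\<in>upper_half_plane. f (mobius_act M z) = automorphy_factor m M z * f z) \<and>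
     (\<forall>M\<in>carrier SL2Z. meromorphic_at_cusp m M f)"

definition is_modular :: "(complex \<Rightarrow> complex) \<Rightarrow> bool" where
  "is_modular f \<longleftrightarrow> (\<exists>m G. congruence_subgroup G \<and> modular_function m G f)"

end

theory Submission
  imports Defs "HOL-Real_Asymp.Real_Asymp"
begin

text \<open>
  Since \<open>n\<^sup>TAn/2 = a(n\<^sub>1 - n\<^sub>2)\<^sup>2/2 + n\<^sub>1n\<^sub>2\<close>, summing along the diagonals \<open>n\<^sub>1 - n\<^sub>2 = k\<close> with the Durfee
  identity gives the formula for \<open>B\<^sub>1 + B\<^sub>2 = 0\<close>. The other two formulas follow from the shift
  equation (with \<open>b = B\<^sub>1\<close>) \<open>F(B) = F(B + e\<^sub>1) + q\<^bsup>a/2+b\<^esup>F(B + Ae\<^sub>1)\<close>, which moves \<open>B\<^sub>1 + B\<^sub>2\<close> by one.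

  For the classification put \<open>q = exp(-\<epsilon>)\<close>. Modularity at the cusp 0 forces
  \<open>ln F = c + \<alpha>/\<epsilon> + w ln \<epsilon> + O(\<epsilon>\<^sup>5)\<close>. On the other hand \<open>F\<close> is an exponential sum in \<open>B\<close>; the shift
  equation and the inequality of arithmetic and geometric means bound it for \<open>B\<close> of size \<open>\<epsilon>\<^bsup>-1/2\<^esup>\<close>,
  so up to \<open>O(\<epsilon>\<^sup>5)\<close> it is a polynomial of degree less than 10 in \<open>B\<close>. The shift equation then
  determines its expansion from the case \<open>B\<^sub>1 + B\<^sub>2 = 0\<close>, first at the integer values of \<open>B\<^sub>1 + B\<^sub>2\<close> and
  by interpolation everywhere. The vanishing of the coefficients of \<open>\<epsilon>, \<dots>, \<epsilon>\<^sup>4\<close> in \<open>ln F\<close> leaves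
  exactly the listed \<open>(B, C)\<close>.
\<close>

section \<open>Nahm sums of rank two\<close>

text \<open>The obstacle is that the shift equation has two unknowns: it ties one value at
  \<open>s = B_1 + B_2\<close> to a sum of two values at s + 1, taken at different points. Functions
  that change sign under the translation between these points solve the homogeneous equation;
  approximate polynomiality in the difference variable rules them out. The same property lets exact
  evaluations of theta series at special points stand in for Poisson summation. The scale
  \<epsilon>^(-1/2) is the one on which \<epsilon>|B|^2 stays bounded, and the bounds there rest on
  the positivity of all summands at real q.

  Four coefficients are computed because those of \<epsilon>^2 and \<epsilon>^3 leave a curve of
  spurious solutions. With u = 1 - 1/a, the condition a > 1/2 yields |u| < 1 and a \<noteq> 1 yields
  u \<noteq> 0. For a = 1 the sum factors into two sums of rank one and the coefficient of
  \<epsilon>^3 vanishes identically.\<close>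

lemma qpow_add: "qpow z (x + y) = qpow z x * qpow z y"
  by (simp add: qpow_def algebra_simps flip: exp_add)

lemma qpow_0 [simp]: "qpow z 0 = 1"
  by (simp add: qpow_def)

lemma qpow_nonzero [simp]: "qpow z x \<noteq> 0"
  by (simp add: qpow_def)

lemma norm_qpow: "norm (qpow z x) = exp (- (2 * pi * Im z * x))"
  by (simp add: qpow_def norm_exp_eq_Re)

lemma qpow_of_nat: "qpow z (real n) = qpow z 1 ^ n"
  by (induction n) (simp_all add: qpow_add)

lemma norm_qpow_less_1: "Im z > 0 \<Longrightarrow> x > 0 \<Longrightarrow> norm (qpow z x) < 1"
  by (simp add: norm_qpow)

lemma qfact_0 [simp]: "qfact z 0 = 1"
  by (simp add: qfact_def)

lemma qfact_Suc: "qfact z (Suc n) = qfact z n * (1 - qpow z (real (Suc n)))"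
  by (simp add: qfact_def)

lemma one_minus_qpow_nonzero:
  assumes "Im z > 0" "x > 0"
  shows "1 - qpow z x \<noteq> 0"
  using norm_qpow_less_1[OF assms] by auto

lemma qfact_nonzero: "Im z > 0 \<Longrightarrow> qfact z n \<noteq> 0"
  using one_minus_qpow_nonzero by (auto simp: qfact_def)

section \<open>The infinite product (q)_inf\<close>

definition qfact_inf :: "complex \<Rightarrow> complex" where
  "qfact_inf z = (\<Prod>n. 1 - qpow z (real (n + 1)))"

lemma qfact_inf_convergent:
  assumes "Im z > 0"
  shows "convergent_prod (\<lambda>n. 1 - qpow z (real (n + 1)))"
proof -
  have "summable (\<lambda>n. norm (qpow z 1) ^ Suc n)"
    using norm_qpow_less_1[OF assms, of 1] by (simp add: summable_geometric)
  then have "summable (\<lambda>n. norm (- qpow z (real (n + 1))))"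
    by (simp only: qpow_of_nat norm_power norm_minus_cancel Suc_eq_plus1)
  then have "abs_convergent_prod (\<lambda>n. 1 + - qpow z (real (n + 1)))"
    by (intro summable_imp_abs_convergent_prod) simp
  then show ?thesis
    using abs_convergent_prod_imp_convergent_prod by simp
qed

lemma qfact_tendsto:
  assumes "Im z > 0"
  shows "qfact z \<longlonglongrightarrow> qfact_inf z"
proof -
  have "(\<lambda>n. \<Prod>i\<le>n. 1 - qpow z (real (i + 1))) \<longlonglongrightarrow> qfact_inf z"
    unfolding qfact_inf_def using convergent_prod_LIMSEQ[OF qfact_inf_convergent[OF assms]] .
  moreover have "(\<Prod>i\<le>n. 1 - qpow z (real (i + 1))) = qfact z (Suc n)" for n
    by (induction n) (simp_all add: qfact_def)
  ultimately have "(\<lambda>n. qfact z (Suc n)) \<longlonglongrightarrow> qfact_inf z"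
    by simp
  then show ?thesis
    by (rule LIMSEQ_imp_Suc)
qed

lemma qfact_inf_nonzero: "Im z > 0 \<Longrightarrow> qfact_inf z \<noteq> 0"
  unfolding qfact_inf_def
  using prodinf_nonzero[OF qfact_inf_convergent] one_minus_qpow_nonzero by simp

lemma dedekind_eta_eq: "dedekind_eta z = qpow z (1/24) * qfact_inf z"
  by (simp add: dedekind_eta_def qfact_inf_def)

text \<open>A sequence with a nonzero limit has bounded inverses, so in convergence proofs all
  denominators of the Nahm sum can be replaced by one constant.\<close>

lemma inverse_qfact_bound:
  assumes "Im z > 0"
  obtains M where "M > 0" "\<And>n. norm (inverse (qfact z n)) \<le> M"
proof -
  have "(\<lambda>n. inverse (qfact z n)) \<longlonglongrightarrow> inverse (qfact_inf z)"
    by (intro tendsto_inverse qfact_tendsto qfact_inf_nonzero assms)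
  then have "Bseq (\<lambda>n. inverse (qfact z n))"
    by (meson convergent_def convergent_imp_Bseq)
  then show ?thesis
    using that unfolding Bseq_def by auto
qed

section \<open>Summability of Gaussian series\<close>

lemma summable_on_gaussian_nat:
  fixes c b :: real
  assumes "c > 0"
  shows "(\<lambda>n::nat. exp (- (c * (real n)\<^sup>2 + b * real n))) summable_on UNIV"
proof -
  \<comment> \<open>Completing the square: c x^2 + (b - 1) x + K = (2 c x - (1 - b))^2 / (4 c), so
    the Gaussian is dominated by a geometric series.\<close>
  define K where "K = (1 - b)\<^sup>2 / (4 * c)"
  have bound: "exp (- (c * x\<^sup>2 + b * x)) \<le> exp K * exp (- x)" for x :: real
  proof -
    have "0 \<le> (2 * c * x - (1 - b))\<^sup>2 / (4 * c)"
      using assms by simp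
    also have "\<dots> = c * x\<^sup>2 + b * x - x + K"
      using assms by (simp add: K_def field_simps power2_eq_square)
    finally show ?thesis
      by (simp flip: exp_add)
  qed
  have "summable (\<lambda>n::nat. exp K * exp (-1 :: real) ^ n)"
    by (intro summable_mult summable_geometric) simp
  then have "summable (\<lambda>n::nat. exp K * exp (- real n))"
    by (simp add: exp_of_nat_mult[symmetric])
  then have "summable (\<lambda>n. norm (exp (- (c * (real n)\<^sup>2 + b * real n))))"
    by (rule summable_comparison_test[rotated]) (use bound in auto)
  then show ?thesis
    by (rule norm_summable_imp_summable_on)
qed

lemma summable_on_gaussian_int:
  fixes c b :: real
  assumes "c > 0"
  shows "(\<lambda>k::int. exp (- (c * (real_of_int k)\<^sup>2 + b * real_of_int k))) summable_on UNIV"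
    (is "?f summable_on _")
proof -
  have "?f summable_on (range int)"
    using summable_on_gaussian_nat[OF assms, of b]
    by (subst summable_on_reindex) (auto simp: o_def inj_on_def)
  moreover have "?f summable_on (range (\<lambda>n. - int n))"
    using summable_on_gaussian_nat[OF assms, of "-b"]
    by (subst summable_on_reindex) (auto simp: o_def inj_on_def)
  ultimately have "?f summable_on (range int \<union> range (\<lambda>n. - int n))"
    by (rule summable_on_union)
  moreover have "k \<in> range int \<union> range (\<lambda>n. - int n)" for k
    by (cases k rule: int_cases2) auto
  then have "range int \<union> range (\<lambda>n. - int n) = UNIV"
    by blast
  ultimately show ?thesis
    by simp
qed

section \<open>The rank two sum as a double series\<close>

definition nahm_exponent :: "real \<Rightarrow> real \<Rightarrow> real \<Rightarrow> nat \<times> nat \<Rightarrow> real" where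
  "nahm_exponent a b c = (\<lambda>(m, n). a * (real m - real n)\<^sup>2 / 2 + real m * real n + b * real m + c * real n)"

definition nahm_term :: "complex \<Rightarrow> real \<Rightarrow> real \<Rightarrow> real \<Rightarrow> nat \<times> nat \<Rightarrow> complex" where
  "nahm_term z a b c p = qpow z (nahm_exponent a b c p) / (qfact z (fst p) * qfact z (snd p))"

definition nahm2 :: "complex \<Rightarrow> real \<Rightarrow> real \<Rightarrow> real \<Rightarrow> complex" where
  "nahm2 z a b c = (\<Sum>\<^sub>\<infinity>p\<in>UNIV. nahm_term z a b c p)"

lemma nahm_exponent_ge:
  assumes "a \<ge> 1/2"
  shows "nahm_exponent a b c (m, n) \<ge>
    (1/4 * (real m)\<^sup>2 + b * real m) + (1/4 * (real n)\<^sup>2 + c * real n)"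
proof -
  have "0 \<le> (a - 1/2) * (real m - real n)\<^sup>2 / 2 + real m * real n / 2"
    using assms by simp
  also have "\<dots> = nahm_exponent a b c (m, n) - ((1/4 * (real m)\<^sup>2 + b * real m) + (1/4 * (real n)\<^sup>2 + c * real n))"
    by (simp add: nahm_exponent_def power2_eq_square field_simps)
  finally show ?thesis
    by simp
qed

lemma nahm_term_abs_summable:
  assumes "a > 1/2" "Im z > 0"
  shows "(\<lambda>p. norm (nahm_term z a b c p)) summable_on UNIV"
proof -
  obtain M where M: "M > 0" "\<And>n. norm (inverse (qfact z n)) \<le> M"
    using inverse_qfact_bound[OF assms(2)] by blast
  define y where "y = 2 * pi * Im z"
  have y: "y > 0"
    using assms by (simp add: y_def)
  define f where "f = (\<lambda>(b::real) (n::nat). exp (- (y / 4 * (real n)\<^sup>2 + y * b * real n)))"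
  have f: "f b summable_on UNIV" for b
    unfolding f_def using summable_on_gaussian_nat[of "y/4" "y * b"] y by simp
  have "(\<lambda>p. f b (fst p) * f c (snd p)) summable_on UNIV \<times> UNIV"
    by (rule summable_on_SigmaI[where g = "\<lambda>m. f b m * infsum (f c) UNIV"])
       (use f in \<open>auto intro!: has_sum_cmult_right has_sum_infsum summable_on_cmult_left simp: f_def\<close>)
  then have "(\<lambda>p. M\<^sup>2 * (f b (fst p) * f c (snd p))) summable_on UNIV"
    by (intro summable_on_cmult_right) simp
  then show ?thesis
  proof (rule summable_on_comparison_test)
    fix p :: "nat \<times> nat"
    obtain m n where p: "p = (m, n)" by force
    have "y * nahm_exponent a b c (m, n) \<ge>
        y * ((1/4 * (real m)\<^sup>2 + b * real m) + (1/4 * (real n)\<^sup>2 + c * real n))"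
      using nahm_exponent_ge[of a m b n c] assms y by (intro mult_left_mono) auto
    then have "norm (qpow z (nahm_exponent a b c p)) \<le> f b m * f c n"
      unfolding f_def norm_qpow p by (simp add: y_def algebra_simps flip: exp_add)
    moreover have "norm (nahm_term z a b c p) =
        norm (qpow z (nahm_exponent a b c p)) * (norm (inverse (qfact z m)) * norm (inverse (qfact z n)))"
      by (simp add: nahm_term_def p norm_divide norm_mult norm_inverse field_simps)
    moreover have "norm (inverse (qfact z m)) * norm (inverse (qfact z n)) \<le> M * M"
      using M by (intro mult_mono) (auto intro: less_imp_le)
    ultimately have "norm (nahm_term z a b c p) \<le> (f b m * f c n) * (M * M)"
      by (auto intro!: mult_mono simp: f_def)
    then show "norm (nahm_term z a b c p) \<le> M\<^sup>2 * (f b (fst p) * f c (snd p))"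
      by (simp add: p power2_eq_square algebra_simps)
  qed auto
qed

lemma nahm_term_summable:
  "a > 1/2 \<Longrightarrow> Im z > 0 \<Longrightarrow> nahm_term z a b c summable_on A"
  using abs_summable_summable[OF nahm_term_abs_summable] summable_on_subset_banach by blast

lemma nahm_sum_eq_nahm2:
  fixes A :: "real^2^2" and B :: "real^2"
  assumes A: "A = vector [vector [a, 1 - a], vector [1 - a, a]]"
  shows "nahm_sum A B C z = qpow z C * nahm2 z a (B$1) (B$2)"
proof -
  define \<phi> where "\<phi> = (\<lambda>p::nat\<times>nat. (vector [fst p, snd p] :: nat^2))"
  have \<phi>: "\<phi> p $ 1 = fst p" "\<phi> p $ 2 = snd p" for p
    by (simp_all add: \<phi>_def)
  have inj: "inj \<phi>"
    by (rule injI) (metis \<phi> prod.expand)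
  have range: "range \<phi> = UNIV"
  proof -
    have "v = \<phi> (v$1, v$2)" for v
      by (simp add: vec_eq_iff forall_2 \<phi>)
    then show ?thesis by blast
  qed
  define g where "g = (\<lambda>n::nat^2. let x = (\<chi> i. real (n $ i)) in
          qpow z (1/2 * (x \<bullet> (A *v x)) + x \<bullet> B + C) / (\<Prod>i\<in>UNIV. qfact z (n $ i)))"
  have "g (\<phi> p) = qpow z C * nahm_term z a (B$1) (B$2) p" for p
  proof -
    have "1/2 * ((\<chi> i. real (\<phi> p $ i)) \<bullet> (A *v (\<chi> i. real (\<phi> p $ i)))) + (\<chi> i. real (\<phi> p $ i)) \<bullet> B + C
        = C + nahm_exponent a (B$1) (B$2) p"
      by (cases p) (simp add: inner_vec_def sum_2 matrix_vector_mult_def A \<phi> nahm_exponent_def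
          power2_eq_square field_simps)
    moreover have "(\<Prod>i\<in>UNIV. qfact z (\<phi> p $ i)) = qfact z (fst p) * qfact z (snd p)"
      using prod.cong[of UNIV UNIV] by (simp add: UNIV_2 \<phi>)
    ultimately show ?thesis
      unfolding g_def Let_def nahm_term_def by (simp only: qpow_add[symmetric] times_divide_eq_right)
  qed
  moreover have "nahm_sum A B C z = infsum g (range \<phi>)"
    unfolding nahm_sum_def g_def range ..
  ultimately show ?thesis
    using infsum_reindex[OF inj, of g] by (simp add: o_def nahm2_def infsum_cmult_right')
qed

lemma infsum_diff:
  fixes f g :: "'a \<Rightarrow> complex"
  assumes "f summable_on A" "g summable_on A"
  shows "(\<Sum>\<^sub>\<infinity>x\<in>A. f x - g x) = infsum f A - infsum g A"
  using infsum_add[OF assms(1) summable_on_uminus[THEN iffD2, OF assms(2)]] by (simp add: infsum_uminus)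

lemma nahm2_commute: "nahm2 z a b c = nahm2 z a c b"
proof -
  have "nahm2 z a b c = infsum (nahm_term z a b c) (range prod.swap)"
    by (simp add: nahm2_def)
  also have "\<dots> = infsum (nahm_term z a b c \<circ> prod.swap) UNIV"
    by (rule infsum_reindex) simp
  also have "nahm_term z a b c \<circ> prod.swap = nahm_term z a c b"
    by (auto simp: nahm_term_def nahm_exponent_def power2_commute algebra_simps)
  finally show ?thesis
    by (simp add: nahm2_def)
qed

text \<open>Multiplying the summand by \<open>1 - q\<^sup>m\<close> cancels the last factor of \<open>(q)\<^sub>m\<close>, after which \<open>m\<close> can be shifted by one.\<close>

lemma nahm2_shift:
  assumes "a > 1/2" "Im z > 0"
  shows "nahm2 z a b c = nahm2 z a (b + 1) c + qpow z (a/2 + b) * nahm2 z a (b + a) (c + 1 - a)"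
proof -
  let ?T = "nahm_term z a"
  have shift: "?T (b + 1) c p = qpow z (real (fst p)) * ?T b c p" for p
    by (cases p) (simp add: nahm_term_def nahm_exponent_def qpow_add algebra_simps)
  have diff: "(\<lambda>p. ?T b c p - ?T (b + 1) c p) (Suc m, n) = qpow z (a/2 + b) * ?T (b + a) (c + 1 - a) (m, n)" for m n
  proof -
    have nz: "1 - qpow z (real (Suc m)) \<noteq> 0"
      using one_minus_qpow_nonzero[of z "real (Suc m)"] assms by simp
    have e: "nahm_exponent a b c (Suc m, n) = (a/2 + b) + nahm_exponent a (b + a) (c + 1 - a) (m, n)"
      by (simp add: nahm_exponent_def power2_eq_square field_simps)
    have L: "(\<lambda>p. ?T b c p - ?T (b + 1) c p) (Suc m, n) = (1 - qpow z (real (Suc m))) * ?T b c (Suc m, n)"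
      by (simp only: shift fst_conv) (simp only: left_diff_distrib mult_1_left)
    have T: "?T b c (Suc m, n) = qpow z (a/2 + b) * qpow z (nahm_exponent a (b + a) (c + 1 - a) (m, n)) /
        (qfact z m * (1 - qpow z (real (Suc m))) * qfact z n)"
      by (simp only: nahm_term_def e qpow_add qfact_Suc fst_conv snd_conv)
    show ?thesis
      unfolding L unfolding T using nz by (simp add: nahm_term_def del: of_nat_Suc)
  qed
  have inj: "inj (\<lambda>(m, n). (Suc m, n :: nat))"
    by (auto simp: inj_on_def)
  have "nahm2 z a b c - nahm2 z a (b + 1) c = (\<Sum>\<^sub>\<infinity>p\<in>UNIV. ?T b c p - ?T (b + 1) c p)"
    unfolding nahm2_def by (intro infsum_diff[symmetric] nahm_term_summable assms)
  also have "\<dots> = (\<Sum>\<^sub>\<infinity>p\<in>range (\<lambda>(m, n). (Suc m, n)). ?T b c p - ?T (b + 1) c p)"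
  proof (rule infsum_cong_neutral)
    fix p :: "nat \<times> nat"
    assume p: "p \<in> UNIV - range (\<lambda>(m, n). (Suc m, n))"
    obtain m n where mn: "p = (m, n)" by force
    have "m = 0"
      using p mn by (cases m) auto
    then show "?T b c p - ?T (b + 1) c p = 0"
      by (simp add: shift mn)
  qed auto
  also have "\<dots> = (\<Sum>\<^sub>\<infinity>p\<in>UNIV. qpow z (a/2 + b) * ?T (b + a) (c + 1 - a) p)"
    unfolding infsum_reindex[OF inj] by (rule infsum_cong) (use diff in \<open>auto simp: o_def\<close>)
  also have "\<dots> = qpow z (a/2 + b) * nahm2 z a (b + a) (c + 1 - a)"
    by (simp add: nahm2_def infsum_cmult_right')
  finally show ?thesis
    by (simp add: algebra_simps)
qed

section \<open>The sums with \<open>B\<^sub>1 + B\<^sub>2 = 0\<close>\<close>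

text \<open>For s = 0 the n-th term generates the partitions with an n by n + k Durfee rectangle.
  The weight q^(sn) serves to state two contiguous relations that can be compared at s = 0.\<close>

definition durfee :: "complex \<Rightarrow> nat \<Rightarrow> nat \<Rightarrow> complex" where
  "durfee z s k = (\<Sum>\<^sub>\<infinity>n\<in>UNIV. qpow z (real (n * (n + k) + s * n)) / (qfact z n * qfact z (n + k)))"

text \<open>For n >= 1 one has n(n + k) + sn >= n^2 + k. The series without its first term is
  therefore O(|q|^k) and disappears as k grows.\<close>

lemma durfee_bound:
  assumes "Im z > 0"
  obtains g where "g summable_on UNIV"
    "\<And>s k n. n \<ge> 1 \<Longrightarrow> norm (qpow z (real (n * (n + k) + s * n)) / (qfact z n * qfact z (n + k))) \<le> norm (qpow z (real k)) * g n"
    "\<And>n. g n \<ge> 0"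
proof -
  obtain M where M: "M > 0" "\<And>n. norm (inverse (qfact z n)) \<le> M"
    using inverse_qfact_bound[OF assms] by blast
  define y where "y = 2 * pi * Im z"
  have y: "y > 0"
    using assms by (simp add: y_def)
  show ?thesis
  proof (rule that[of "\<lambda>n. M\<^sup>2 * exp (- (y * (real n)\<^sup>2 + 0 * real n))"])
    show "(\<lambda>n. M\<^sup>2 * exp (- (y * (real n)\<^sup>2 + 0 * real n))) summable_on UNIV"
      by (intro summable_on_cmult_right summable_on_gaussian_nat y)
    fix s k n :: nat assume n: "n \<ge> 1"
    have "n * (n + k) + s * n \<ge> n\<^sup>2 + k"
      using n mult_le_mono1[of 1 n k] by (simp add: power2_eq_square algebra_simps trans_le_add1)
    then have "real (n * (n + k) + s * n) \<ge> real (n\<^sup>2 + k)"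
      by linarith
    then have "y * real (n * (n + k) + s * n) \<ge> y * real (n\<^sup>2 + k)"
      using y by (intro mult_left_mono) auto
    then have 1: "norm (qpow z (real (n * (n + k) + s * n))) \<le> exp (- (y * (real n)\<^sup>2)) * norm (qpow z (real k))"
      unfolding norm_qpow by (simp add: y_def algebra_simps flip: exp_add)
    have 2: "norm (inverse (qfact z n)) * norm (inverse (qfact z (n + k))) \<le> M * M"
      using M by (intro mult_mono) (auto intro: less_imp_le)
    have "norm (qpow z (real (n * (n + k) + s * n)) / (qfact z n * qfact z (n + k)))
        = norm (qpow z (real (n * (n + k) + s * n))) * (norm (inverse (qfact z n)) * norm (inverse (qfact z (n + k))))"
      by (simp add: norm_divide norm_mult norm_inverse field_simps del: of_nat_mult of_nat_add)
    also have "\<dots> \<le> (exp (- (y * (real n)\<^sup>2)) * norm (qpow z (real k))) * (M * M)"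
      by (intro mult_mono 1 2) auto
    finally show "norm (qpow z (real (n * (n + k) + s * n)) / (qfact z n * qfact z (n + k)))
        \<le> norm (qpow z (real k)) * (M\<^sup>2 * exp (- (y * (real n)\<^sup>2 + 0 * real n)))"
      by (simp add: power2_eq_square algebra_simps)
  qed auto
qed

lemma durfee_summable:
  assumes "Im z > 0"
  shows "(\<lambda>n. norm (qpow z (real (n * (n + k) + s * n)) / (qfact z n * qfact z (n + k)))) summable_on UNIV"
proof -
  obtain g where g: "g summable_on UNIV"
    "\<And>s k n. n \<ge> 1 \<Longrightarrow> norm (qpow z (real (n * (n + k) + s * n)) / (qfact z n * qfact z (n + k))) \<le> norm (qpow z (real k)) * g n"
    "\<And>n. g n \<ge> 0"
    using durfee_bound[OF assms] by blast
  have "(\<lambda>n. norm (qpow z (real k)) * g n) summable_on UNIV - {0}"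
    by (intro summable_on_cmult_right summable_on_subset_banach[OF g(1)]) auto
  then have "(\<lambda>n. norm (qpow z (real (n * (n + k) + s * n)) / (qfact z n * qfact z (n + k)))) summable_on UNIV - {0}"
    by (rule summable_on_comparison_test) (use g in auto)
  then show ?thesis
    using summable_on_insert_iff[of "\<lambda>n. norm (qpow z (real (n * (n + k) + s * n)) / (qfact z n * qfact z (n + k)))" "0::nat" "UNIV - {0}"]
    by (simp only: insert_Diff_single insert_UNIV)
qed

text \<open>The factor 1 - q^n between the weights s and s + 1 cancels the last factor of (q)_n,
  after which n is shifted by one.\<close>

lemma durfee_shift_left:
  assumes "Im z > 0"
  shows "durfee z s k = durfee z (Suc s) k + qpow z (real (k + 1 + s)) * durfee z (Suc s) (Suc k)"
proof -
  let ?t = "\<lambda>s k n. qpow z (real (n * (n + k) + s * n)) / (qfact z n * qfact z (n + k))"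
  have sum: "?t s k summable_on A" for s k A
    using abs_summable_summable[OF durfee_summable[OF assms]] summable_on_subset_banach by blast
  have "durfee z s k - durfee z (Suc s) k = (\<Sum>\<^sub>\<infinity>n\<in>UNIV. ?t s k n - ?t (Suc s) k n)"
    unfolding durfee_def by (intro infsum_diff[symmetric] sum)
  also have "\<dots> = (\<Sum>\<^sub>\<infinity>n\<in>range Suc. ?t s k n - ?t (Suc s) k n)"
  proof (rule infsum_cong_neutral)
    fix n assume "n \<in> UNIV - range Suc"
    then have "n = 0"
      by (metis DiffD2 not0_implies_Suc rangeI)
    then show "?t s k n - ?t (Suc s) k n = 0" by simp
  qed auto
  also have "\<dots> = (\<Sum>\<^sub>\<infinity>n\<in>UNIV. qpow z (real (k + 1 + s)) * ?t (Suc s) (Suc k) n)"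
    unfolding infsum_reindex[OF inj_Suc]
  proof (rule infsum_cong)
    fix n
    have nz: "1 - qpow z (real (Suc n)) \<noteq> 0"
      using one_minus_qpow_nonzero[of z "real (Suc n)"] assms by simp
    have e1: "real (Suc n * (Suc n + k) + Suc s * Suc n) = real (Suc n) + real (Suc n * (Suc n + k) + s * Suc n)"
      by simp
    have e2: "real (Suc n * (Suc n + k) + s * Suc n) = real (k + 1 + s) + real (n * (n + Suc k) + Suc s * n)"
      by (simp add: algebra_simps)
    have L: "?t s k (Suc n) - ?t (Suc s) k (Suc n) = (1 - qpow z (real (Suc n))) * ?t s k (Suc n)"
      unfolding e1 qpow_add by (simp only: left_diff_distrib mult_1_left times_divide_eq_right diff_divide_distrib)
    have R: "?t s k (Suc n) = qpow z (real (k + 1 + s)) * qpow z (real (n * (n + Suc k) + Suc s * n)) /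
        (qfact z n * (1 - qpow z (real (Suc n))) * qfact z (n + Suc k))"
      unfolding e2 qpow_add by (simp only: qfact_Suc add_Suc add_Suc_right)
    show "((\<lambda>n. ?t s k n - ?t (Suc s) k n) \<circ> Suc) n = qpow z (real (k + 1 + s)) * ?t (Suc s) (Suc k) n"
      unfolding o_def unfolding L unfolding R using nz by (simp del: of_nat_Suc of_nat_add of_nat_mult)
  qed
  also have "\<dots> = qpow z (real (k + 1 + s)) * durfee z (Suc s) (Suc k)"
    by (simp only: durfee_def infsum_cmult_right')
  finally show ?thesis
    by (simp add: algebra_simps)
qed

text \<open>Each summand is split by 1 = q^(k+1) q^n + (1 - q^(n+k+1)); the second piece cancels the
  last factor of (q)_(n+k+1) and so lowers k.\<close>

lemma durfee_shift_right:
  assumes "Im z > 0"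
  shows "durfee z s (Suc k) = qpow z (real (Suc k)) * durfee z (Suc s) (Suc k) + durfee z (Suc s) k"
proof -
  let ?t = "\<lambda>s k n. qpow z (real (n * (n + k) + s * n)) / (qfact z n * qfact z (n + k))"
  have sum: "?t s k summable_on A" for s k A
    using abs_summable_summable[OF durfee_summable[OF assms]] summable_on_subset_banach by blast
  have "?t s (Suc k) n = qpow z (real (Suc k)) * ?t (Suc s) (Suc k) n + ?t (Suc s) k n" for n
  proof -
    have e: "real (n * (n + Suc k) + Suc s * n) = real n + real (n * (n + Suc k) + s * n)"
      by (simp add: algebra_simps)
    have e': "n * (n + k) + Suc s * n = n * (n + Suc k) + s * n"
      by (simp add: algebra_simps)
    have f: "qpow z (real (Suc (n + k))) = qpow z (real (Suc k)) * qpow z (real n)"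
      by (simp add: algebra_simps flip: qpow_add)
    have "1 - qpow z (real (Suc k)) * qpow z (real n) \<noteq> 0"
      using one_minus_qpow_nonzero[of z "real (Suc (n + k))"] assms f by simp
    then show ?thesis
      unfolding e e' using qfact_nonzero[OF assms]
      by (simp add: qfact_Suc f qpow_add divide_simps del: of_nat_Suc of_nat_add of_nat_mult)
         (simp add: algebra_simps)
  qed
  then have "durfee z s (Suc k) = (\<Sum>\<^sub>\<infinity>n\<in>UNIV. qpow z (real (Suc k)) * ?t (Suc s) (Suc k) n + ?t (Suc s) k n)"
    unfolding durfee_def by (intro infsum_cong) 
  also have "\<dots> = qpow z (real (Suc k)) * durfee z (Suc s) (Suc k) + durfee z (Suc s) k"
    unfolding durfee_def by (simp only: infsum_add[OF summable_on_cmult_right[OF sum] sum] infsum_cmult_right')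
  finally show ?thesis .
qed

text \<open>At s = 0 the two contiguous relations express the values at k and at k + 1 by the same
  two quantities, so the sum is independent of k. As k grows only the term 1/(q)_k with n = 0
  survives, and its limit is the value.\<close>

lemma durfee_identity:
  assumes "Im z > 0"
  shows "durfee z 0 k = 1 / qfact_inf z"
proof -
  have "durfee z 0 (Suc k) = durfee z 0 k" for k
    using durfee_shift_left[OF assms, of 0 k] durfee_shift_right[OF assms, of 0 k] by simp
  then have const: "durfee z 0 k = durfee z 0 0" for k
    by (induction k) auto
  let ?t = "\<lambda>k n. qpow z (real (n * (n + k))) / (qfact z n * qfact z (n + k))"
  obtain g where g: "g summable_on UNIV"
    "\<And>s k n. n \<ge> 1 \<Longrightarrow> norm (qpow z (real (n * (n + k) + s * n)) / (qfact z n * qfact z (n + k))) \<le> norm (qpow z (real k)) * g n"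
    "\<And>n. g n \<ge> 0"
    using durfee_bound[OF assms] by blast
  have abs: "(\<lambda>n. norm (?t k n)) summable_on A" for k A
    using durfee_summable[OF assms, of k 0] summable_on_subset_banach by (auto intro: summable_on_subset_banach)
  have g': "g summable_on UNIV - {0}"
    by (rule summable_on_subset_banach[OF g(1)]) auto
  have bound: "norm (durfee z 0 k - 1 / qfact z k) \<le> norm (qpow z 1) ^ k * infsum g (UNIV - {0})" for k
  proof -
    have "durfee z 0 k = infsum (?t k) (insert 0 (UNIV - {0}))"
      by (simp add: durfee_def insert_absorb)
    also have "\<dots> = ?t k 0 + infsum (?t k) (UNIV - {0})"
      using abs_summable_summable[OF abs] by (subst infsum_insert) auto
    finally have "durfee z 0 k - 1 / qfact z k = infsum (?t k) (UNIV - {0})"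
      by simp
    also have "norm \<dots> \<le> (\<Sum>\<^sub>\<infinity>n\<in>UNIV - {0}. norm (?t k n))"
      by (rule norm_infsum_bound) (rule abs)
    also have "\<dots> \<le> (\<Sum>\<^sub>\<infinity>n\<in>UNIV - {0}. norm (qpow z (real k)) * g n)"
      by (intro infsum_mono abs summable_on_cmult_right g') (use g(2)[of _ _ 0] in auto)
    also have "\<dots> = norm (qpow z 1) ^ k * infsum g (UNIV - {0})"
      by (simp only: infsum_cmult_right' qpow_of_nat[of z k] norm_power)
    finally show ?thesis .
  qed
  have "(\<lambda>k. norm (qpow z 1) ^ k * infsum g (UNIV - {0})) \<longlonglongrightarrow> 0 * infsum g (UNIV - {0})"
    using norm_qpow_less_1[OF assms, of 1] by (intro tendsto_mult LIMSEQ_power_zero tendsto_const) auto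
  then have "(\<lambda>k. durfee z 0 k - 1 / qfact z k) \<longlonglongrightarrow> 0"
    unfolding mult_zero_left by (rule Lim_null_comparison[OF always_eventually[OF allI[OF bound]]])
  moreover have "(\<lambda>k. 1 / qfact z k) \<longlonglongrightarrow> 1 / qfact_inf z"
    by (intro tendsto_intros qfact_tendsto qfact_inf_nonzero assms)
  ultimately have lim: "(\<lambda>k. (durfee z 0 k - 1 / qfact z k) + 1 / qfact z k) \<longlonglongrightarrow> 0 + 1 / qfact_inf z"
    by (rule tendsto_add)
  have eq: "(\<lambda>k. (durfee z 0 k - 1 / qfact z k) + 1 / qfact z k) = (\<lambda>_. durfee z 0 0)"
    by (simp add: fun_eq_iff) (intro allI const)
  have "durfee z 0 0 = 1 / qfact_inf z"
    using lim[unfolded eq] by (simp add: LIMSEQ_const_iff)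
  then show ?thesis
    using const[of k] by simp
qed

lemma bij_diagonal:
  "bij (\<lambda>(k::int, j::nat). (j + nat k, j + nat (- k)))"
proof (rule o_bij[of "\<lambda>(m, n). (int m - int n, min m n)"])
  show "(\<lambda>(m, n). (int m - int n, min m n)) \<circ> (\<lambda>(k, j). (j + nat k, j + nat (- k))) = id"
    by (auto simp: fun_eq_iff)
  show "(\<lambda>(k, j). (j + nat k, j + nat (- k))) \<circ> (\<lambda>(m, n). (int m - int n, min m n)) = id"
    by (auto simp: fun_eq_iff)
qed

text \<open>On the diagonal m - n = k with j = min m n the exponent is a k^2/2 + b k + j(j + |k|).
  The sum over j is a Durfee sum, which has the same value on every diagonal.\<close>

lemma nahm2_theta:
  assumes "a > 1/2" "Im z > 0"
  shows "nahm2 z a b (- b) = (\<Sum>\<^sub>\<infinity>k\<in>(UNIV::int set). qpow z (a * (real_of_int k)\<^sup>2 / 2 + b * real_of_int k)) / qfact_inf z"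
proof -
  let ?\<phi> = "\<lambda>(k::int, j::nat). (j + nat k, j + nat (- k))"
  let ?T = "nahm_term z a b (- b)"
  have inj: "inj ?\<phi>" and range: "range ?\<phi> = UNIV"
    using bij_diagonal by (auto simp: bij_def)
  have *: "?T (?\<phi> (k, j)) = qpow z (a * (real_of_int k)\<^sup>2 / 2 + b * real_of_int k) *
      (qpow z (real (j * (j + nat \<bar>k\<bar>) + 0 * j)) / (qfact z j * qfact z (j + nat \<bar>k\<bar>)))" for k j
  proof (cases "k \<ge> 0")
    case True
    then obtain n where "k = int n"
      by (metis nonneg_int_cases)
    then show ?thesis
      by (simp add: nahm_term_def nahm_exponent_def algebra_simps flip: qpow_add)
  next
    case False
    then obtain n where "k = - int n"
      by (cases k rule: int_cases2) auto
    then show ?thesis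
      by (simp add: nahm_term_def nahm_exponent_def algebra_simps flip: qpow_add)
  qed
  have summ: "(\<lambda>p. ?T (?\<phi> p)) summable_on UNIV \<times> UNIV"
    using nahm_term_summable[OF assms, of b "-b" "range ?\<phi>"] inj
    by (subst (asm) summable_on_reindex) (auto simp: o_def)
  have "nahm2 z a b (- b) = infsum ?T (range ?\<phi>)"
    by (simp add: nahm2_def range)
  also have "\<dots> = infsum (\<lambda>p. ?T (?\<phi> p)) (UNIV \<times> UNIV)"
    using infsum_reindex[OF inj, of ?T] by (simp add: o_def)
  also have "\<dots> = (\<Sum>\<^sub>\<infinity>k\<in>UNIV. \<Sum>\<^sub>\<infinity>j\<in>UNIV. ?T (?\<phi> (k, j)))"
    using infsum_Sigma'_banach[of "\<lambda>k j. ?T (?\<phi> (k, j))" UNIV "\<lambda>_. UNIV"] summ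
    by (simp add: case_prod_unfold)
  also have "\<dots> = (\<Sum>\<^sub>\<infinity>k\<in>UNIV. qpow z (a * (real_of_int k)\<^sup>2 / 2 + b * real_of_int k) * durfee z 0 (nat \<bar>k\<bar>))"
    unfolding * infsum_cmult_right' durfee_def ..
  also have "\<dots> = (\<Sum>\<^sub>\<infinity>k\<in>(UNIV::int set). qpow z (a * (real_of_int k)\<^sup>2 / 2 + b * real_of_int k)) / qfact_inf z"
    by (simp only: durfee_identity[OF assms(2)] divide_inverse infsum_cmult_left' mult_1_left)
  finally show ?thesis .
qed

section \<open>Theta series over cosets and the three formulas\<close>

definition theta_coset :: "complex \<Rightarrow> real \<Rightarrow> real \<Rightarrow> complex" where
  "theta_coset z a x = (\<Sum>\<^sub>\<infinity>n\<in>{n. n - x \<in> \<int>}. qpow z (a * n\<^sup>2 / 2))"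

lemma theta_coset_eq_infsum_int:
  "theta_coset z a x = (\<Sum>\<^sub>\<infinity>k\<in>(UNIV::int set). qpow z (a * (real_of_int k + x)\<^sup>2 / 2))"
proof -
  have "{n. n - x \<in> \<int>} = range (\<lambda>k::int. real_of_int k + x)"
    by (auto simp: Ints_def algebra_simps)
  then show ?thesis
    unfolding theta_coset_def by (simp add: infsum_reindex inj_on_def o_def)
qed

lemma theta_coset_minus: "theta_coset z a (- x) = theta_coset z a x"
proof -
  have img: "uminus ` {n. n - x \<in> \<int>} = {n. n - (- x) \<in> \<int>}"
  proof (intro equalityI subsetI)
    fix n assume "n \<in> {n. n - (- x) \<in> \<int>}"
    then have "- (n - (- x)) \<in> \<int>"
      by (simp only: mem_Collect_eq Ints_minus)
    then have "- n \<in> {n. n - x \<in> \<int>}"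
      by simp
    then show "n \<in> uminus ` {n. n - x \<in> \<int>}"
      by force
  next
    fix n assume "n \<in> uminus ` {n. n - x \<in> \<int>}"
    then obtain m where "n = - m" "m - x \<in> \<int>" by auto
    then show "n \<in> {n. n - (- x) \<in> \<int>}"
      using Ints_minus[of "m - x"] by simp
  qed
  show ?thesis
    unfolding theta_coset_def img[symmetric] by (subst infsum_reindex) (auto simp: o_def)
qed

lemma theta_coset_add_1: "theta_coset z a (x + 1) = theta_coset z a x"
proof -
  have "n - (x + 1) \<in> \<int> \<longleftrightarrow> n - x \<in> \<int>" for n :: real
    using Ints_add[of "n - (x + 1)" 1] Ints_diff[of "n - x" 1] by (auto simp: algebra_simps)
  then show ?thesis
    by (simp add: theta_coset_def)
qed

text \<open>Completing the square, a k^2/2 + b k = a (k + b/a)^2/2 - b^2/(2a), moves the linear term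
  into the coset and explains the b^2/(2a) in C.\<close>

lemma nahm2_antidiagonal:
  assumes "a > 1/2" "Im z > 0"
  shows "nahm2 z a b (- b) = qpow z (- (b\<^sup>2 / (2 * a))) * theta_coset z a (b / a) / qfact_inf z"
proof -
  have "qpow z (a * (real_of_int k)\<^sup>2 / 2 + b * real_of_int k)
      = qpow z (- (b\<^sup>2 / (2 * a))) * qpow z (a * (real_of_int k + b / a)\<^sup>2 / 2)" for k
  proof -
    have "a * (real_of_int k)\<^sup>2 / 2 + b * real_of_int k = - (b\<^sup>2 / (2 * a)) + a * (real_of_int k + b / a)\<^sup>2 / 2"
      using assms by (simp add: power2_eq_square field_simps)
    then show ?thesis
      by (simp only: qpow_add)
  qed
  then show ?thesis
    by (simp add: nahm2_theta[OF assms] theta_coset_eq_infsum_int infsum_cmult_right')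
qed

text \<open>Both vectors on the right of the shift equation have components summing to 0, with
  cosets 1/(2a) and 1 - 1/(2a). Evenness and periodicity of the theta series identify the two, hence
  the factor 2.\<close>

lemma nahm2_shift_antidiagonal_neg:
  assumes "a > 1/2" "Im z > 0"
  shows "nahm2 z a (-1/2) (-1/2) = 2 * qpow z (- (1 / (8 * a))) * theta_coset z a (1 / (2 * a)) / qfact_inf z"
proof -
  have "theta_coset z a ((a - 1/2) / a) = theta_coset z a (- (1 / (2 * a)) + 1)"
    using assms by (simp add: field_simps)
  then have *: "theta_coset z a ((a - 1/2) / a) = theta_coset z a (1 / (2 * a))"
    by (simp only: theta_coset_add_1 theta_coset_minus)
  have e: "qpow z (a/2 + (-1/2)) * qpow z (- ((a - 1/2)\<^sup>2 / (2 * a))) = qpow z (- (1 / (8 * a)))"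
  proof -
    have "(a/2 + (-1/2)) + - ((a - 1/2)\<^sup>2 / (2 * a)) = - (1 / (8 * a))"
      using assms by (simp add: power2_eq_square field_simps)
    then show ?thesis
      by (simp only: qpow_add[symmetric])
  qed
  have "nahm2 z a (-1/2) (-1/2) = nahm2 z a (1/2) (- (1/2)) + qpow z (a/2 + (-1/2)) * nahm2 z a (a - 1/2) (- (a - 1/2))"
    using nahm2_shift[OF assms, of "-1/2" "-1/2"] by (simp add: algebra_simps)
  also have "nahm2 z a (1/2) (- (1/2)) = qpow z (- (1 / (8 * a))) * theta_coset z a (1 / (2 * a)) / qfact_inf z"
    unfolding nahm2_antidiagonal[OF assms] by (simp add: power2_eq_square)
  also have "qpow z (a/2 + (-1/2)) * nahm2 z a (a - 1/2) (- (a - 1/2))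
      = (qpow z (a/2 + (-1/2)) * qpow z (- ((a - 1/2)\<^sup>2 / (2 * a)))) * theta_coset z a (1 / (2 * a)) / qfact_inf z"
    unfolding nahm2_antidiagonal[OF assms] * by simp
  finally show ?thesis
    unfolding e by simp
qed

text \<open>The shift equation is read backwards: at (-a/2, a/2) its prefactor is 1, and its right
  side consists of the wanted sum and the sum with B swapped, which are equal. Hence the factor
  1/2.\<close>

lemma nahm2_shift_antidiagonal_pos:
  assumes "a > 1/2" "Im z > 0"
  shows "nahm2 z a (1 - a/2) (a/2) = qpow z (- (a / 8)) * theta_coset z a (1 / 2) / (2 * qfact_inf z)"
proof -
  have "nahm2 z a (- (a/2)) (- (- (a/2))) = nahm2 z a (1 - a/2) (a/2) + nahm2 z a (a/2) (1 - a/2)"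
    using nahm2_shift[OF assms, of "- (a/2)" "a/2"] by (simp add: algebra_simps)
  then have "2 * nahm2 z a (1 - a/2) (a/2) = nahm2 z a (- (a/2)) (- (- (a/2)))"
    by (simp add: nahm2_commute)
  also have "\<dots> = qpow z (- (a / 8)) * theta_coset z a (1 / 2) / qfact_inf z"
    unfolding nahm2_antidiagonal[OF assms] using assms theta_coset_minus[of z a "1/2"]
    by (simp add: power2_eq_square)
  finally have "nahm2 z a (1 - a/2) (a/2) = (qpow z (- (a / 8)) * theta_coset z a (1 / 2) / qfact_inf z) / 2"
    by (metis nonzero_mult_div_cancel_left zero_neq_numeral)
  then show ?thesis
    by simp
qed

section \<open>Functions that are polynomial up to a small error\<close>

lemma eps_power_bigo:
  assumes "N \<le> (k::nat)"
  shows "(\<lambda>\<epsilon>::real. \<epsilon> ^ k) \<in> O[at_right 0](\<lambda>\<epsilon>. \<epsilon> ^ N)"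
proof -
  have "(\<lambda>\<epsilon>::real. \<epsilon> ^ (k - N)) \<in> O[at_right 0](\<lambda>_. 1)"
    by (cases "k - N = 0") (simp, real_asymp)
  then have "(\<lambda>\<epsilon>::real. \<epsilon> ^ N * \<epsilon> ^ (k - N)) \<in> O[at_right 0](\<lambda>\<epsilon>. \<epsilon> ^ N * 1)"
    by (intro landau_o.big.mult) auto
  then show ?thesis
    using assms by (simp flip: power_add)
qed

text \<open>
  The second argument \<open>x\<close> lives on the scale \<open>\<epsilon>\<^bsup>-1/2\<^esup>\<close>, so that an expansion of such a function
  up to \<open>O(\<epsilon>\<^sup>N)\<close> has degree less than \<open>2N\<close> in \<open>x\<close>.
\<close>

definition near_poly :: "nat \<Rightarrow> (real \<Rightarrow> real \<Rightarrow> real) \<Rightarrow> bool" where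
  "near_poly N g \<longleftrightarrow> (\<exists>P. (\<forall>\<epsilon>. degree (P \<epsilon> :: real poly) < 2 * N) \<and>
     (\<forall>x. (\<lambda>\<epsilon>. g \<epsilon> x - poly (P \<epsilon>) x) \<in> O[at_right 0](\<lambda>\<epsilon>. \<epsilon> ^ N)))"

lemma near_polyE:
  assumes "near_poly N g"
  obtains P where "\<And>\<epsilon>. degree (P \<epsilon>) < 2 * N"
    "\<And>x. (\<lambda>\<epsilon>. g \<epsilon> x - poly (P \<epsilon>) x) \<in> O[at_right 0](\<lambda>\<epsilon>. \<epsilon> ^ N)"
  using assms unfolding near_poly_def by blast

lemma near_poly_diff:
  assumes "near_poly N f" "near_poly N g"
  shows "near_poly N (\<lambda>\<epsilon> x. f \<epsilon> x - g \<epsilon> x)"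
proof -
  obtain P where P: "\<And>\<epsilon>. degree (P \<epsilon>) < 2 * N"
    "\<And>x. (\<lambda>\<epsilon>. f \<epsilon> x - poly (P \<epsilon>) x) \<in> O[at_right 0](\<lambda>\<epsilon>. \<epsilon> ^ N)"
    using near_polyE[OF assms(1)] by blast
  obtain Q where Q: "\<And>\<epsilon>. degree (Q \<epsilon>) < 2 * N"
    "\<And>x. (\<lambda>\<epsilon>. g \<epsilon> x - poly (Q \<epsilon>) x) \<in> O[at_right 0](\<lambda>\<epsilon>. \<epsilon> ^ N)"
    using near_polyE[OF assms(2)] by blast
  have "(\<lambda>\<epsilon>. (f \<epsilon> x - g \<epsilon> x) - poly (P \<epsilon> - Q \<epsilon>) x) \<in> O[at_right 0](\<lambda>\<epsilon>. \<epsilon> ^ N)" for x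
    using sum_in_bigo(2)[OF P(2)[of x] Q(2)[of x]] by (simp add: algebra_simps)
  moreover have "degree (P \<epsilon> - Q \<epsilon>) < 2 * N" for \<epsilon>
    by (intro degree_diff_less P Q)
  ultimately show ?thesis
    unfolding near_poly_def by (intro exI[of _ "\<lambda>\<epsilon>. P \<epsilon> - Q \<epsilon>"]) blast
qed

lemma near_poly_scale:
  assumes "near_poly N f"
  shows "near_poly N (\<lambda>\<epsilon> x. f \<epsilon> (c * x))"
proof -
  obtain P where P: "\<And>\<epsilon>. degree (P \<epsilon>) < 2 * N"
    "\<And>x. (\<lambda>\<epsilon>. f \<epsilon> x - poly (P \<epsilon>) x) \<in> O[at_right 0](\<lambda>\<epsilon>. \<epsilon> ^ N)"
    using near_polyE[OF assms(1)] by blast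
  have "degree (pcompose (P \<epsilon>) [:0, c:]) < 2 * N" for \<epsilon>
  proof -
    have "degree (pcompose (P \<epsilon>) [:0, c:]) \<le> degree (P \<epsilon>) * 1"
      using degree_pcompose_le[of "P \<epsilon>" "[:0, c:]"]
      by (rule order_trans) (intro mult_left_mono, auto)
    then show ?thesis
      using P(1)[of \<epsilon>] by simp
  qed
  moreover have "(\<lambda>\<epsilon>. f \<epsilon> (c * x) - poly (pcompose (P \<epsilon>) [:0, c:]) x) \<in> O[at_right 0](\<lambda>\<epsilon>. \<epsilon> ^ N)" for x
    using P(2)[of "c * x"] by (simp add: poly_pcompose mult.commute)
  ultimately show ?thesis
    unfolding near_poly_def by (intro exI[of _ "\<lambda>\<epsilon>. pcompose (P \<epsilon>) [:0, c:]"]) blast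
qed

subsection \<open>Interpolation at the integers\<close>

text \<open>The weights depend on x and n alone. One set of weights therefore serves a whole family
  of polynomials indexed by \<epsilon>, without any control of their coefficients.\<close>

lemma lagrange_interpolation:
  fixes x :: real
  shows "\<exists>l. \<forall>p. degree p < n \<longrightarrow> poly p x = (\<Sum>i<n. l i * poly p (real i))"
proof -
  define L :: "nat \<Rightarrow> real poly" where
    "L i = (\<Prod>k\<in>{..<n} - {i}. smult (1 / (real i - real k)) [:- real k, 1:])" for i
  have deg: "degree (L i) < n" if "i < n" for i
  proof -
    have "degree (L i) \<le> (\<Sum>k\<in>{..<n} - {i}. 1)"
      unfolding L_def
      by (rule order_trans[OF degree_prod_sum_le]) (auto intro!: sum_mono simp: degree_smult_le)
    also have "\<dots> < n"
      using that by simp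
    finally show ?thesis .
  qed
  have val: "poly (L i) (real j) = (if i = j then 1 else 0)" if "i < n" "j < n" for i j
  proof (cases "i = j")
    case True
    then show ?thesis
      by (auto simp: L_def poly_prod diff_divide_distrib[symmetric] intro!: prod.neutral)
  next
    case False
    then show ?thesis
      using that by (auto simp: L_def poly_prod intro!: prod_zero bexI[of _ j])
  qed
  show ?thesis
  proof (intro exI allI impI)
    fix p :: "real poly" assume p: "degree p < n"
    define Q where "Q = (\<Sum>i<n. smult (poly p (real i)) (L i))"
    have "degree Q < n"
      unfolding Q_def using p by (intro degree_sum_less) (auto intro: le_less_trans[OF degree_smult_le] deg)
    moreover have "poly p y = poly Q y" if y: "y \<in> real ` {..<n}" for y
    proof -
      obtain j where j: "j < n" "y = real j"
        using y by auto
      have "poly Q y = (\<Sum>i<n. if i = j then poly p (real j) else 0)"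
        unfolding Q_def poly_sum by (intro sum.cong) (use j val in auto)
      then show ?thesis
        using j by simp
    qed
    ultimately have "p = Q"
      using p by (intro poly_eqI_degree[of "real ` {..<n}"]) (auto simp: card_image)
    then show "poly p x = (\<Sum>i<n. poly (L i) x * poly p (real i))"
      by (metis (no_types, lifting) Q_def mult.commute poly_smult poly_sum sum.cong)
  qed
qed

lemma near_poly_small_on_nats_imp_small:
  assumes "near_poly N f" and nats: "\<And>i. i < 2 * N \<Longrightarrow> (\<lambda>\<epsilon>. f \<epsilon> (real i)) \<in> O[at_right 0](\<lambda>\<epsilon>. \<epsilon> ^ N)"
  shows "(\<lambda>\<epsilon>. f \<epsilon> x) \<in> O[at_right 0](\<lambda>\<epsilon>. \<epsilon> ^ N)"
proof -
  obtain P where P: "\<And>\<epsilon>. degree (P \<epsilon>) < 2 * N"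
    "\<And>x. (\<lambda>\<epsilon>. f \<epsilon> x - poly (P \<epsilon>) x) \<in> O[at_right 0](\<lambda>\<epsilon>. \<epsilon> ^ N)"
    using near_polyE[OF assms(1)] by blast
  obtain l where l: "\<And>p. degree p < 2 * N \<Longrightarrow> poly p x = (\<Sum>i<2*N. l i * poly p (real i))"
    using lagrange_interpolation[of "2 * N" x] by blast
  have "(\<lambda>\<epsilon>. f \<epsilon> (real i) - (f \<epsilon> (real i) - poly (P \<epsilon>) (real i))) \<in> O[at_right 0](\<lambda>\<epsilon>. \<epsilon> ^ N)"
    if "i < 2 * N" for i
    by (intro sum_in_bigo nats that P)
  then have "(\<lambda>\<epsilon>. \<Sum>i<2*N. l i * poly (P \<epsilon>) (real i)) \<in> O[at_right 0](\<lambda>\<epsilon>. \<epsilon> ^ N)"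
    by (intro big_sum_in_bigo) simp
  then have "(\<lambda>\<epsilon>. poly (P \<epsilon>) x) \<in> O[at_right 0](\<lambda>\<epsilon>. \<epsilon> ^ N)"
    using l[OF P(1)] by simp
  from sum_in_bigo(1)[OF P(2)[of x] this] show ?thesis
    by simp
qed

subsection \<open>Iterated differences\<close>

definition shift_diff :: "real \<Rightarrow> (real \<Rightarrow> real \<Rightarrow> real) \<Rightarrow> real \<Rightarrow> real \<Rightarrow> real" where
  "shift_diff h f = (\<lambda>\<epsilon> x. f \<epsilon> (x + h) - f \<epsilon> x)"

lemma shift_diff_funpow_Suc:
  "(shift_diff h ^^ Suc n) f \<epsilon> x = (shift_diff h ^^ n) f \<epsilon> (x + h) - (shift_diff h ^^ n) f \<epsilon> x"
  by (simp add: shift_diff_def)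

lemma shift_diff_funpow_bigo:
  assumes "\<And>x. (\<lambda>\<epsilon>. f \<epsilon> x) \<in> O[at_right 0](g)"
  shows "(\<lambda>\<epsilon>. (shift_diff h ^^ n) f \<epsilon> x) \<in> O[at_right 0](g)"
proof (induction n arbitrary: x)
  case (Suc n)
  then show ?case
    unfolding shift_diff_funpow_Suc by (intro sum_in_bigo)
qed (use assms in simp)

lemma shift_diff_funpow_add:
  "(shift_diff h ^^ n) (\<lambda>\<epsilon> x. f \<epsilon> x + g \<epsilon> x) = (\<lambda>\<epsilon> x. (shift_diff h ^^ n) f \<epsilon> x + (shift_diff h ^^ n) g \<epsilon> x)"
proof (induction n)
  case (Suc n)
  show ?case
    by (intro ext) (simp only: shift_diff_funpow_Suc Suc algebra_simps)
qed simp

lemma shift_diff_funpow_poly: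
  assumes "\<And>\<epsilon>. degree (P \<epsilon>) < n"
  shows "(shift_diff h ^^ n) (\<lambda>\<epsilon>. poly (P \<epsilon>)) = (\<lambda>\<epsilon> x. 0)"
  using assms
proof (induction n arbitrary: P)
  case (Suc n)
  define D where "D = (\<lambda>\<epsilon>. pcompose (P \<epsilon>) [:h, 1:] - P \<epsilon>)"
  have D: "shift_diff h (\<lambda>\<epsilon>. poly (P \<epsilon>)) = (\<lambda>\<epsilon>. poly (D \<epsilon>))"
    by (simp add: shift_diff_def D_def poly_pcompose fun_eq_iff add.commute)
  have deg: "D \<epsilon> = 0 \<or> degree (D \<epsilon>) < degree (P \<epsilon>)" for \<epsilon>
  proof (cases "D \<epsilon> = 0")
    case False
    have "degree (pcompose (P \<epsilon>) [:h, 1:]) = degree (P \<epsilon>)"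
      by (simp add: degree_pcompose)
    moreover from this have "coeff (pcompose (P \<epsilon>) [:h, 1:]) (degree (P \<epsilon>)) = coeff (P \<epsilon>) (degree (P \<epsilon>))"
      using lead_coeff_comp[of "[:h, 1:]" "P \<epsilon>"] by simp
    ultimately have "degree (D \<epsilon>) \<le> degree (P \<epsilon>)" "coeff (D \<epsilon>) (degree (P \<epsilon>)) = 0"
      unfolding D_def by (auto intro: degree_diff_le)
    then show ?thesis
      using False degree_less_if_less_eqI by blast
  qed simp
  show ?case
  proof (cases n)
    case 0
    then have "degree (P \<epsilon>) = 0" for \<epsilon>
      using Suc.prems[of \<epsilon>] by simp
    then have "D \<epsilon> = 0" for \<epsilon>
      using deg[of \<epsilon>] by simp
    then show ?thesis
      using D 0 by (simp add: fun_eq_iff)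
  next
    case (Suc k)
    have "degree (D \<epsilon>) < n" for \<epsilon>
      using deg[of \<epsilon>] Suc.prems[of \<epsilon>] Suc by auto
    then show ?thesis
      using Suc.IH[of D] by (simp only: funpow_Suc_right o_apply D)
  qed
qed simp

lemma near_poly_shift_diff:
  assumes "near_poly N f"
  shows "(\<lambda>\<epsilon>. (shift_diff h ^^ (2 * N)) f \<epsilon> x) \<in> O[at_right 0](\<lambda>\<epsilon>. \<epsilon> ^ N)"
proof -
  obtain P where P: "\<And>\<epsilon>. degree (P \<epsilon>) < 2 * N"
    "\<And>x. (\<lambda>\<epsilon>. f \<epsilon> x - poly (P \<epsilon>) x) \<in> O[at_right 0](\<lambda>\<epsilon>. \<epsilon> ^ N)"
    using near_polyE[OF assms(1)] by blast
  have "f = (\<lambda>\<epsilon> x. (f \<epsilon> x - poly (P \<epsilon>) x) + poly (P \<epsilon>) x)"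
    by simp
  then have "(shift_diff h ^^ (2 * N)) f =
      (\<lambda>\<epsilon> x. (shift_diff h ^^ (2 * N)) (\<lambda>\<epsilon> x. f \<epsilon> x - poly (P \<epsilon>) x) \<epsilon> x + (shift_diff h ^^ (2 * N)) (\<lambda>\<epsilon>. poly (P \<epsilon>)) \<epsilon> x)"
    using shift_diff_funpow_add by metis
  then show ?thesis
    using shift_diff_funpow_bigo[of "\<lambda>\<epsilon> x. f \<epsilon> x - poly (P \<epsilon>) x", OF P(2)]
    by (simp add: shift_diff_funpow_poly[OF P(1)])
qed

text \<open>
  If \<open>g(x) + g(x + h)\<close> is small, then the difference operator acts on \<open>g\<close> as multiplication by
  \<open>-2\<close>, while its \<open>2N\<close>-th power annihilates \<open>g\<close> up to \<open>O(\<epsilon>\<^sup>N)\<close>.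
\<close>

lemma near_poly_alternating_imp_small:
  assumes near: "near_poly N g"
    and bdd: "\<And>x. (\<lambda>\<epsilon>. g \<epsilon> x) \<in> O[at_right 0](\<lambda>_. 1)"
    and alt: "\<And>x. (\<lambda>\<epsilon>. g \<epsilon> x + exp (- (\<epsilon> * l x)) * g \<epsilon> (x + h)) \<in> O[at_right 0](\<lambda>\<epsilon>. \<epsilon> ^ N)"
  shows "(\<lambda>\<epsilon>. g \<epsilon> x) \<in> O[at_right 0](\<lambda>\<epsilon>. \<epsilon> ^ N)"
proof -
  \<comment> \<open>Bootstrapping in the exponent: replacing
    \<open>exp (- (\<epsilon> * l x))\<close> by 1 costs O(\<epsilon>) times the bound already known
    for g, so each round gains one power of \<epsilon>.\<close>
  have "\<forall>x. (\<lambda>\<epsilon>. g \<epsilon> x) \<in> O[at_right 0](\<lambda>\<epsilon>. \<epsilon> ^ k)" if "k \<le> N" for k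
    using that
  proof (induction k)
    case 0
    then show ?case using bdd by simp
  next
    case (Suc k)
    have IH: "(\<lambda>\<epsilon>. g \<epsilon> x) \<in> O[at_right 0](\<lambda>\<epsilon>. \<epsilon> ^ k)" for x
      using Suc by simp
    have diff: "(\<lambda>\<epsilon>. g \<epsilon> (x + h) + g \<epsilon> x) \<in> O[at_right 0](\<lambda>\<epsilon>. \<epsilon> ^ Suc k)" for x
    proof -
      have "(\<lambda>\<epsilon>. 1 - exp (- (\<epsilon> * l x))) \<in> O[at_right 0](\<lambda>\<epsilon>. \<epsilon>)"
        by real_asymp
      then have "(\<lambda>\<epsilon>. (1 - exp (- (\<epsilon> * l x))) * g \<epsilon> (x + h)) \<in> O[at_right 0](\<lambda>\<epsilon>. \<epsilon> ^ Suc k)"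
        unfolding power_Suc by (intro landau_o.big.mult IH)
      from sum_in_bigo(1)[OF this landau_o.big_trans[OF alt eps_power_bigo[OF Suc.prems]], of x]
      show ?thesis
        by (simp add: algebra_simps)
    qed
    have "(\<lambda>\<epsilon>. (shift_diff h ^^ n) g \<epsilon> x - (-2) ^ n * g \<epsilon> x) \<in> O[at_right 0](\<lambda>\<epsilon>. \<epsilon> ^ Suc k)" for n x
    proof (induction n arbitrary: x)
      case (Suc n)
      have "(\<lambda>\<epsilon>. ((shift_diff h ^^ n) g \<epsilon> (x + h) - (-2) ^ n * g \<epsilon> (x + h))
          - ((shift_diff h ^^ n) g \<epsilon> x - (-2) ^ n * g \<epsilon> x)
          + (-2) ^ n * (g \<epsilon> (x + h) + g \<epsilon> x)) \<in> O[at_right 0](\<lambda>\<epsilon>. \<epsilon> ^ Suc k)"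
        by (intro sum_in_bigo Suc) (use diff[of x] in simp)
      then show ?case
        unfolding shift_diff_funpow_Suc by (simp add: algebra_simps)
    qed simp
    note iterate = this
    have "(\<lambda>\<epsilon>. (shift_diff h ^^ (2 * N)) g \<epsilon> x
        - ((shift_diff h ^^ (2 * N)) g \<epsilon> x - (-2) ^ (2 * N) * g \<epsilon> x)) \<in> O[at_right 0](\<lambda>\<epsilon>. \<epsilon> ^ Suc k)" for x
      by (rule sum_in_bigo(2)[OF landau_o.big_trans[OF near_poly_shift_diff[OF near] eps_power_bigo[OF Suc.prems]] iterate])
    then have "(\<lambda>\<epsilon>. (-2) ^ (2 * N) * g \<epsilon> x) \<in> O[at_right 0](\<lambda>\<epsilon>. \<epsilon> ^ Suc k)" for x
      by simp
    then show ?case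
      by simp
  qed
  then show ?thesis
    by simp
qed

subsection \<open>Exponential sums\<close>

lemma has_sum_sum:
  fixes f :: "'b \<Rightarrow> 'a \<Rightarrow> real"
  assumes "finite J" "\<And>j. j \<in> J \<Longrightarrow> (f j has_sum s j) A"
  shows "((\<lambda>i. \<Sum>j\<in>J. f j i) has_sum (\<Sum>j\<in>J. s j)) A"
  using assms by (induction J rule: finite_induct) (auto intro: has_sum_add)

lemma exp_minus_partial_sum_le:
  fixes x :: real
  shows "\<bar>exp x - (\<Sum>j<n. x ^ j / fact j)\<bar> \<le> \<bar>x\<bar> ^ n / fact n * exp \<bar>x\<bar>"
proof -
  obtain t where t: "\<bar>t\<bar> \<le> \<bar>x\<bar>" "exp x = (\<Sum>m<n. x ^ m / fact m) + exp t / fact n * x ^ n"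
    using Maclaurin_exp_le[of x n] by auto
  have "\<bar>exp x - (\<Sum>j<n. x ^ j / fact j)\<bar> = \<bar>x\<bar> ^ n / fact n * exp t"
    by (simp add: t(2) abs_mult power_abs)
  also have "\<dots> \<le> \<bar>x\<bar> ^ n / fact n * exp \<bar>x\<bar>"
    using t(1) by (intro mult_left_mono) auto
  finally show ?thesis .
qed

lemma power_div_fact_le_exp:
  fixes x :: real
  assumes "x \<ge> 0"
  shows "x ^ n / fact n \<le> exp x"
proof -
  have "x ^ n / fact n \<le> (\<Sum>j<Suc n. x ^ j / fact j)"
    using assms by (intro member_le_sum) auto
  also obtain t where "exp x = (\<Sum>j<Suc n. x ^ j / fact j) + exp t / fact (Suc n) * x ^ Suc n"
    using Maclaurin_exp_le[of x "Suc n"] by auto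
  then have "(\<Sum>j<Suc n. x ^ j / fact j) \<le> exp x"
    using assms by simp
  finally show ?thesis .
qed

text \<open>\<open>exp(r|y|)\<close> is at most \<open>exp(ry) + exp(-ry)\<close>, so the Taylor remainder of an exponential sum is controlled by its values at \<open>\<plusminus>r\<close>.\<close>

lemma exp_sum_near_poly:
  fixes w Y :: "'a \<Rightarrow> real"
  assumes w: "\<And>i. w i \<ge> 0" and summ: "\<And>x. (\<lambda>i. w i * exp (x * Y i)) summable_on UNIV" and "n > 0"
  defines "\<Phi> \<equiv> \<lambda>x. \<Sum>\<^sub>\<infinity>i. w i * exp (x * Y i)"
  shows "\<exists>P. degree P < n \<and> (\<forall>x \<rho> r. 0 < \<rho> \<longrightarrow> \<rho> + \<bar>x\<bar> \<le> r \<longrightarrow>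
    \<bar>\<Phi> x - poly P x\<bar> \<le> (\<bar>x\<bar> / \<rho>) ^ n * (\<Phi> r + \<Phi> (- r)))"
proof -
  have exp_abs: "exp (r * \<bar>y\<bar>) \<le> exp (r * y) + exp (- r * y)" if "r \<ge> 0" for r y :: real
    by (cases "y \<ge> 0") auto
  have summ_pow: "(\<lambda>i. w i * Y i ^ j) summable_on UNIV" for j
  proof -
    have "(\<lambda>i. fact j * (w i * exp (1 * Y i) + w i * exp (-1 * Y i))) summable_on UNIV"
      by (intro summable_on_cmult_right summable_on_add summ)
    then have "(\<lambda>i. \<bar>w i * Y i ^ j\<bar>) summable_on UNIV"
    proof (rule summable_on_comparison_test)
      fix i
      have "\<bar>Y i\<bar> ^ j \<le> fact j * exp \<bar>Y i\<bar>"
        using power_div_fact_le_exp[of "\<bar>Y i\<bar>" j] by (simp add: field_simps)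
      also have "\<dots> \<le> fact j * (exp (Y i) + exp (- Y i))"
        using exp_abs[of 1 "Y i"] by (intro mult_left_mono) auto
      finally have "w i * \<bar>Y i\<bar> ^ j \<le> w i * (fact j * (exp (Y i) + exp (- Y i)))"
        using w by (intro mult_left_mono) auto
      then show "\<bar>w i * Y i ^ j\<bar> \<le> fact j * (w i * exp (1 * Y i) + w i * exp (-1 * Y i))"
        using w[of i] by (simp add: abs_mult power_abs algebra_simps)
    qed auto
    then show ?thesis
      using summable_on_iff_abs_summable_on_real[of "\<lambda>i. w i * Y i ^ j" UNIV] by (simp only: real_norm_def)
  qed
  \<comment> \<open>The Taylor polynomial at 0; its coefficients are moments of the weights divided
    by factorials.\<close>
  define P where "P = (\<Sum>j<n. monom ((\<Sum>\<^sub>\<infinity>i. w i * Y i ^ j) / fact j) j)"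
  have "degree P < n"
    unfolding P_def using \<open>n > 0\<close> by (intro degree_sum_less) (auto intro: le_less_trans[OF degree_monom_le])
  moreover have "\<bar>\<Phi> x - poly P x\<bar> \<le> (\<bar>x\<bar> / \<rho>) ^ n * (\<Phi> r + \<Phi> (- r))"
    if \<rho>: "0 < \<rho>" "\<rho> + \<bar>x\<bar> \<le> r" for x \<rho> r
  proof -
    let ?S = "\<lambda>i. \<Sum>j<n. w i * Y i ^ j * (x ^ j / fact j)"
    have S: "((\<lambda>i. ?S i) has_sum (\<Sum>j<n. (\<Sum>\<^sub>\<infinity>i. w i * Y i ^ j) * (x ^ j / fact j))) UNIV"
      by (intro has_sum_sum has_sum_cmult_left has_sum_infsum summ_pow finite_lessThan)
    also have "(\<Sum>j<n. (\<Sum>\<^sub>\<infinity>i. w i * Y i ^ j) * (x ^ j / fact j)) = poly P x"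
      unfolding P_def poly_sum poly_monom by (intro sum.cong) auto
    finally have S: "(?S has_sum poly P x) UNIV" .
    have \<Phi>: "((\<lambda>i. w i * exp (y * Y i)) has_sum \<Phi> y) UNIV" for y
      unfolding \<Phi>_def by (intro has_sum_infsum summ)
    have term_le: "\<bar>w i * exp (x * Y i) - ?S i\<bar> \<le> (\<bar>x\<bar> / \<rho>) ^ n * (w i * exp (r * Y i) + w i * exp (- r * Y i))" for i
    proof -
      have "?S i = w i * (\<Sum>j<n. (x * Y i) ^ j / fact j)"
        by (simp add: sum_distrib_left power_mult_distrib algebra_simps)
      then have "\<bar>w i * exp (x * Y i) - ?S i\<bar> = w i * \<bar>exp (x * Y i) - (\<Sum>j<n. (x * Y i) ^ j / fact j)\<bar>"
        using w[of i] by (simp add: abs_mult flip: right_diff_distrib)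
      also have "\<dots> \<le> w i * (\<bar>x * Y i\<bar> ^ n / fact n * exp \<bar>x * Y i\<bar>)"
        by (intro mult_left_mono exp_minus_partial_sum_le w)
      \<comment> \<open>The scale \<rho> is inserted so that the power of \<rho>|Y| is absorbed by
        exp(\<rho>|Y|), leaving (|x|/\<rho>)^n as the small factor.\<close>
      also have "\<bar>x * Y i\<bar> ^ n / fact n = (\<bar>x\<bar> / \<rho>) ^ n * ((\<rho> * \<bar>Y i\<bar>) ^ n / fact n)"
        using \<rho> by (simp add: abs_mult power_mult_distrib power_divide)
      also have "w i * ((\<bar>x\<bar> / \<rho>) ^ n * ((\<rho> * \<bar>Y i\<bar>) ^ n / fact n) * exp \<bar>x * Y i\<bar>)
          \<le> w i * ((\<bar>x\<bar> / \<rho>) ^ n * exp (\<rho> * \<bar>Y i\<bar>) * exp \<bar>x * Y i\<bar>)"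
        using \<rho> by (intro mult_left_mono mult_right_mono power_div_fact_le_exp w) auto
      also have "\<dots> = w i * ((\<bar>x\<bar> / \<rho>) ^ n * exp ((\<rho> + \<bar>x\<bar>) * \<bar>Y i\<bar>))"
        by (simp add: abs_mult exp_add algebra_simps)
      also have "\<dots> \<le> w i * ((\<bar>x\<bar> / \<rho>) ^ n * exp (r * \<bar>Y i\<bar>))"
        using \<rho> by (intro mult_left_mono w) (auto intro: mult_right_mono)
      also have "\<dots> \<le> w i * ((\<bar>x\<bar> / \<rho>) ^ n * (exp (r * Y i) + exp (- r * Y i)))"
        using \<rho> by (intro mult_left_mono w exp_abs) auto
      finally show ?thesis
        by (simp add: algebra_simps)
    qed
    have D: "((\<lambda>i. w i * exp (x * Y i) - ?S i) has_sum (\<Phi> x - poly P x)) UNIV"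
      using has_sum_add[OF \<Phi>[of x] has_sum_uminus[THEN iffD2, of ?S UNIV "- poly P x"]] S by simp
    have B: "((\<lambda>i. (\<bar>x\<bar> / \<rho>) ^ n * (w i * exp (r * Y i) + w i * exp (- r * Y i))) has_sum
        ((\<bar>x\<bar> / \<rho>) ^ n * (\<Phi> r + \<Phi> (- r)))) UNIV"
      by (intro has_sum_cmult_right has_sum_add \<Phi>)
    have "\<Phi> x - poly P x \<le> (\<bar>x\<bar> / \<rho>) ^ n * (\<Phi> r + \<Phi> (- r))"
      by (rule has_sum_mono[OF D B]) (use term_le in \<open>auto simp: abs_le_iff\<close>)
    moreover have "((\<lambda>i. - (w i * exp (x * Y i) - ?S i)) has_sum - (\<Phi> x - poly P x)) UNIV"
      using D has_sum_uminus[of "\<lambda>i. w i * exp (x * Y i) - ?S i" UNIV "- (\<Phi> x - poly P x)"] by simp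
    then have "- (\<Phi> x - poly P x) \<le> (\<bar>x\<bar> / \<rho>) ^ n * (\<Phi> r + \<Phi> (- r))"
      by (rule has_sum_mono[OF _ B]) (use term_le in \<open>auto simp: abs_le_iff\<close>)
    ultimately show ?thesis
      by linarith
  qed
  ultimately show ?thesis
    by blast
qed

subsection \<open>Polynomials in \<open>\<epsilon>\<close>, \<open>\<epsilon>x\<close> and \<open>\<epsilon>x\<^sup>2\<close>\<close>

text \<open>The outer variable of Q is \<epsilon>. The degree bound keeps each term of f bounded for
  x of size \<epsilon>^(-1/2), and it is stable under products, as the expansion of exponentials
  requires.\<close>

definition tame :: "(real \<Rightarrow> real \<Rightarrow> real) \<Rightarrow> bool" where
  "tame f \<longleftrightarrow> (\<exists>Q :: real poly poly. (\<forall>p. degree (coeff Q p) \<le> 2 * p) \<and> (\<forall>\<epsilon> x. f \<epsilon> x = poly (poly Q [:\<epsilon>:]) x))"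

lemma tame_const: "tame (\<lambda>\<epsilon> x. c)"
  unfolding tame_def by (rule exI[of _ "[:[:c:]:]"]) (auto simp: coeff_pCons split: nat.split)

lemma tame_eps: "tame (\<lambda>\<epsilon> x. \<epsilon>)"
  unfolding tame_def by (rule exI[of _ "[:0, [:1:]:]"]) (auto simp: coeff_pCons split: nat.split)

lemma tame_eps_x: "tame (\<lambda>\<epsilon> x. \<epsilon> * x)"
  unfolding tame_def by (rule exI[of _ "[:0, [:0, 1:]:]"]) (auto simp: coeff_pCons split: nat.split)

lemma tame_eps_x2: "tame (\<lambda>\<epsilon> x. \<epsilon> * x\<^sup>2)"
  unfolding tame_def
  by (rule exI[of _ "[:0, [:0, 0, 1:]:]"]) (auto simp: coeff_pCons power2_eq_square split: nat.split)

lemma tame_add: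
  assumes "tame f" "tame g"
  shows "tame (\<lambda>\<epsilon> x. f \<epsilon> x + g \<epsilon> x)"
proof -
  obtain P Q :: "real poly poly" where
    "\<And>p. degree (coeff P p) \<le> 2 * p" "\<And>p. degree (coeff Q p) \<le> 2 * p"
    "\<And>\<epsilon> x. f \<epsilon> x = poly (poly P [:\<epsilon>:]) x" "\<And>\<epsilon> x. g \<epsilon> x = poly (poly Q [:\<epsilon>:]) x"
    using assms unfolding tame_def by metis
  then show ?thesis
    unfolding tame_def by (intro exI[of _ "P + Q"]) (auto intro: degree_add_le)
qed

lemma tame_mult:
  assumes "tame f" "tame g"
  shows "tame (\<lambda>\<epsilon> x. f \<epsilon> x * g \<epsilon> x)"
proof -
  obtain P Q :: "real poly poly" where PQ:
    "\<And>p. degree (coeff P p) \<le> 2 * p" "\<And>p. degree (coeff Q p) \<le> 2 * p"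
    "\<And>\<epsilon> x. f \<epsilon> x = poly (poly P [:\<epsilon>:]) x" "\<And>\<epsilon> x. g \<epsilon> x = poly (poly Q [:\<epsilon>:]) x"
    using assms unfolding tame_def by metis
  have "degree (coeff (P * Q) p) \<le> 2 * p" for p
    unfolding coeff_mult
  proof (rule degree_sum_le)
    fix i assume "i \<in> {..p}"
    then show "degree (coeff P i * coeff Q (p - i)) \<le> 2 * p"
      using degree_mult_le[of "coeff P i" "coeff Q (p - i)"] PQ(1)[of i] PQ(2)[of "p - i"] by simp
  qed simp
  then show ?thesis
    unfolding tame_def using PQ by (intro exI[of _ "P * Q"]) auto
qed

lemma tame_cmult: "tame f \<Longrightarrow> tame (\<lambda>\<epsilon> x. c * f \<epsilon> x)"
  by (intro tame_mult tame_const)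

lemma tame_power: "tame f \<Longrightarrow> tame (\<lambda>\<epsilon> x. f \<epsilon> x ^ n)"
  by (induction n) (auto intro: tame_mult tame_const)

lemma tame_sum: "(\<And>i. i \<in> I \<Longrightarrow> tame (f i)) \<Longrightarrow> tame (\<lambda>\<epsilon> x. \<Sum>i\<in>I. f i \<epsilon> x)"
  by (induction I rule: infinite_finite_induct) (auto intro: tame_add tame_const)

text \<open>Truncation keeps the powers \<epsilon>^p with p < N, whose coefficients have degree at
  most 2N - 2; for fixed x the discarded terms are O(\<epsilon>^N).\<close>

lemma tame_imp_near_poly:
  assumes "tame f" "N > 0"
  shows "near_poly N f"
proof -
  obtain Q :: "real poly poly" where Q: "\<And>p. degree (coeff Q p) \<le> 2 * p"
    "\<And>\<epsilon> x. f \<epsilon> x = poly (poly Q [:\<epsilon>:]) x"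
    using assms(1) unfolding tame_def by metis
  define I where "I = {..degree Q}"
  define P where "P = (\<lambda>\<epsilon>. \<Sum>i\<in>I \<inter> {..<N}. coeff Q i * [:\<epsilon>:] ^ i)"
  have "degree (P \<epsilon>) < 2 * N" for \<epsilon>
    unfolding P_def
  proof (rule degree_sum_less)
    fix i assume i: "i \<in> I \<inter> {..<N}"
    have "degree (coeff Q i * [:\<epsilon>:] ^ i) \<le> degree (coeff Q i) + degree ([:\<epsilon>:] ^ i)"
      by (rule degree_mult_le)
    also have "degree ([:\<epsilon>:] ^ i) \<le> 0"
      using degree_power_le[of "[:\<epsilon>:]" i] by simp
    finally show "degree (coeff Q i * [:\<epsilon>:] ^ i) < 2 * N"
      using Q(1)[of i] i by auto
  qed (use assms in simp)
  moreover have "(\<lambda>\<epsilon>. f \<epsilon> x - poly (P \<epsilon>) x) \<in> O[at_right 0](\<lambda>\<epsilon>. \<epsilon> ^ N)" for x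
  proof -
    have "f \<epsilon> x - poly (P \<epsilon>) x = (\<Sum>i\<in>I - {..<N}. poly (coeff Q i) x * \<epsilon> ^ i)" for \<epsilon>
    proof -
      have "f \<epsilon> x = (\<Sum>i\<in>I. poly (coeff Q i) x * \<epsilon> ^ i)"
        by (simp add: Q(2) poly_altdef[of Q] poly_sum I_def)
      also have "\<dots> = (\<Sum>i\<in>I - {..<N}. poly (coeff Q i) x * \<epsilon> ^ i) + (\<Sum>i\<in>I \<inter> {..<N}. poly (coeff Q i) x * \<epsilon> ^ i)"
        using sum.Int_Diff[of I _ "{..<N}"] by (simp add: I_def add.commute)
      finally show ?thesis
        by (simp add: P_def poly_sum)
    qed
    moreover have "(\<lambda>\<epsilon>. \<Sum>i\<in>I - {..<N}. poly (coeff Q i) x * \<epsilon> ^ i) \<in> O[at_right 0](\<lambda>\<epsilon>. \<epsilon> ^ N)"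
      using eps_power_bigo[of N] by (intro big_sum_in_bigo) (auto simp: not_less)
    ultimately show ?thesis
      by simp
  qed
  ultimately show ?thesis
    unfolding near_poly_def by blast
qed

lemma exp_partial_sum_bigo:
  assumes "k \<in> O[at_right 0](\<lambda>\<epsilon>::real. \<epsilon>)"
  shows "(\<lambda>\<epsilon>. exp (k \<epsilon>) - (\<Sum>j<N. k \<epsilon> ^ j / fact j)) \<in> O[at_right 0](\<lambda>\<epsilon>. \<epsilon> ^ N)"
proof -
  have "((\<lambda>\<epsilon>::real. \<epsilon>) \<longlongrightarrow> 0) (at_right 0)"
    by (rule tendsto_ident_at)
  then have "k \<in> o[at_right 0](\<lambda>_. 1)"
    by (intro landau_o.big_small_trans[OF assms]) real_asymp
  then have "(k \<longlongrightarrow> 0) (at_right 0)"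
    using smalloD_tendsto by fastforce
  then have ev: "eventually (\<lambda>\<epsilon>. \<bar>k \<epsilon>\<bar> < 1) (at_right 0)"
    using order_tendstoD(2)[OF tendsto_rabs, of k 0 "at_right 0" 1] by simp
  have "(\<lambda>\<epsilon>. exp (k \<epsilon>) - (\<Sum>j<N. k \<epsilon> ^ j / fact j)) \<in> O[at_right 0](\<lambda>\<epsilon>. k \<epsilon> ^ N)"
  proof (rule bigoI)
    show "\<forall>\<^sub>F \<epsilon> in at_right 0. norm (exp (k \<epsilon>) - (\<Sum>j<N. k \<epsilon> ^ j / fact j)) \<le> exp 1 / fact N * norm (k \<epsilon> ^ N)"
      using ev
    proof eventually_elim
      case (elim \<epsilon>)
      have "\<bar>exp (k \<epsilon>) - (\<Sum>j<N. k \<epsilon> ^ j / fact j)\<bar> \<le> \<bar>k \<epsilon>\<bar> ^ N / fact N * exp \<bar>k \<epsilon>\<bar>"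
        by (rule exp_minus_partial_sum_le)
      also have "\<dots> \<le> \<bar>k \<epsilon>\<bar> ^ N / fact N * exp 1"
        using elim by (intro mult_left_mono) auto
      finally show ?case
        by (simp add: power_abs field_simps)
    qed
  qed
  also have "(\<lambda>\<epsilon>. k \<epsilon> ^ N) \<in> O[at_right 0](\<lambda>\<epsilon>. \<epsilon> ^ N)"
    by (intro landau_o.big_power assms)
  finally show ?thesis .
qed

section \<open>Modular functions near the cusp 0\<close>

lemma ln_one_plus_bigo:
  fixes f :: "real \<Rightarrow> real"
  assumes "f \<in> O[F](g)" "(f \<longlongrightarrow> 0) F"
  shows "(\<lambda>x. ln (1 + f x)) \<in> O[F](g)"
proof -
  have "\<bar>ln (1 + x)\<bar> \<le> 2 * \<bar>x\<bar>" if "\<bar>x\<bar> \<le> 1/2" for x :: real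
  proof -
    have "\<bar>ln (1 + x) - x\<bar> \<le> 2 * x\<^sup>2"
      using abs_ln_one_plus_x_minus_x_bound[OF that] .
    moreover have "2 * x\<^sup>2 \<le> \<bar>x\<bar>"
      using mult_right_mono[OF that, of "\<bar>x\<bar>"] by (simp add: power2_eq_square)
    ultimately show ?thesis
      by linarith
  qed
  moreover have "eventually (\<lambda>x. \<bar>f x\<bar> < 1/2) F"
    using order_tendstoD(2)[OF tendsto_rabs[OF assms(2)], of "1/2"] by simp
  ultimately have "(\<lambda>x. ln (1 + f x)) \<in> O[F](f)"
    by (intro bigoI[of _ 2]) (auto elim!: eventually_mono)
  then show ?thesis
    using assms(1) by (rule landau_o.big_trans)
qed

text \<open>The matrix S sends z = 2 pi i/\<epsilon> to the point where q = exp(-\<epsilon>), and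
  the local parameter of the cusp at z is W = exp(-4 pi^2/(N \<epsilon>)), smaller than every power
  of \<epsilon>. If the Laurent series in W starts at order k, then k ln W is the 1/\<epsilon> term,
  the weight supplies the multiple of ln \<epsilon>, and the rest is a constant plus O(W).\<close>

lemma modular_expansion_at_zero:
  assumes mod: "is_modular f" and nz: "\<And>\<epsilon>. \<epsilon> > 0 \<Longrightarrow> f (\<i> * of_real (\<epsilon> / (2 * pi))) \<noteq> 0"
  shows "\<exists>c \<alpha> w. (\<lambda>\<epsilon>. ln (norm (f (\<i> * of_real (\<epsilon> / (2 * pi))))) - (c + \<alpha> / \<epsilon> + w * ln \<epsilon>))
    \<in> O[at_right 0](\<lambda>\<epsilon>. \<epsilon> ^ n)"
proof -
  define S :: "int^2^2" where "S = vector [vector [0, -1], vector [1, 0]]"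
  have S: "S$1$1 = 0" "S$1$2 = -1" "S$2$1 = 1" "S$2$2 = 0"
    by (simp_all add: S_def)
  have "S \<in> carrier SL2Z"
    by (simp add: SL2Z_def det_2 S)
  then obtain m where "meromorphic_at_cusp m S f"
    using mod unfolding is_modular_def modular_function_def by blast
  then obtain N g Y where N: "N \<ge> 1" and g: "g meromorphic_on {0}" and "Y > 0"
    and eq: "\<And>z. Im z > Y \<Longrightarrow> csqrt (denom S z) powi (-m) * f (mobius_act S z) = g (qpow z (1 / real N))"
    unfolding meromorphic_at_cusp_def by blast
  define \<kappa> where "\<kappa> = 4 * pi\<^sup>2 / real N"
  have \<kappa>: "\<kappa> > 0"
    using N by (simp add: \<kappa>_def)
  define W where "W = (\<lambda>\<epsilon>. exp (- \<kappa> / \<epsilon>))"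
  define F where "F = (\<lambda>\<epsilon>. f (\<i> * of_real (\<epsilon> / (2 * pi))))"
  have eqF: "sqrt (2 * pi / \<epsilon>) powi (-m) * norm (F \<epsilon>) = norm (g (of_real (W \<epsilon>)))"
    if \<epsilon>: "0 < \<epsilon>" "\<epsilon> < 2 * pi / Y" for \<epsilon>
  proof -
    define z where "z = \<i> * of_real (2 * pi / \<epsilon>)"
    have "Im z > Y"
      using \<epsilon> \<open>Y > 0\<close> by (simp add: z_def field_simps)
    from eq[OF this] have "norm (csqrt (denom S z) powi (-m) * f (mobius_act S z)) = norm (g (qpow z (1 / real N)))"
      by simp
    moreover have "denom S z = z"
      by (simp add: denom_def S)
    moreover have "mobius_act S z = \<i> * of_real (\<epsilon> / (2 * pi))"
      using \<epsilon> by (simp add: mobius_act_def S z_def field_simps)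
    moreover have "norm z = 2 * pi / \<epsilon>"
      using \<epsilon> by (simp add: z_def norm_mult norm_divide)
    moreover have "qpow z (1 / real N) = of_real (W \<epsilon>)"
      by (simp add: qpow_def z_def W_def \<kappa>_def power2_eq_square field_simps flip: exp_of_real)
    ultimately show ?thesis
      by (simp add: norm_mult norm_power_int F_def)
  qed
  have W0: "(W \<longlongrightarrow> 0) (at_right 0)"
    unfolding W_def using \<kappa> by real_asymp
  have Wn: "W \<in> O[at_right 0](\<lambda>\<epsilon>. \<epsilon> ^ n)"
    unfolding W_def using \<kappa> by real_asymp
  have small: "eventually (\<lambda>\<epsilon>. 0 < \<epsilon> \<and> \<epsilon> < 2 * pi / Y) (at_right 0)"
    using eventually_at_right_real[of 0 "2 * pi / Y"] \<open>Y > 0\<close> by (simp add: eventually_mono)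
  have "filterlim (\<lambda>\<epsilon>. complex_of_real (W \<epsilon>)) (at 0) (at_right 0)"
    unfolding filterlim_at using tendsto_of_real[OF W0, where ?'a = complex] by (simp add: W_def)
  \<comment> \<open>Nonvanishing of f on the imaginary axis shows that g is not identically 0 near
    0, so that its order there is meaningful.\<close>
  moreover have "eventually (\<lambda>\<epsilon>. g (of_real (W \<epsilon>)) \<noteq> 0) (at_right 0)"
    using small
  proof eventually_elim
    case (elim \<epsilon>)
    have "sqrt (2 * pi / \<epsilon>) powi (-m) * norm (F \<epsilon>) \<noteq> 0"
      using nz[of \<epsilon>] elim by (simp add: F_def)
    then show ?case
      using eqF[of \<epsilon>] elim by simp
  qed
  ultimately have freq: "\<exists>\<^sub>F w in at 0. g w \<noteq> 0"
    unfolding frequently_def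
  proof (intro notI)
    assume lim: "filterlim (\<lambda>\<epsilon>. complex_of_real (W \<epsilon>)) (at 0) (at_right 0)"
      and ne: "\<forall>\<^sub>F \<epsilon> in at_right 0. g (of_real (W \<epsilon>)) \<noteq> 0"
      and ev: "\<forall>\<^sub>F w in at 0. \<not> g w \<noteq> 0"
    have "\<forall>\<^sub>F \<epsilon> in at_right 0. \<not> g (of_real (W \<epsilon>)) \<noteq> 0"
      by (rule eventually_compose_filterlim[OF ev lim])
    with ne have "\<forall>\<^sub>F \<epsilon> in at_right (0::real). False"
      by eventually_elim simp
    then show False
      by simp
  qed
  define h where "h = zor_poly g 0"
  define k where "k = zorder g 0"
  obtain r where "h 0 \<noteq> 0" and r: "r > 0" "h holomorphic_on cball 0 r"
    and gh: "\<And>w. w \<in> cball 0 r - {0} \<Longrightarrow> g w = h w * w powi k \<and> h w \<noteq> 0"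
    using zorder_exist[of g 0] meromorphic_on_isolated_singularity[of g 0]
      meromorphic_on_not_essential[of g 0] g freq unfolding h_def k_def by auto
  have "h field_differentiable (at 0)"
    using r by (meson ball_subset_cball centre_in_ball holomorphic_on_imp_differentiable_at holomorphic_on_subset open_ball)
  then obtain D where D: "(h has_field_derivative D) (at 0)"
    unfolding field_differentiable_def by blast
  have hlim: "((\<lambda>\<epsilon>. (h (of_real (W \<epsilon>)) - h 0) / of_real (W \<epsilon>)) \<longlongrightarrow> D) (at_right 0)"
    using filterlim_compose[OF D[unfolded has_field_derivative_iff] \<open>filterlim (\<lambda>\<epsilon>. complex_of_real (W \<epsilon>)) (at 0) (at_right 0)\<close>]
    by simp
  then have "((\<lambda>\<epsilon>. norm ((h (of_real (W \<epsilon>)) - h 0) / of_real (W \<epsilon>))) \<longlongrightarrow> norm D) (at_right 0)"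
    by (rule tendsto_norm)
  then have "(\<lambda>\<epsilon>. norm ((h (of_real (W \<epsilon>)) - h 0) / of_real (W \<epsilon>))) \<in> O[at_right 0](\<lambda>_. 1)"
    by (intro bigoI_tendsto[of _ _ "norm D"]) auto
  then have "(\<lambda>\<epsilon>. norm ((h (of_real (W \<epsilon>)) - h 0) / of_real (W \<epsilon>)) * W \<epsilon>) \<in> O[at_right 0](\<lambda>\<epsilon>. 1 * \<epsilon> ^ n)"
    by (intro landau_o.big.mult Wn)
  moreover have "norm ((h (of_real (W \<epsilon>)) - h 0) / of_real (W \<epsilon>)) * W \<epsilon> = norm (h (of_real (W \<epsilon>)) - h 0)" for \<epsilon>
    by (simp add: norm_divide W_def)
  ultimately have hn: "(\<lambda>\<epsilon>. norm (h (of_real (W \<epsilon>)) - h 0)) \<in> O[at_right 0](\<lambda>\<epsilon>. \<epsilon> ^ n)"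
    by simp
  \<comment> \<open>The relative error of |h(W)| against |h(0)|, so that ln |h(W)| = ln |h(0)| + ln
    (1 + v).\<close>
  define v where "v = (\<lambda>\<epsilon>. norm (h (of_real (W \<epsilon>))) / norm (h 0) - 1)"
  have v_le: "\<bar>v \<epsilon>\<bar> \<le> 1 / norm (h 0) * norm (h (of_real (W \<epsilon>)) - h 0)" for \<epsilon>
  proof -
    have "v \<epsilon> = (norm (h (of_real (W \<epsilon>))) - norm (h 0)) / norm (h 0)"
      using \<open>h 0 \<noteq> 0\<close> by (simp add: v_def field_simps)
    then show ?thesis
      using norm_triangle_ineq3[of "h (of_real (W \<epsilon>))" "h 0"] \<open>h 0 \<noteq> 0\<close>
      by (simp add: divide_right_mono)
  qed
  have "v \<in> O[at_right 0](\<lambda>\<epsilon>. norm (h (of_real (W \<epsilon>)) - h 0))"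
    by (rule bigoI[of _ "1 / norm (h 0)"]) (use v_le in auto)
  then have vn: "v \<in> O[at_right 0](\<lambda>\<epsilon>. \<epsilon> ^ n)"
    using hn by (rule landau_o.big_trans)
  have "((\<lambda>\<epsilon>. (h (of_real (W \<epsilon>)) - h 0) / of_real (W \<epsilon>) * of_real (W \<epsilon>)) \<longlongrightarrow> D * of_real 0) (at_right 0)"
    by (intro tendsto_mult hlim tendsto_of_real W0)
  then have "((\<lambda>\<epsilon>. h (of_real (W \<epsilon>)) - h 0) \<longlongrightarrow> 0) (at_right 0)"
    by (simp add: W_def)
  then have "((\<lambda>\<epsilon>. 1 / norm (h 0) * norm (h (of_real (W \<epsilon>)) - h 0)) \<longlongrightarrow> 1 / norm (h 0) * 0) (at_right 0)"
    by (intro tendsto_mult tendsto_const tendsto_norm_zero)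
  then have "(v \<longlongrightarrow> 0) (at_right 0)"
    by (intro Lim_null_comparison[of v "\<lambda>\<epsilon>. 1 / norm (h 0) * norm (h (of_real (W \<epsilon>)) - h 0)"])
       (use v_le in \<open>auto intro: always_eventually\<close>)
  with vn have lnv: "(\<lambda>\<epsilon>. ln (1 + v \<epsilon>)) \<in> O[at_right 0](\<lambda>\<epsilon>. \<epsilon> ^ n)"
    by (rule ln_one_plus_bigo)
  define c where "c = ln (norm (h 0)) + of_int m / 2 * ln (2 * pi)"
  define \<alpha> where "\<alpha> = - \<kappa> * of_int k"
  define w where "w = - (of_int m / 2 :: real)"
  have "eventually (\<lambda>\<epsilon>. W \<epsilon> < r) (at_right 0)"
    using order_tendstoD(2)[OF W0 r(1)] .
  with small have "eventually (\<lambda>\<epsilon>. ln (norm (F \<epsilon>)) - (c + \<alpha> / \<epsilon> + w * ln \<epsilon>) = ln (1 + v \<epsilon>)) (at_right 0)"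
  proof eventually_elim
    case (elim \<epsilon>)
    then have \<epsilon>: "\<epsilon> > 0" "\<epsilon> < 2 * pi / Y" and Wr: "W \<epsilon> < r" by auto
    have Wpos: "W \<epsilon> > 0"
      by (simp add: W_def)
    then have "complex_of_real (W \<epsilon>) \<in> cball 0 r - {0}"
      using Wr by simp
    note gh' = gh[OF this]
    have "norm (F \<epsilon>) > 0"
      using nz[of \<epsilon>] \<epsilon> by (simp add: F_def)
    have "sqrt (2 * pi / \<epsilon>) powi (-m) * norm (F \<epsilon>) = norm (h (of_real (W \<epsilon>))) * W \<epsilon> powi k"
      using eqF[OF \<epsilon>] gh' Wpos by (simp add: norm_mult norm_power_int)
    then have "ln (sqrt (2 * pi / \<epsilon>) powi (-m) * norm (F \<epsilon>)) = ln (norm (h (of_real (W \<epsilon>))) * W \<epsilon> powi k)"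
      by simp
    moreover have "ln (sqrt (2 * pi / \<epsilon>) powi (-m) * norm (F \<epsilon>)) = - of_int m * (ln (2 * pi / \<epsilon>) / 2) + ln (norm (F \<epsilon>))"
      using \<epsilon> \<open>norm (F \<epsilon>) > 0\<close> by (simp add: ln_mult ln_sqrt powr_real_of_int'[symmetric] ln_powr)
    moreover have "ln (norm (h (of_real (W \<epsilon>))) * W \<epsilon> powi k) = ln (norm (h (of_real (W \<epsilon>)))) + of_int k * (- \<kappa> / \<epsilon>)"
      using gh' Wpos by (simp add: ln_mult powr_real_of_int'[symmetric] ln_powr) (simp add: W_def)
    moreover have "ln (1 + v \<epsilon>) = ln (norm (h (of_real (W \<epsilon>)))) - ln (norm (h 0))"
      using gh' \<open>h 0 \<noteq> 0\<close> by (simp add: v_def ln_div)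
    moreover have "ln (2 * pi / \<epsilon>) = ln (2 * pi) - ln \<epsilon>"
      using \<epsilon> by (simp add: ln_div)
    ultimately have "ln (norm (F \<epsilon>)) = ln (norm (h 0)) + ln (1 + v \<epsilon>) + of_int k * (- \<kappa> / \<epsilon>)
        + of_int m * ((ln (2 * pi) - ln \<epsilon>) / 2)"
      by simp
    then show ?case
      by (simp add: c_def \<alpha>_def w_def algebra_simps diff_divide_distrib)
  qed
  then have "(\<lambda>\<epsilon>. ln (norm (F \<epsilon>)) - (c + \<alpha> / \<epsilon> + w * ln \<epsilon>)) \<in> O[at_right 0](\<lambda>\<epsilon>. \<epsilon> ^ n)"
    using lnv by (subst landau_o.big.in_cong)
  then show ?thesis
    unfolding F_def by blast
qed

section \<open>Nahm sums on the imaginary axis\<close>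

text \<open>The point \<open>axis \<epsilon>\<close> is the one at which \<open>q = exp(-\<epsilon>)\<close>.\<close>

definition axis :: "real \<Rightarrow> complex" where
  "axis \<epsilon> = \<i> * of_real (\<epsilon> / (2 * pi))"

lemma Im_axis [simp]: "Im (axis \<epsilon>) > 0 \<longleftrightarrow> \<epsilon> > 0"
  by (simp add: axis_def zero_less_divide_iff)

lemma qpow_axis: "qpow (axis \<epsilon>) x = of_real (exp (- (\<epsilon> * x)))"
  by (simp add: qpow_def axis_def field_simps flip: exp_of_real)

definition rfact :: "real \<Rightarrow> nat \<Rightarrow> real" where
  "rfact \<epsilon> n = (\<Prod>k=1..n. 1 - exp (- (\<epsilon> * real k)))"

definition rfact_inf :: "real \<Rightarrow> real" where
  "rfact_inf \<epsilon> = Re (qfact_inf (axis \<epsilon>))"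

lemma qfact_axis: "qfact (axis \<epsilon>) n = of_real (rfact \<epsilon> n)"
  by (simp add: qfact_def rfact_def qpow_axis)

lemma rfact_pos: "\<epsilon> > 0 \<Longrightarrow> rfact \<epsilon> n > 0"
  unfolding rfact_def by (intro prod_pos) auto

lemma rfact_tendsto:
  assumes "\<epsilon> > 0"
  shows "rfact \<epsilon> \<longlonglongrightarrow> rfact_inf \<epsilon>"
  using tendsto_Re[OF qfact_tendsto[of "axis \<epsilon>"]] assms
  by (simp add: rfact_inf_def qfact_axis)

lemma qfact_inf_axis:
  assumes "\<epsilon> > 0"
  shows "qfact_inf (axis \<epsilon>) = of_real (rfact_inf \<epsilon>)"
proof -
  have "(\<lambda>n. qfact (axis \<epsilon>) n) \<longlonglongrightarrow> of_real (rfact_inf \<epsilon>)"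
    unfolding qfact_axis by (intro tendsto_of_real rfact_tendsto assms)
  then show ?thesis
    using qfact_tendsto[of "axis \<epsilon>"] assms LIMSEQ_unique by auto
qed

lemma rfact_inf_pos:
  assumes "\<epsilon> > 0"
  shows "rfact_inf \<epsilon> > 0"
proof -
  have "rfact_inf \<epsilon> \<ge> 0"
    by (rule LIMSEQ_le_const[OF rfact_tendsto[OF assms]])
       (use rfact_pos[OF assms] in \<open>auto intro!: exI[of _ 0] less_imp_le\<close>)
  moreover have "rfact_inf \<epsilon> \<noteq> 0"
    using qfact_inf_nonzero[of "axis \<epsilon>"] assms by (simp add: qfact_inf_axis)
  ultimately show ?thesis
    by simp
qed

section \<open>The double series as a series of positive reals\<close>

definition rterm :: "real \<Rightarrow> real \<Rightarrow> real \<Rightarrow> real \<Rightarrow> nat \<times> nat \<Rightarrow> real" where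
  "rterm a \<epsilon> b c p = exp (- (\<epsilon> * nahm_exponent a b c p)) / (rfact \<epsilon> (fst p) * rfact \<epsilon> (snd p))"

definition rnahm :: "real \<Rightarrow> real \<Rightarrow> real \<Rightarrow> real \<Rightarrow> real" where
  "rnahm a \<epsilon> b c = (\<Sum>\<^sub>\<infinity>p\<in>UNIV. rterm a \<epsilon> b c p)"

lemma nahm_term_axis: "nahm_term (axis \<epsilon>) a b c p = of_real (rterm a \<epsilon> b c p)"
  by (simp add: nahm_term_def rterm_def qpow_axis qfact_axis)

lemma rterm_pos: "\<epsilon> > 0 \<Longrightarrow> rterm a \<epsilon> b c p > 0"
  by (simp add: rterm_def rfact_pos)

lemma rterm_summable:
  assumes "a > 1/2" "\<epsilon> > 0"
  shows "rterm a \<epsilon> b c summable_on A"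
proof -
  have "(\<lambda>p. norm (nahm_term (axis \<epsilon>) a b c p)) summable_on UNIV"
    by (intro nahm_term_abs_summable) (use assms in auto)
  then have "rterm a \<epsilon> b c summable_on UNIV"
    using rterm_pos[OF assms(2)] by (simp add: nahm_term_axis less_imp_le)
  then show ?thesis
    by (rule summable_on_subset_banach) auto
qed

lemma nahm2_axis:
  assumes "a > 1/2" "\<epsilon> > 0"
  shows "nahm2 (axis \<epsilon>) a b c = of_real (rnahm a \<epsilon> b c)"
  unfolding nahm2_def rnahm_def nahm_term_axis
  by (intro infsumI has_sum_of_real has_sum_infsum rterm_summable assms)

lemma rnahm_pos:
  assumes "a > 1/2" "\<epsilon> > 0"
  shows "rnahm a \<epsilon> b c > 0"
proof -
  have "0 < (\<Sum>p\<in>{(0,0)}. rterm a \<epsilon> b c p)"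
    using rterm_pos[OF assms(2)] by simp
  also have "\<dots> \<le> rnahm a \<epsilon> b c"
    unfolding rnahm_def
    by (intro finite_sum_le_infsum rterm_summable assms) (use rterm_pos[OF assms(2)] in \<open>auto intro: less_imp_le\<close>)
  finally show ?thesis .
qed

lemma rnahm_commute:
  assumes "a > 1/2" "\<epsilon> > 0"
  shows "rnahm a \<epsilon> b c = rnahm a \<epsilon> c b"
  using nahm2_commute[of "axis \<epsilon>" a b c] by (simp add: nahm2_axis[OF assms])

lemma rnahm_shift:
  assumes "a > 1/2" "\<epsilon> > 0"
  shows "rnahm a \<epsilon> b c = rnahm a \<epsilon> (b + 1) c + exp (- (\<epsilon> * (a/2 + b))) * rnahm a \<epsilon> (b + a) (c + 1 - a)"
proof -
  have "complex_of_real (rnahm a \<epsilon> b c) =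
      of_real (rnahm a \<epsilon> (b + 1) c + exp (- (\<epsilon> * (a/2 + b))) * rnahm a \<epsilon> (b + a) (c + 1 - a))"
    using nahm2_shift[of a "axis \<epsilon>" b c] assms by (simp add: nahm2_axis qpow_axis)
  then show ?thesis
    by (simp only: of_real_eq_iff)
qed

text \<open>The arithmetic--geometric mean inequality, applied to each summand.\<close>

lemma rnahm_midpoint:
  assumes "a > 1/2" "\<epsilon> > 0"
  shows "2 * exp (- (\<eta> / 2)) * rnahm a \<epsilon> ((b + b') / 2) ((c + c') / 2) \<le> rnahm a \<epsilon> b c + exp (- \<eta>) * rnahm a \<epsilon> b' c'"
proof -
  have amgm: "2 * exp ((u + v) / 2) \<le> exp u + exp v" for u v :: real
  proof -
    have "0 \<le> (exp (u / 2) - exp (v / 2))\<^sup>2"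
      by simp
    also have "\<dots> = exp u + exp v - 2 * exp ((u + v) / 2)"
      by (simp add: power2_eq_square algebra_simps add_divide_distrib flip: exp_add)
    finally show ?thesis by simp
  qed
  have le: "2 * exp (- (\<eta> / 2)) * rterm a \<epsilon> ((b + b') / 2) ((c + c') / 2) p
      \<le> rterm a \<epsilon> b c p + exp (- \<eta>) * rterm a \<epsilon> b' c' p" for p
  proof -
    let ?D = "rfact \<epsilon> (fst p) * rfact \<epsilon> (snd p)"
    let ?u = "- (\<epsilon> * nahm_exponent a b c p)" and ?v = "- \<eta> - \<epsilon> * nahm_exponent a b' c' p"
    have "- (\<eta> / 2) + - (\<epsilon> * nahm_exponent a ((b + b') / 2) ((c + c') / 2) p) = (?u + ?v) / 2"
      by (cases p) (simp add: nahm_exponent_def field_simps)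
    then have "2 * exp (- (\<eta> / 2)) * rterm a \<epsilon> ((b + b') / 2) ((c + c') / 2) p = 2 * exp ((?u + ?v) / 2) / ?D"
      by (simp add: rterm_def flip: exp_add)
    also have "\<dots> \<le> (exp ?u + exp ?v) / ?D"
      using rfact_pos[OF assms(2)] by (intro divide_right_mono amgm) (simp add: less_imp_le)
    also have "\<dots> = rterm a \<epsilon> b c p + exp (- \<eta>) * rterm a \<epsilon> b' c' p"
      by (simp add: rterm_def add_divide_distrib flip: exp_add)
    finally show ?thesis .
  qed
  have "2 * exp (- (\<eta> / 2)) * rnahm a \<epsilon> ((b + b') / 2) ((c + c') / 2)
      = (\<Sum>\<^sub>\<infinity>p\<in>UNIV. 2 * exp (- (\<eta> / 2)) * rterm a \<epsilon> ((b + b') / 2) ((c + c') / 2) p)"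
    by (simp only: rnahm_def infsum_cmult_right')
  also have "\<dots> \<le> (\<Sum>\<^sub>\<infinity>p\<in>UNIV. rterm a \<epsilon> b c p + exp (- \<eta>) * rterm a \<epsilon> b' c' p)"
    by (intro infsum_mono summable_on_cmult_right summable_on_add rterm_summable assms le)
  also have "\<dots> = rnahm a \<epsilon> b c + exp (- \<eta>) * rnahm a \<epsilon> b' c'"
    unfolding rnahm_def
    by (subst infsum_add) (auto intro!: summable_on_cmult_right rterm_summable assms simp: infsum_cmult_right')
  finally show ?thesis .
qed

subsection \<open>Theta series\<close>

definition rtheta :: "real \<Rightarrow> real \<Rightarrow> real \<Rightarrow> real" where
  "rtheta a \<epsilon> d = (\<Sum>\<^sub>\<infinity>k\<in>(UNIV::int set). exp (- (\<epsilon> * (a * (real_of_int k)\<^sup>2 / 2 + d * real_of_int k))))"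

lemma rtheta_summable:
  assumes "a > 0" "\<epsilon> > 0"
  shows "(\<lambda>k::int. exp (- (\<epsilon> * (a * (real_of_int k)\<^sup>2 / 2 + d * real_of_int k)))) summable_on A"
proof -
  have "(\<lambda>k::int. exp (- ((\<epsilon> * a / 2) * (real_of_int k)\<^sup>2 + (\<epsilon> * d) * real_of_int k))) summable_on UNIV"
    by (intro summable_on_gaussian_int) (use assms in auto)
  then have "(\<lambda>k::int. exp (- (\<epsilon> * (a * (real_of_int k)\<^sup>2 / 2 + d * real_of_int k)))) summable_on UNIV"
    by (simp add: algebra_simps)
  then show ?thesis
    by (rule summable_on_subset_banach) auto
qed

lemma rtheta_pos:
  assumes "a > 0" "\<epsilon> > 0"
  shows "rtheta a \<epsilon> d > 0"
proof -
  have "0 < (\<Sum>k\<in>{0::int}. exp (- (\<epsilon> * (a * (real_of_int k)\<^sup>2 / 2 + d * real_of_int k))))"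
    by simp
  also have "\<dots> \<le> rtheta a \<epsilon> d"
    unfolding rtheta_def by (intro finite_sum_le_infsum rtheta_summable assms) auto
  finally show ?thesis .
qed

lemma rnahm_antidiagonal:
  assumes "a > 1/2" "\<epsilon> > 0"
  shows "rnahm a \<epsilon> d (- d) = rtheta a \<epsilon> d / rfact_inf \<epsilon>"
proof -
  have "(\<Sum>\<^sub>\<infinity>k\<in>(UNIV::int set). qpow (axis \<epsilon>) (a * (real_of_int k)\<^sup>2 / 2 + d * real_of_int k)) = of_real (rtheta a \<epsilon> d)"
    unfolding qpow_axis rtheta_def
    by (intro infsumI has_sum_of_real has_sum_infsum rtheta_summable) (use assms in auto)
  then have "complex_of_real (rnahm a \<epsilon> d (- d)) = of_real (rtheta a \<epsilon> d / rfact_inf \<epsilon>)"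
    using nahm2_theta[of a "axis \<epsilon>" d] assms by (simp add: nahm2_axis qfact_inf_axis)
  then show ?thesis
    by (simp only: of_real_eq_iff)
qed

lemma infsum_int_shift:
  fixes f :: "int \<Rightarrow> real"
  shows "(\<Sum>\<^sub>\<infinity>k\<in>UNIV. f (k + j)) = infsum f UNIV"
  by (rule infsum_reindex_bij_witness[of _ "\<lambda>k. k - j" "\<lambda>k. k + j"]) auto

lemma rtheta_add_period:
  "rtheta a \<epsilon> (d + a) = exp (\<epsilon> * (a / 2 + d)) * rtheta a \<epsilon> d"
proof -
  have "rtheta a \<epsilon> (d + a) = (\<Sum>\<^sub>\<infinity>k\<in>UNIV. exp (\<epsilon> * (a / 2 + d)) *
      exp (- (\<epsilon> * (a * (real_of_int (k + 1))\<^sup>2 / 2 + d * real_of_int (k + 1)))))"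
    unfolding rtheta_def
    by (intro infsum_cong) (simp add: power2_eq_square field_simps flip: exp_add)
  also have "\<dots> = exp (\<epsilon> * (a / 2 + d)) * rtheta a \<epsilon> d"
    unfolding infsum_cmult_right' rtheta_def
    using infsum_int_shift[of "\<lambda>k. exp (- (\<epsilon> * (a * (real_of_int k)\<^sup>2 / 2 + d * real_of_int k)))" 1] by simp
  finally show ?thesis .
qed

text \<open>Iterating the quasi-period a gives the exact ratio to d = 0 at 0, a, 2a, ...; these
  points become the interpolation nodes.\<close>

lemma rtheta_period_multiple:
  "rtheta a \<epsilon> (a * real j) = exp (\<epsilon> * (a * (real j)\<^sup>2 / 2)) * rtheta a \<epsilon> 0"
proof (induction j)
  case (Suc j)
  have "rtheta a \<epsilon> (a * real (Suc j)) = rtheta a \<epsilon> (a * real j + a)"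
    by (simp add: algebra_simps)
  also have "\<dots> = exp (\<epsilon> * (a / 2 + a * real j)) * (exp (\<epsilon> * (a * (real j)\<^sup>2 / 2)) * rtheta a \<epsilon> 0)"
    by (simp only: rtheta_add_period Suc)
  also have "\<dots> = exp (\<epsilon> * (a * (real (Suc j))\<^sup>2 / 2)) * rtheta a \<epsilon> 0"
  proof -
    have "\<epsilon> * (a / 2 + a * real j) + \<epsilon> * (a * (real j)\<^sup>2 / 2) = \<epsilon> * (a * (real (Suc j))\<^sup>2 / 2)"
      by (simp add: power2_eq_square field_simps)
    then show ?thesis
      by (simp only: mult.assoc[symmetric] exp_add[symmetric])
  qed
  finally show ?case .
qed simp

text \<open>
  Up to the factor \<open>exp(\<epsilon>d\<^sup>2/2a)\<close> the series sums a Gaussian over \<open>\<int> + d/a\<close>, and on an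
  interval between consecutive integers a Gaussian is at most the sum of its values at the endpoints.
\<close>

lemma rtheta_le:
  assumes "a > 0" "\<epsilon> > 0"
  shows "rtheta a \<epsilon> d \<le> 2 * exp (\<epsilon> * d\<^sup>2 / (2 * a)) * rtheta a \<epsilon> 0"
proof -
  define E where "E = exp (\<epsilon> * d\<^sup>2 / (2 * a))"
  define g where "g = (\<lambda>y::real. exp (- (\<epsilon> * (a * y\<^sup>2 / 2))))"
  define j where "j = \<lfloor>d / a\<rfloor>"
  have g: "(\<lambda>k::int. g (real_of_int k)) summable_on A" for A
    using rtheta_summable[OF assms, of 0 A] by (simp add: g_def)
  have g': "(\<lambda>k::int. g (real_of_int (k + i))) summable_on UNIV" for i
    using summable_on_reindex_bij_witness[of UNIV "\<lambda>k. k - i" "\<lambda>k. k + i" UNIV "\<lambda>k. g (real_of_int k)" "\<lambda>k. g (real_of_int (k + i))"] g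
    by auto
  have th0: "(\<Sum>\<^sub>\<infinity>k\<in>UNIV. g (real_of_int (k + i))) = rtheta a \<epsilon> 0" for i
    using infsum_int_shift[of "\<lambda>k. g (real_of_int k)" i] by (simp add: g_def rtheta_def)
  have gle: "g y \<le> g x" if "x\<^sup>2 \<le> y\<^sup>2" for x y
    using that assms by (simp add: g_def mult_left_mono divide_right_mono)
  have le: "exp (- (\<epsilon> * (a * (real_of_int k)\<^sup>2 / 2 + d * real_of_int k)))
      \<le> E * (g (real_of_int (k + j)) + g (real_of_int (k + (j + 1))))" for k :: int
  proof -
    define y where "y = real_of_int k + d / a"
    have y: "real_of_int (k + j) \<le> y" "y \<le> real_of_int (k + (j + 1))"
      unfolding y_def j_def by linarith+
    have "exp (- (\<epsilon> * (a * (real_of_int k)\<^sup>2 / 2 + d * real_of_int k))) = E * g y"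
      using assms by (simp add: E_def g_def y_def power2_eq_square field_simps flip: exp_add)
    also have "g y \<le> g (real_of_int (k + j)) + g (real_of_int (k + (j + 1)))"
    proof (cases "k + j \<ge> 0")
      case True
      then have "(real_of_int (k + j))\<^sup>2 \<le> y\<^sup>2"
        using y by (intro power_mono) auto
      then show ?thesis
        using gle[of "real_of_int (k + j)" y] by (simp add: g_def add_increasing2)
    next
      case False
      then have "real_of_int (k + (j + 1)) \<le> 0"
        by linarith
      then have "(- real_of_int (k + (j + 1)))\<^sup>2 \<le> (- y)\<^sup>2"
        using y by (intro power_mono) linarith+
      then have "(real_of_int (k + (j + 1)))\<^sup>2 \<le> y\<^sup>2"
        by (simp only: power2_minus)
      then show ?thesis
        using gle[of "real_of_int (k + (j + 1))" y] by (simp add: g_def add_increasing)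
    qed
    finally show ?thesis
      by (simp add: E_def)
  qed
  have "rtheta a \<epsilon> d \<le> (\<Sum>\<^sub>\<infinity>k\<in>UNIV. E * (g (real_of_int (k + j)) + g (real_of_int (k + (j + 1)))))"
    unfolding rtheta_def
    by (intro infsum_mono rtheta_summable assms summable_on_cmult_right summable_on_add g' le)
  also have "\<dots> = E * (rtheta a \<epsilon> 0 + rtheta a \<epsilon> 0)"
    unfolding infsum_cmult_right' by (subst infsum_add[OF g' g']) (simp only: th0)
  finally show ?thesis
    by (simp add: E_def)
qed

text \<open>The indices are split by parity: both halves are theta series at 4\<epsilon>, with d = 0
  and d = a/2. This later yields the behaviour of ln theta between \<epsilon> and 4\<epsilon>
  without a transformation formula.\<close>

lemma rtheta_dissection:
  assumes "a > 0" "\<epsilon> > 0"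
  shows "rtheta a \<epsilon> 0 = rtheta a (4 * \<epsilon>) 0 + exp (- (\<epsilon> * a / 2)) * rtheta a (4 * \<epsilon>) (a / 2)"
proof -
  let ?f = "\<lambda>k::int. exp (- (\<epsilon> * (a * (real_of_int k)\<^sup>2 / 2 + 0 * real_of_int k)))"
  have U: "(UNIV :: int set) = range (\<lambda>k. 2 * k) \<union> range (\<lambda>k. 2 * k + 1)"
    by (auto simp: image_iff) (metis oddE evenE)
  have disj: "range (\<lambda>k::int. 2 * k) \<inter> range (\<lambda>k. 2 * k + 1) = {}"
    by (auto simp: image_iff) presburger
  have "infsum ?f UNIV = infsum ?f (range (\<lambda>k. 2 * k)) + infsum ?f (range (\<lambda>k. 2 * k + 1))"
    by (subst U, rule infsum_Un_disjoint[OF rtheta_summable rtheta_summable disj]) fact+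
  also have "infsum ?f (range (\<lambda>k. 2 * k)) = rtheta a (4 * \<epsilon>) 0"
    unfolding rtheta_def by (subst infsum_reindex) (auto simp: inj_on_def o_def intro!: infsum_cong)
  also have "infsum ?f (range (\<lambda>k. 2 * k + 1)) = exp (- (\<epsilon> * a / 2)) * rtheta a (4 * \<epsilon>) (a / 2)"
    unfolding rtheta_def infsum_cmult_right'[symmetric]
    by (subst infsum_reindex)
       (auto simp: inj_on_def o_def power2_eq_square field_simps simp flip: exp_add intro!: infsum_cong)
  finally show ?thesis
    by (simp add: rtheta_def)
qed

subsection \<open>The relation between \<open>\<eta>\<close> and theta\<close>

text \<open>For a = 1 both sums on the right of the shift equation coincide, so each shift of b
  splits off one factor of the product (-q^(b+1/2); q)_n.\<close>

lemma rnahm_one_shift: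
  assumes "\<epsilon> > 0"
  shows "rnahm 1 \<epsilon> b c = (\<Prod>i=1..n. 1 + exp (- (\<epsilon> * (b - 1/2 + real i)))) * rnahm 1 \<epsilon> (b + real n) c"
proof (induction n)
  case (Suc n)
  have "rnahm 1 \<epsilon> (b + real n) c = (1 + exp (- (\<epsilon> * (b - 1/2 + real (Suc n))))) * rnahm 1 \<epsilon> (b + real (Suc n)) c"
    using rnahm_shift[of 1 \<epsilon> "b + real n" c] assms by (simp add: algebra_simps)
  then show ?case
    by (simp add: Suc algebra_simps)
qed simp

lemma rfact_ratio:
  assumes "\<epsilon> > 0"
  shows "(\<Prod>i=1..n. 1 + exp (- (\<epsilon> * real i))) = rfact (2 * \<epsilon>) n / rfact \<epsilon> n"
proof -
  have "(1 + exp (- (\<epsilon> * real i))) * (1 - exp (- (\<epsilon> * real i))) = 1 - exp (- (2 * \<epsilon> * real i))" for i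
    by (simp add: algebra_simps flip: exp_add)
  then have "(\<Prod>i=1..n. 1 + exp (- (\<epsilon> * real i))) * rfact \<epsilon> n = rfact (2 * \<epsilon>) n"
    unfolding rfact_def by (simp flip: prod.distrib)
  then show ?thesis
    using rfact_pos[OF assms, of n] by (simp add: field_simps)
qed

text \<open>Gauss's identity, the right side being twice the sum of q^(k(k+1)/2) over k >= 0. It
  results from evaluating the sum for a = 1 at B = (1/2, -1/2) in two ways: as a theta series
  divided by (q)_inf, and as twice the square of the product of all 1 + q^i.\<close>

lemma rfact_inf_theta:
  assumes "\<epsilon> > 0"
  shows "2 * (rfact_inf (2 * \<epsilon>))\<^sup>2 / rfact_inf \<epsilon> = rtheta 1 \<epsilon> (1/2)"
proof -
  define R where "R = (\<lambda>n. rfact (2 * \<epsilon>) n / rfact \<epsilon> n)"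
  \<comment> \<open>When both components of B grow by n, every term other than that of (0, 0) gains
    a factor of at most exp(-\<epsilon>)^n. The sum therefore tends to 1, and only the split-off
    products remain in the limit.\<close>
  have bound: "\<bar>rnahm 1 \<epsilon> (1/2 + real n) (1/2 + real n) - 1\<bar> \<le> exp (- \<epsilon>) ^ n * rnahm 1 \<epsilon> (1/2) (1/2)" for n
  proof -
    let ?t = "rterm 1 \<epsilon> (1/2 + real n) (1/2 + real n)"
    have "rnahm 1 \<epsilon> (1/2 + real n) (1/2 + real n) = infsum ?t (insert (0, 0) (UNIV - {(0, 0)}))"
      by (simp add: rnahm_def insert_absorb)
    also have "\<dots> = ?t (0, 0) + infsum ?t (UNIV - {(0, 0)})"
      by (subst infsum_insert) (auto intro!: rterm_summable assms)
    also have "?t (0, 0) = 1"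
      by (simp add: rterm_def nahm_exponent_def rfact_def)
    finally have "rnahm 1 \<epsilon> (1/2 + real n) (1/2 + real n) - 1 = infsum ?t (UNIV - {(0, 0)})"
      by simp
    moreover have "infsum ?t (UNIV - {(0, 0)}) \<ge> 0"
      by (intro infsum_nonneg less_imp_le rterm_pos assms)
    moreover have "infsum ?t (UNIV - {(0, 0)}) \<le> infsum (\<lambda>p. exp (- \<epsilon>) ^ n * rterm 1 \<epsilon> (1/2) (1/2) p) UNIV"
    proof (rule infsum_mono_neutral)
      fix p :: "nat \<times> nat" assume p: "p \<in> (UNIV - {(0, 0)}) \<inter> UNIV"
      obtain k l where kl: "p = (k, l)" by force
      have "k + l \<ge> 1"
        using p kl by (cases k) auto
      then have "real n * real (k + l) \<ge> real n * 1"
        by (intro mult_left_mono) linarith+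
      then have "nahm_exponent 1 (1/2 + real n) (1/2 + real n) p \<ge> real n + nahm_exponent 1 (1/2) (1/2) p"
        by (simp add: nahm_exponent_def kl algebra_simps)
      then have "\<epsilon> * nahm_exponent 1 (1/2 + real n) (1/2 + real n) p \<ge> \<epsilon> * (real n + nahm_exponent 1 (1/2) (1/2) p)"
        using assms by (intro mult_left_mono) auto
      then have "exp (- (\<epsilon> * nahm_exponent 1 (1/2 + real n) (1/2 + real n) p)) \<le> exp (- \<epsilon>) ^ n * exp (- (\<epsilon> * nahm_exponent 1 (1/2) (1/2) p))"
        by (simp add: algebra_simps flip: exp_of_nat_mult exp_add)
      then show "?t p \<le> exp (- \<epsilon>) ^ n * rterm 1 \<epsilon> (1/2) (1/2) p"
        unfolding rterm_def times_divide_eq_right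
        using rfact_pos[OF assms] by (intro divide_right_mono) (auto intro: less_imp_le)
    qed (use rterm_pos[OF assms] in \<open>auto intro!: rterm_summable summable_on_cmult_right assms simp: less_imp_le\<close>)
    ultimately show ?thesis
      by (simp add: rnahm_def infsum_cmult_right')
  qed
  have "(\<lambda>n. exp (- \<epsilon>) ^ n * rnahm 1 \<epsilon> (1/2) (1/2)) \<longlonglongrightarrow> 0 * rnahm 1 \<epsilon> (1/2) (1/2)"
    using assms by (intro tendsto_mult LIMSEQ_power_zero tendsto_const) auto
  then have "(\<lambda>n. rnahm 1 \<epsilon> (1/2 + real n) (1/2 + real n) - 1) \<longlonglongrightarrow> 0"
    unfolding mult_zero_left by (rule Lim_null_comparison[OF always_eventually[OF allI[OF bound[folded real_norm_def]]]])
  then have "(\<lambda>n. rnahm 1 \<epsilon> (1/2 + real n) (1/2 + real n)) \<longlonglongrightarrow> 1"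
    by (simp add: LIM_zero_iff)
  moreover have "R \<longlonglongrightarrow> rfact_inf (2 * \<epsilon>) / rfact_inf \<epsilon>"
    unfolding R_def using rfact_inf_pos[OF assms] assms by (intro tendsto_divide rfact_tendsto) auto
  ultimately have "(\<lambda>n. (R n)\<^sup>2 * rnahm 1 \<epsilon> (1/2 + real n) (1/2 + real n)) \<longlonglongrightarrow> (rfact_inf (2 * \<epsilon>) / rfact_inf \<epsilon>)\<^sup>2 * 1"
    by (intro tendsto_mult tendsto_power)
  moreover have "(R n)\<^sup>2 * rnahm 1 \<epsilon> (1/2 + real n) (1/2 + real n) = rnahm 1 \<epsilon> (1/2) (1/2)" for n
    using rnahm_one_shift[OF assms, of "1/2" "1/2" n] rnahm_one_shift[OF assms, of "1/2" "1/2 + real n" n]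
      rnahm_commute[of 1 \<epsilon> "1/2 + real n" "1/2"] assms
    unfolding R_def rfact_ratio[OF assms, symmetric] by (simp add: power2_eq_square)
  ultimately have "(\<lambda>n::nat. rnahm 1 \<epsilon> (1/2) (1/2)) \<longlonglongrightarrow> (rfact_inf (2 * \<epsilon>) / rfact_inf \<epsilon>)\<^sup>2"
    by simp
  then have "rnahm 1 \<epsilon> (1/2) (1/2) = (rfact_inf (2 * \<epsilon>) / rfact_inf \<epsilon>)\<^sup>2"
    by (simp add: LIMSEQ_const_iff)
  \<comment> \<open>The 2 is 1 + q^0, split off when the component -1/2 is shifted to 1/2.\<close>
  moreover have "rnahm 1 \<epsilon> (1/2) (- (1/2)) = 2 * rnahm 1 \<epsilon> (1/2) (1/2)"
    using rnahm_one_shift[OF assms, of "- (1/2)" "1/2" 1] rnahm_commute[of 1 \<epsilon> "1/2" "- (1/2)"] assms by simp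
  ultimately have "rtheta 1 \<epsilon> (1/2) / rfact_inf \<epsilon> = 2 * (rfact_inf (2 * \<epsilon>) / rfact_inf \<epsilon>)\<^sup>2"
    using rnahm_antidiagonal[of 1 \<epsilon> "1/2"] assms by simp
  then show ?thesis
    using rfact_inf_pos[OF assms] by (simp add: field_simps power2_eq_square)
qed

section \<open>The normalised sums\<close>

lemma eventually_at_right_0_1: "eventually (\<lambda>\<epsilon>::real. 0 < \<epsilon> \<and> \<epsilon> < 1) (at_right 0)"
  using eventually_at_right_real[of 0 "1::real"] by (simp add: eventually_mono)

lemma eventually_at_right_0_pos: "eventually (\<lambda>\<epsilon>::real. 0 < \<epsilon>) (at_right 0)"
  using eventually_at_right_0_1 by (rule eventually_mono) simp

text \<open>With \<rho> = 1/sqrt \<epsilon> the Taylor remainder of order 2N carries the factor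
  |x|^(2N) \<epsilon>^N. It remains to bound the sum at r and -r for a single r per \<epsilon>;
  allowing any sufficiently large r makes it possible to choose an even integer.\<close>

lemma exp_sum_family_near_poly:
  fixes w Y :: "real \<Rightarrow> 'a \<Rightarrow> real" and \<Phi> :: "real \<Rightarrow> real \<Rightarrow> real"
  assumes w: "\<And>\<epsilon> i. 0 < \<epsilon> \<Longrightarrow> \<epsilon> < 1 \<Longrightarrow> w \<epsilon> i \<ge> 0"
    and sum: "\<And>\<epsilon> x. 0 < \<epsilon> \<Longrightarrow> \<epsilon> < 1 \<Longrightarrow> ((\<lambda>i. w \<epsilon> i * exp (x * Y \<epsilon> i)) has_sum \<Phi> \<epsilon> x) UNIV"
    and bound: "\<And>x. \<exists>C. \<forall>\<epsilon>. 0 < \<epsilon> \<longrightarrow> \<epsilon> < 1 \<longrightarrow> (\<exists>r \<ge> 1 / sqrt \<epsilon> + \<bar>x\<bar>. \<Phi> \<epsilon> r + \<Phi> \<epsilon> (- r) \<le> C)"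
    and "N > 0"
  shows "near_poly N \<Phi>"
proof -
  have "\<exists>P. degree P < 2 * N \<and> (0 < \<epsilon> \<longrightarrow> \<epsilon> < 1 \<longrightarrow> (\<forall>x \<rho> r. 0 < \<rho> \<longrightarrow> \<rho> + \<bar>x\<bar> \<le> r \<longrightarrow>
    \<bar>\<Phi> \<epsilon> x - poly P x\<bar> \<le> (\<bar>x\<bar> / \<rho>) ^ (2 * N) * (\<Phi> \<epsilon> r + \<Phi> \<epsilon> (- r))))" for \<epsilon>
  proof (cases "0 < \<epsilon> \<and> \<epsilon> < 1")
    case True
    then have \<epsilon>: "0 < \<epsilon>" "\<epsilon> < 1" by auto
    have S: "(\<lambda>i. w \<epsilon> i * exp (x * Y \<epsilon> i)) summable_on UNIV" for x
      using sum[OF \<epsilon>] unfolding summable_on_def by blast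
    have eq: "(\<Sum>\<^sub>\<infinity>i. w \<epsilon> i * exp (x * Y \<epsilon> i)) = \<Phi> \<epsilon> x" for x
      using sum[OF \<epsilon>] by (rule infsumI)
    have "2 * N > 0"
      using \<open>N > 0\<close> by simp
    from exp_sum_near_poly[of "w \<epsilon>" "Y \<epsilon>", OF w[OF \<epsilon>] S this] show ?thesis
      unfolding eq by blast
  next
    case False
    then show ?thesis
      using \<open>N > 0\<close> by (intro exI[of _ 0]) auto
  qed
  then obtain P where deg: "\<And>\<epsilon>. degree (P \<epsilon>) < 2 * N"
    and P: "\<And>\<epsilon> x \<rho> r. 0 < \<epsilon> \<Longrightarrow> \<epsilon> < 1 \<Longrightarrow> 0 < \<rho> \<Longrightarrow> \<rho> + \<bar>x\<bar> \<le> r \<Longrightarrow>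
      \<bar>\<Phi> \<epsilon> x - poly (P \<epsilon>) x\<bar> \<le> (\<bar>x\<bar> / \<rho>) ^ (2 * N) * (\<Phi> \<epsilon> r + \<Phi> \<epsilon> (- r))"
    by metis
  have "(\<lambda>\<epsilon>. \<Phi> \<epsilon> x - poly (P \<epsilon>) x) \<in> O[at_right 0](\<lambda>\<epsilon>. \<epsilon> ^ N)" for x
  proof -
    obtain C where C: "\<And>\<epsilon>. 0 < \<epsilon> \<Longrightarrow> \<epsilon> < 1 \<Longrightarrow> \<exists>r \<ge> 1 / sqrt \<epsilon> + \<bar>x\<bar>. \<Phi> \<epsilon> r + \<Phi> \<epsilon> (- r) \<le> C"
      using bound[of x] by blast
    have "norm (\<Phi> \<epsilon> x - poly (P \<epsilon>) x) \<le> (\<bar>x\<bar> ^ (2 * N) * C) * norm (\<epsilon> ^ N)" if \<epsilon>: "0 < \<epsilon>" "\<epsilon> < 1" for \<epsilon>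
    proof -
      obtain r where r: "r \<ge> 1 / sqrt \<epsilon> + \<bar>x\<bar>" "\<Phi> \<epsilon> r + \<Phi> \<epsilon> (- r) \<le> C"
        using C[OF \<epsilon>] by blast
      have "\<bar>\<Phi> \<epsilon> x - poly (P \<epsilon>) x\<bar> \<le> (\<bar>x\<bar> / (1 / sqrt \<epsilon>)) ^ (2 * N) * (\<Phi> \<epsilon> r + \<Phi> \<epsilon> (- r))"
        using \<epsilon> r by (intro P) auto
      also have "\<dots> \<le> (\<bar>x\<bar> / (1 / sqrt \<epsilon>)) ^ (2 * N) * C"
        using r \<epsilon> by (intro mult_left_mono) auto
      also have "(\<bar>x\<bar> / (1 / sqrt \<epsilon>)) ^ (2 * N) = \<bar>x\<bar> ^ (2 * N) * \<epsilon> ^ N"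
        using \<epsilon> by (simp add: power_mult_distrib power_mult)
      finally show ?thesis
        using \<epsilon> by (simp add: algebra_simps)
    qed
    then show ?thesis
      using eventually_at_right_0_1 by (intro bigoI[of _ "\<bar>x\<bar> ^ (2 * N) * C"]) (auto elim: eventually_mono)
  qed
  with deg show ?thesis
    unfolding near_poly_def by blast
qed

lemma scaled_square_le:
  assumes "0 < \<epsilon>" "\<epsilon> < 1" "y \<ge> 0"
  shows "\<epsilon> * (1 / sqrt \<epsilon> + y)\<^sup>2 \<le> (1 + y)\<^sup>2"
proof -
  have "\<epsilon> * (1 / sqrt \<epsilon> + y)\<^sup>2 = (sqrt \<epsilon> * (1 / sqrt \<epsilon> + y))\<^sup>2"
    using assms by (simp add: power_mult_distrib)
  also have "sqrt \<epsilon> * (1 / sqrt \<epsilon> + y) = 1 + sqrt \<epsilon> * y"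
    using assms by (simp add: field_simps)
  also have "(1 + sqrt \<epsilon> * y)\<^sup>2 \<le> (1 + y)\<^sup>2"
    using assms mult_right_mono[of "sqrt \<epsilon>" 1 y] by (intro power_mono) auto
  finally show ?thesis .
qed

lemma rtheta_near_poly:
  assumes "a > 0" "N > 0"
  shows "near_poly N (\<lambda>\<epsilon> x. rtheta a \<epsilon> x / rtheta a \<epsilon> 0)"
proof (rule exp_sum_family_near_poly)
  fix \<epsilon> x :: real assume \<epsilon>: "0 < \<epsilon>" "\<epsilon> < 1"
  show "((\<lambda>k::int. exp (- (\<epsilon> * (a * (real_of_int k)\<^sup>2 / 2))) / rtheta a \<epsilon> 0 * exp (x * (- \<epsilon> * real_of_int k)))
      has_sum (rtheta a \<epsilon> x / rtheta a \<epsilon> 0)) UNIV"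
    using has_sum_cmult_right[OF has_sum_infsum[OF rtheta_summable[OF assms(1) \<epsilon>(1), of x UNIV]], of "1 / rtheta a \<epsilon> 0"]
    by (simp add: rtheta_def algebra_simps flip: exp_add)
  show "exp (- (\<epsilon> * (a * (real_of_int k)\<^sup>2 / 2))) / rtheta a \<epsilon> 0 \<ge> 0" for k :: int
    using rtheta_pos[OF assms(1) \<epsilon>(1), of 0] by simp
next
  fix x :: real
  have "rtheta a \<epsilon> d / rtheta a \<epsilon> 0 \<le> 2 * exp ((1 + \<bar>x\<bar>)\<^sup>2 / (2 * a))"
    if "0 < \<epsilon>" "\<epsilon> < 1" "d\<^sup>2 = (1 / sqrt \<epsilon> + \<bar>x\<bar>)\<^sup>2" for \<epsilon> d
  proof -
    have "rtheta a \<epsilon> d / rtheta a \<epsilon> 0 \<le> 2 * exp (\<epsilon> * d\<^sup>2 / (2 * a))"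
      using rtheta_le[OF assms(1) that(1), of d] rtheta_pos[OF assms(1) that(1), of 0]
      by (simp add: field_simps)
    also have "\<dots> \<le> 2 * exp ((1 + \<bar>x\<bar>)\<^sup>2 / (2 * a))"
      using scaled_square_le[OF that(1,2), of "\<bar>x\<bar>"] assms(1) that(3)
      by (simp add: divide_right_mono)
    finally show ?thesis .
  qed
  note le = this
  define C where "C = 2 * exp ((1 + \<bar>x\<bar>)\<^sup>2 / (2 * a))"
  have "rtheta a \<epsilon> (1 / sqrt \<epsilon> + \<bar>x\<bar>) / rtheta a \<epsilon> 0 + rtheta a \<epsilon> (- (1 / sqrt \<epsilon> + \<bar>x\<bar>)) / rtheta a \<epsilon> 0 \<le> C + C"
    if "0 < \<epsilon>" "\<epsilon> < 1" for \<epsilon>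
    unfolding C_def by (intro add_mono le that) (simp_all only: power2_minus)
  then show "\<exists>C. \<forall>\<epsilon>. 0 < \<epsilon> \<longrightarrow> \<epsilon> < 1 \<longrightarrow> (\<exists>r\<ge>1 / sqrt \<epsilon> + \<bar>x\<bar>.
      rtheta a \<epsilon> r / rtheta a \<epsilon> 0 + rtheta a \<epsilon> (- r) / rtheta a \<epsilon> 0 \<le> C)"
    by (intro exI[of _ "C + C"]) blast
qed fact

text \<open>The ratio equals the exponential exactly at the multiples of a. Up to O(\<epsilon>^N)
  both are polynomials of degree below 2N in d, so interpolation carries the agreement to every
  d.\<close>

lemma rtheta_expansion:
  assumes "a > 0" and N: "N > 0"
  shows "(\<lambda>\<epsilon>. rtheta a \<epsilon> d / rtheta a \<epsilon> 0 - exp (\<epsilon> * d\<^sup>2 / (2 * a))) \<in> O[at_right 0](\<lambda>\<epsilon>. \<epsilon> ^ N)"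
proof -
  \<comment> \<open>With d = a x the exponent \<epsilon> d^2/(2a) becomes (a/2) \<epsilon> x^2 and
    the nodes become integers; the exponential series is cut off to obtain a polynomial.\<close>
  define E where "E = (\<lambda>\<epsilon> x. \<Sum>j<N. (a / 2 * (\<epsilon> * x\<^sup>2)) ^ j / fact j)"
  have expE: "(\<lambda>\<epsilon>. exp (a / 2 * (\<epsilon> * x\<^sup>2)) - E \<epsilon> x) \<in> O[at_right 0](\<lambda>\<epsilon>. \<epsilon> ^ N)" for x
    unfolding E_def by (rule exp_partial_sum_bigo) simp
  have "tame E"
    unfolding E_def divide_inverse by (intro tame_sum tame_mult tame_power tame_const tame_eps_x2)
  then have "near_poly N (\<lambda>\<epsilon> x. rtheta a \<epsilon> (a * x) / rtheta a \<epsilon> 0 - E \<epsilon> x)"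
    by (intro near_poly_diff tame_imp_near_poly N near_poly_scale[OF rtheta_near_poly[OF assms]])
  then have "(\<lambda>\<epsilon>. rtheta a \<epsilon> (a * (d / a)) / rtheta a \<epsilon> 0 - E \<epsilon> (d / a)) \<in> O[at_right 0](\<lambda>\<epsilon>. \<epsilon> ^ N)"
  proof (rule near_poly_small_on_nats_imp_small)
    fix i :: nat
    have "eventually (\<lambda>\<epsilon>. exp (a / 2 * (\<epsilon> * (real i)\<^sup>2)) - E \<epsilon> (real i) = rtheta a \<epsilon> (a * real i) / rtheta a \<epsilon> 0 - E \<epsilon> (real i)) (at_right 0)"
      using eventually_at_right_0_pos
    proof eventually_elim
      case (elim \<epsilon>)
      then show ?case
        using rtheta_pos[OF assms(1), of \<epsilon> 0] by (simp add: rtheta_period_multiple algebra_simps)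
    qed
    from landau_o.big.in_cong[OF this] show "(\<lambda>\<epsilon>. rtheta a \<epsilon> (a * real i) / rtheta a \<epsilon> 0 - E \<epsilon> (real i)) \<in> O[at_right 0](\<lambda>\<epsilon>. \<epsilon> ^ N)"
      using expE[of "real i"] by simp
  qed
  from sum_in_bigo(2)[OF this expE[of "d / a"]] show ?thesis
    using assms by (simp add: power2_eq_square field_simps)
qed

text \<open>Here s = B_1 + B_2 and d = (B_1 - B_2)/2. The factor 2^s removes the leading dependence
  on B: as \<epsilon> tends to 0 the dominant terms have q^m and q^n near 1/2, the solution of 1 - Q
  = Q^a Q^(1-a).\<close>

definition gnahm :: "real \<Rightarrow> real \<Rightarrow> real \<Rightarrow> real \<Rightarrow> real" where
  "gnahm a s d \<epsilon> = 2 powr s * rnahm a \<epsilon> (s / 2 + d) (s / 2 - d) / rnahm a \<epsilon> 0 0"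

context
  fixes a :: real
  assumes a: "a > 1/2"
begin

lemma gnahm_pos: "\<epsilon> > 0 \<Longrightarrow> gnahm a s d \<epsilon> > 0"
  using rnahm_pos[OF a] by (simp add: gnahm_def)

lemma gnahm_minus: "\<epsilon> > 0 \<Longrightarrow> gnahm a s (- d) \<epsilon> = gnahm a s d \<epsilon>"
  using rnahm_commute[OF a] by (simp add: gnahm_def)

lemma gnahm_shift:
  assumes "\<epsilon> > 0"
  shows "2 * gnahm a s d \<epsilon> = gnahm a (s + 1) (d + 1/2) \<epsilon> + exp (- (\<epsilon> * (a/2 + s/2 + d))) * gnahm a (s + 1) (d + a - 1/2) \<epsilon>"
proof -
  have e: "(s + 1) / 2 + (d + 1/2) = s/2 + d + 1" "(s + 1) / 2 - (d + 1/2) = s/2 - d"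
    "(s + 1) / 2 + (d + a - 1/2) = s/2 + d + a" "(s + 1) / 2 - (d + a - 1/2) = s/2 - d + 1 - a"
    "a/2 + s/2 + d = a/2 + (s/2 + d)"
    by (simp_all add: field_simps)
  show ?thesis
    unfolding gnahm_def e
    by (subst rnahm_shift[OF a assms, of "s/2 + d"]) (simp add: powr_add add_divide_distrib algebra_simps)
qed

lemma gnahm_0:
  assumes "\<epsilon> > 0"
  shows "gnahm a 0 d \<epsilon> = rtheta a \<epsilon> d / rtheta a \<epsilon> 0"
  using rnahm_antidiagonal[OF a assms, of d] rnahm_antidiagonal[OF a assms, of 0] rfact_inf_pos[OF assms]
  by (simp add: gnahm_def)

section \<open>Bounds for d or s of size \<epsilon>^(-1/2)\<close>

lemma gnahm_0_le:
  assumes "\<epsilon> > 0"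
  shows "gnahm a 0 d \<epsilon> \<le> 2 * exp (\<epsilon> * d\<^sup>2 / (2 * a))"
  using rtheta_le[of a \<epsilon> d] rtheta_pos[of a \<epsilon> 0] a assms by (simp add: gnahm_0 field_simps)

text \<open>Both terms on the right of the shift equation are positive, and dropping the second
  costs a factor 2 per step. This is harmless for fixed m, but not for s of size
  \<epsilon>^(-1/2).\<close>

lemma gnahm_nat_le:
  assumes "\<epsilon> > 0"
  shows "gnahm a (real m) d \<epsilon> \<le> 2 ^ Suc m * exp (\<epsilon> * (\<bar>d\<bar> + real m / 2)\<^sup>2 / (2 * a))"
proof -
  have "gnahm a (real m) d \<epsilon> \<le> 2 ^ m * gnahm a 0 (d - real m / 2) \<epsilon>"
  proof (induction m arbitrary: d)
    case (Suc m)
    have "gnahm a (real m + 1) (d - 1/2 + 1/2) \<epsilon> \<le> 2 * gnahm a (real m) (d - 1/2) \<epsilon>"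
      unfolding gnahm_shift[OF assms, of "real m" "d - 1/2"] using gnahm_pos[OF assms] by (simp add: less_imp_le)
    also have "\<dots> \<le> 2 * (2 ^ m * gnahm a 0 (d - 1/2 - real m / 2) \<epsilon>)"
      by (intro mult_left_mono Suc) auto
    also have "d - 1/2 - real m / 2 = d - real (Suc m) / 2"
      by (simp add: field_simps)
    finally show ?case
      by (simp add: add.commute)
  qed simp
  also have "\<dots> \<le> 2 ^ m * (2 * exp (\<epsilon> * (d - real m / 2)\<^sup>2 / (2 * a)))"
    by (intro mult_left_mono gnahm_0_le assms) auto
  also have "(d - real m / 2)\<^sup>2 \<le> (\<bar>d\<bar> + real m / 2)\<^sup>2"
    by (rule power2_le_iff_abs_le[THEN iffD2]) auto
  then have "2 ^ m * (2 * exp (\<epsilon> * (d - real m / 2)\<^sup>2 / (2 * a))) \<le> 2 ^ m * (2 * exp (\<epsilon> * (\<bar>d\<bar> + real m / 2)\<^sup>2 / (2 * a)))"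
    using a assms by (intro mult_left_mono exp_le_cancel_iff[THEN iffD2] divide_right_mono) auto
  finally show ?thesis
    by simp
qed

text \<open>To avoid the factor 2 per step, the mean inequality is applied to the two terms of the
  shift equation: it bounds the value at their midpoint d + a/2 and loses only an exponential of
  order \<epsilon>. The symmetry between d and -d lets a second step return to d, and the
  contributions of d to the exponents cancel.\<close>

lemma gnahm_two_steps_le:
  assumes "\<epsilon> > 0"
  shows "gnahm a (s + 2) d \<epsilon> \<le> exp (\<epsilon> * (s/2 + 1/4 + a/4)) * gnahm a s d \<epsilon>"
proof -
  have mid: "gnahm a (s + 1) (d + a/2) \<epsilon> \<le> exp (\<epsilon> * (a/2 + s/2 + d) / 2) * gnahm a s d \<epsilon>" for s d
  proof -
    define \<eta> where "\<eta> = \<epsilon> * (a/2 + s/2 + d)"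
    define c where "c = 2 powr (s + 1) / rnahm a \<epsilon> 0 0"
    have c: "c > 0"
      using rnahm_pos[OF a assms] by (simp add: c_def)
    have G: "gnahm a (s + 1) y \<epsilon> = c * rnahm a \<epsilon> ((s + 1) / 2 + y) ((s + 1) / 2 - y)" for y
      by (simp add: gnahm_def c_def)
    have e: "(s + 1) / 2 + (d + a/2) = (((s + 1) / 2 + (d + 1/2)) + ((s + 1) / 2 + (d + a - 1/2))) / 2"
      "(s + 1) / 2 - (d + a/2) = (((s + 1) / 2 - (d + 1/2)) + ((s + 1) / 2 - (d + a - 1/2))) / 2"
      by (simp_all add: field_simps)
    have "2 * exp (- (\<eta> / 2)) * gnahm a (s + 1) (d + a/2) \<epsilon> =
        c * (2 * exp (- (\<eta> / 2)) * rnahm a \<epsilon> ((((s + 1) / 2 + (d + 1/2)) + ((s + 1) / 2 + (d + a - 1/2))) / 2)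
          ((((s + 1) / 2 - (d + 1/2)) + ((s + 1) / 2 - (d + a - 1/2))) / 2))"
      unfolding G e by simp
    also have "\<dots> \<le> c * (rnahm a \<epsilon> ((s + 1) / 2 + (d + 1/2)) ((s + 1) / 2 - (d + 1/2))
        + exp (- \<eta>) * rnahm a \<epsilon> ((s + 1) / 2 + (d + a - 1/2)) ((s + 1) / 2 - (d + a - 1/2)))"
      using c by (intro mult_left_mono rnahm_midpoint a assms) auto
    also have "\<dots> = 2 * gnahm a s d \<epsilon>"
      unfolding gnahm_shift[OF assms] G \<eta>_def by (simp add: algebra_simps)
    finally have "exp (\<eta> / 2) * (exp (- (\<eta> / 2)) * gnahm a (s + 1) (d + a/2) \<epsilon>) \<le> exp (\<eta> / 2) * gnahm a s d \<epsilon>"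
      by (intro mult_left_mono) auto
    then show ?thesis
      by (simp add: \<eta>_def flip: mult.assoc exp_add)
  qed
  have "gnahm a (s + 2) d \<epsilon> \<le> exp (\<epsilon> * (a/2 + (s + 1)/2 + (d - a/2)) / 2) * gnahm a (s + 1) (d - a/2) \<epsilon>"
    using mid[of "s + 1" "d - a/2"] by (simp add: add.assoc)
  also have "gnahm a (s + 1) (d - a/2) \<epsilon> = gnahm a (s + 1) (- d + a/2) \<epsilon>"
    using gnahm_minus[OF assms, of "s + 1" "d - a/2"] by simp
  also have "exp (\<epsilon> * (a/2 + (s + 1)/2 + (d - a/2)) / 2) * \<dots>
      \<le> exp (\<epsilon> * (a/2 + (s + 1)/2 + (d - a/2)) / 2) * (exp (\<epsilon> * (a/2 + s/2 + - d) / 2) * gnahm a s (- d) \<epsilon>)"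
    by (intro mult_left_mono mid) auto
  also have "\<dots> = exp (\<epsilon> * (s/2 + 1/4 + a/4)) * gnahm a s d \<epsilon>"
    unfolding gnahm_minus[OF assms] mult.assoc[symmetric] exp_add[symmetric]
    by (simp add: field_simps)
  finally show ?thesis .
qed

text \<open>The exponents of the double steps add up to O(\<epsilon> s^2), which stays bounded on
  the scale \<epsilon>^(-1/2); the constant 1 + a is generous.\<close>

lemma gnahm_even_le:
  assumes "\<epsilon> > 0"
  shows "gnahm a (2 * real j) d \<epsilon> \<le> 2 * exp (\<epsilon> * (d\<^sup>2 + (1 + a) * (2 * real j)\<^sup>2))"
proof -
  have "gnahm a (2 * real j) d \<epsilon> \<le> exp (\<epsilon> * ((1 + a) * (2 * real j)\<^sup>2)) * gnahm a 0 d \<epsilon>"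
  proof (induction j)
    case (Suc j)
    have "gnahm a (2 * real (Suc j)) d \<epsilon> = gnahm a (2 * real j + 2) d \<epsilon>"
      by (simp add: algebra_simps)
    also have "\<dots> \<le> exp (\<epsilon> * (2 * real j/2 + 1/4 + a/4)) * gnahm a (2 * real j) d \<epsilon>"
      by (rule gnahm_two_steps_le[OF assms])
    also have "\<dots> \<le> exp (\<epsilon> * (2 * real j/2 + 1/4 + a/4)) * (exp (\<epsilon> * ((1 + a) * (2 * real j)\<^sup>2)) * gnahm a 0 d \<epsilon>)"
      by (intro mult_left_mono Suc) auto
    also have "\<dots> = exp (\<epsilon> * (2 * real j/2 + 1/4 + a/4 + (1 + a) * (2 * real j)\<^sup>2)) * gnahm a 0 d \<epsilon>"
      by (simp only: distrib_left exp_add mult.assoc)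
    also have "\<dots> \<le> exp (\<epsilon> * ((1 + a) * (2 * real (Suc j))\<^sup>2)) * gnahm a 0 d \<epsilon>"
    proof -
      have "(1 + a) * (2 * real (Suc j))\<^sup>2 - (1 + a) * (2 * real j)\<^sup>2 = 4 * (1 + a) * (2 * real j + 1)"
        by (simp add: power2_eq_square algebra_simps)
      moreover have "2 * real j/2 + 1/4 + a/4 \<le> 4 * (1 + a) * (2 * real j + 1)"
      proof -
        have "a * real j \<ge> 0"
          using a by simp
        moreover have "4 * (1 + a) * (2 * real j + 1) = 8 * real j + 4 + 4 * a + 8 * (a * real j)"
          by (simp add: algebra_simps)
        ultimately show ?thesis
          using a of_nat_0_le_iff[of j] by linarith
      qed
      ultimately have "2 * real j/2 + 1/4 + a/4 + (1 + a) * (2 * real j)\<^sup>2 \<le> (1 + a) * (2 * real (Suc j))\<^sup>2"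
        by linarith
      then show ?thesis
        using gnahm_pos[OF assms] assms by (intro mult_right_mono) (auto intro: less_imp_le)
    qed
    finally show ?case .
  qed simp
  also have "\<dots> \<le> exp (\<epsilon> * ((1 + a) * (2 * real j)\<^sup>2)) * (2 * exp (\<epsilon> * d\<^sup>2))"
  proof -
    have "d\<^sup>2 / (2 * a) \<le> d\<^sup>2"
      using a mult_left_mono[of 1 "2 * a" "d\<^sup>2"] by (simp add: field_simps)
    then have "exp (\<epsilon> * d\<^sup>2 / (2 * a)) \<le> exp (\<epsilon> * d\<^sup>2)"
      using assms mult_left_mono[of "d\<^sup>2 / (2 * a)" "d\<^sup>2" \<epsilon>] by simp
    then have "gnahm a 0 d \<epsilon> \<le> 2 * exp (\<epsilon> * d\<^sup>2)"
      using gnahm_0_le[OF assms, of d] by linarith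
    then show ?thesis
      by (intro mult_left_mono) auto
  qed
  also have "\<dots> = 2 * exp (\<epsilon> * (d\<^sup>2 + (1 + a) * (2 * real j)\<^sup>2))"
    by (simp add: algebra_simps flip: exp_add)
  finally show ?thesis .
qed

text \<open>Downwards in s the shift equation averages two values, so no factor accumulates. Each
  step moves |d| by at most a, and the additional 1 in a + 1 makes room for the exponential
  prefactor, whose exponent is covered by (X + 1)^2 - X^2 = 2X + 1.\<close>

lemma gnahm_neg_le:
  assumes "\<epsilon> > 0"
  shows "gnahm a (- real m) d \<epsilon> \<le> 2 * exp (\<epsilon> * ((a + 1) * real m + \<bar>d\<bar>)\<^sup>2)"
proof (induction m arbitrary: d)
  case 0
  have "d\<^sup>2 / (2 * a) \<le> d\<^sup>2"
    using a mult_left_mono[of 1 "2 * a" "d\<^sup>2"] by (simp add: field_simps)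
  then have "exp (\<epsilon> * d\<^sup>2 / (2 * a)) \<le> exp (\<epsilon> * d\<^sup>2)"
    using assms mult_left_mono[of "d\<^sup>2 / (2 * a)" "d\<^sup>2" \<epsilon>] by simp
  then have "gnahm a 0 d \<epsilon> \<le> 2 * exp (\<epsilon> * d\<^sup>2)"
    using gnahm_0_le[OF assms, of d] by linarith
  then show ?case
    by simp
next
  case (Suc m)
  define X where "X = (a + 1) * real m + \<bar>d\<bar> + a"
  define D where "D = 2 * exp (\<epsilon> * ((a + 1) * real (Suc m) + \<bar>d\<bar>)\<^sup>2)"
  have X1: "(a + 1) * real (Suc m) + \<bar>d\<bar> = X + 1"
    by (simp add: X_def algebra_simps)
  have le: "gnahm a (- real m) y \<epsilon> \<le> 2 * exp (\<epsilon> * X\<^sup>2)" if "\<bar>y\<bar> \<le> \<bar>d\<bar> + a" for y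
  proof -
    have "(a + 1) * real m + \<bar>y\<bar> \<le> X"
      using that by (simp add: X_def)
    then have "((a + 1) * real m + \<bar>y\<bar>)\<^sup>2 \<le> X\<^sup>2"
      using a by (intro power_mono) auto
    then have "exp (\<epsilon> * ((a + 1) * real m + \<bar>y\<bar>)\<^sup>2) \<le> exp (\<epsilon> * X\<^sup>2)"
      using assms by simp
    then show ?thesis
      using Suc[of y] by linarith
  qed
  have X0: "X \<ge> 0"
    using a by (simp add: X_def)
  have "gnahm a (- real m) (d + 1/2) \<epsilon> \<le> 2 * exp (\<epsilon> * X\<^sup>2)"
    by (rule le) (use a in \<open>auto simp: abs_le_iff\<close>)
  also have "\<dots> \<le> D"
    unfolding D_def X1 using X0 assms by (simp add: power_mono)
  finally have 1: "gnahm a (- real m) (d + 1/2) \<epsilon> \<le> D" .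
  have "exp (- (\<epsilon> * (a/2 + - real (Suc m)/2 + d))) * gnahm a (- real m) (d + a - 1/2) \<epsilon>
      \<le> exp (- (\<epsilon> * (a/2 + - real (Suc m)/2 + d))) * (2 * exp (\<epsilon> * X\<^sup>2))"
    by (intro mult_left_mono le) (use a in \<open>auto simp: abs_le_iff\<close>)
  also have "\<dots> = 2 * exp (\<epsilon> * (X\<^sup>2 - (a/2 + - real (Suc m)/2 + d)))"
    by (simp add: algebra_simps flip: exp_add)
  also have "X\<^sup>2 - (a/2 + - real (Suc m)/2 + d) \<le> (X + 1)\<^sup>2"
  proof -
    have "a * real m \<ge> 0"
      using a by simp
    then have "real (Suc m)/2 + \<bar>d\<bar> \<le> 2 * X + 1"
      unfolding X_def using a by (simp add: algebra_simps)
    moreover have "(X + 1)\<^sup>2 = X\<^sup>2 + 2 * X + 1"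
      by (simp add: power2_sum)
    ultimately show ?thesis
      using a abs_ge_minus_self[of d] by linarith
  qed
  then have "2 * exp (\<epsilon> * (X\<^sup>2 - (a/2 + - real (Suc m)/2 + d))) \<le> D"
    unfolding D_def X1 using assms by simp
  finally have 2: "exp (- (\<epsilon> * (a/2 + - real (Suc m)/2 + d))) * gnahm a (- real m) (d + a - 1/2) \<epsilon> \<le> D" .
  have "2 * gnahm a (- real (Suc m)) d \<epsilon> \<le> D + D"
    using gnahm_shift[OF assms, of "- real (Suc m)" d] 1 2 by simp
  then show ?case
    by (simp add: D_def)
qed

section \<open>Approximate polynomiality in d and in s\<close>

lemma gnahm_near_poly_d:
  assumes "N > 0"
  shows "near_poly N (\<lambda>\<epsilon> d. gnahm a (real m) d \<epsilon>)"
proof (rule exp_sum_family_near_poly)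
  fix \<epsilon> x :: real assume \<epsilon>: "0 < \<epsilon>" "\<epsilon> < 1"
  have eq: "2 powr real m / rnahm a \<epsilon> 0 0 * rterm a \<epsilon> (real m / 2 + x) (real m / 2 - x) p
     = 2 powr real m / rnahm a \<epsilon> 0 0 * rterm a \<epsilon> (real m / 2) (real m / 2) p * exp (x * (- \<epsilon> * (real (fst p) - real (snd p))))" for p
    by (cases p) (simp add: rterm_def nahm_exponent_def algebra_simps flip: exp_add)
  have val: "2 powr real m / rnahm a \<epsilon> 0 0 * infsum (rterm a \<epsilon> (real m / 2 + x) (real m / 2 - x)) UNIV = gnahm a (real m) x \<epsilon>"
    by (simp add: gnahm_def rnahm_def)
  show "((\<lambda>p. 2 powr real m / rnahm a \<epsilon> 0 0 * rterm a \<epsilon> (real m / 2) (real m / 2) p * exp (x * (- \<epsilon> * (real (fst p) - real (snd p)))))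
      has_sum (gnahm a (real m) x \<epsilon>)) UNIV"
    using has_sum_cmult_right[OF has_sum_infsum[OF rterm_summable[OF a \<epsilon>(1), of "real m / 2 + x" "real m / 2 - x" UNIV]], of "2 powr real m / rnahm a \<epsilon> 0 0"]
    unfolding eq val .
  show "2 powr real m / rnahm a \<epsilon> 0 0 * rterm a \<epsilon> (real m / 2) (real m / 2) p \<ge> 0" for p
    using rnahm_pos[OF a \<epsilon>(1)] rterm_pos[OF \<epsilon>(1)] by (simp add: less_imp_le)
next
  fix x :: real
  define C where "C = 2 ^ Suc m * exp ((1 + (\<bar>x\<bar> + real m / 2))\<^sup>2 / (2 * a))"
  have le: "gnahm a (real m) d \<epsilon> \<le> C" if \<epsilon>: "0 < \<epsilon>" "\<epsilon> < 1" and d: "\<bar>d\<bar> = 1 / sqrt \<epsilon> + \<bar>x\<bar>" for \<epsilon> d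
  proof -
    have "\<epsilon> * (\<bar>d\<bar> + real m / 2)\<^sup>2 \<le> (1 + (\<bar>x\<bar> + real m / 2))\<^sup>2"
      using scaled_square_le[OF \<epsilon>, of "\<bar>x\<bar> + real m / 2"] by (simp add: d add.assoc)
    then have "exp (\<epsilon> * (\<bar>d\<bar> + real m / 2)\<^sup>2 / (2 * a)) \<le> exp ((1 + (\<bar>x\<bar> + real m / 2))\<^sup>2 / (2 * a))"
      using a by (simp add: divide_right_mono)
    then show ?thesis
      unfolding C_def using gnahm_nat_le[OF \<epsilon>(1), of m d] by (meson mult_left_mono order_trans zero_le_numeral zero_le_power)
  qed
  have "gnahm a (real m) (1 / sqrt \<epsilon> + \<bar>x\<bar>) \<epsilon> + gnahm a (real m) (- (1 / sqrt \<epsilon> + \<bar>x\<bar>)) \<epsilon> \<le> C + C"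
    if "0 < \<epsilon>" "\<epsilon> < 1" for \<epsilon>
  proof (intro add_mono)
    have "\<bar>1 / sqrt \<epsilon> + \<bar>x\<bar>\<bar> = 1 / sqrt \<epsilon> + \<bar>x\<bar>"
      using that by simp
    then show "gnahm a (real m) (1 / sqrt \<epsilon> + \<bar>x\<bar>) \<epsilon> \<le> C" "gnahm a (real m) (- (1 / sqrt \<epsilon> + \<bar>x\<bar>)) \<epsilon> \<le> C"
      using le[OF that] by (simp_all only: abs_minus_cancel)
  qed
  then show "\<exists>C. \<forall>\<epsilon>. 0 < \<epsilon> \<longrightarrow> \<epsilon> < 1 \<longrightarrow> (\<exists>r\<ge>1 / sqrt \<epsilon> + \<bar>x\<bar>. gnahm a (real m) r \<epsilon> + gnahm a (real m) (- r) \<epsilon> \<le> C)"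
    by (intro exI[of _ "C + C"]) blast
qed fact

lemma gnahm_near_poly_s:
  assumes "N > 0"
  shows "near_poly N (\<lambda>\<epsilon> s. gnahm a s d \<epsilon>)"
proof (rule exp_sum_family_near_poly)
  fix \<epsilon> x :: real assume \<epsilon>: "0 < \<epsilon>" "\<epsilon> < 1"
  \<comment> \<open>As a function of s this is an exponential sum with frequencies ln 2 -
    \<epsilon>(m + n)/2, the ln 2 coming from the normalising factor 2^s.\<close>
  have eq: "2 powr x / rnahm a \<epsilon> 0 0 * rterm a \<epsilon> (x / 2 + d) (x / 2 - d) p
     = rterm a \<epsilon> d (- d) p / rnahm a \<epsilon> 0 0 * exp (x * (ln 2 - \<epsilon> * (real (fst p) + real (snd p)) / 2))" for p
    by (cases p) (simp add: rterm_def nahm_exponent_def powr_def field_simps flip: exp_add)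
  have val: "2 powr x / rnahm a \<epsilon> 0 0 * infsum (rterm a \<epsilon> (x / 2 + d) (x / 2 - d)) UNIV = gnahm a x d \<epsilon>"
    by (simp add: gnahm_def rnahm_def)
  show "((\<lambda>p. rterm a \<epsilon> d (- d) p / rnahm a \<epsilon> 0 0 * exp (x * (ln 2 - \<epsilon> * (real (fst p) + real (snd p)) / 2)))
      has_sum (gnahm a x d \<epsilon>)) UNIV"
    using has_sum_cmult_right[OF has_sum_infsum[OF rterm_summable[OF a \<epsilon>(1), of "x / 2 + d" "x / 2 - d" UNIV]], of "2 powr x / rnahm a \<epsilon> 0 0"]
    unfolding eq val .
  show "rterm a \<epsilon> d (- d) p / rnahm a \<epsilon> 0 0 \<ge> 0" for p
    using rnahm_pos[OF a \<epsilon>(1)] rterm_pos[OF \<epsilon>(1)] by (simp add: less_imp_le)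
next
  fix x :: real
  define y where "y = \<bar>x\<bar> + 2 + \<bar>d\<bar>"
  \<comment> \<open>The exponent is (a + 1)(a + 3)(1 + y)^2, which exceeds both (1 + a)(1 + y)^2,
    arising at r, and (a + 1)^2 (1 + y)^2, arising at -r.\<close>
  define C where "C = 2 * exp ((1 + (a + 1)) * (a + 1) * (1 + y)\<^sup>2 + (a + 1) * (1 + y)\<^sup>2)"
  have "\<exists>r\<ge>1 / sqrt \<epsilon> + \<bar>x\<bar>. gnahm a r d \<epsilon> + gnahm a (- r) d \<epsilon> \<le> C + C" if \<epsilon>: "0 < \<epsilon>" "\<epsilon> < 1" for \<epsilon>
  proof -
    \<comment> \<open>The bound for positive s holds at even integers, so r is the least even
      integer above the required size; rounding adds at most 2, whence the 2 in y.\<close>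
    define j where "j = nat \<lceil>(1 / sqrt \<epsilon> + \<bar>x\<bar>) / 2\<rceil>"
    define r where "r = 2 * real j"
    have nn: "(1 / sqrt \<epsilon> + \<bar>x\<bar>) / 2 \<ge> 0"
      using \<epsilon> by simp
    then have "real j = of_int \<lceil>(1 / sqrt \<epsilon> + \<bar>x\<bar>) / 2\<rceil>"
      unfolding j_def by (intro of_nat_nat) simp
    moreover have "t \<le> 2 * i \<and> 2 * i \<le> t + 2" if "i = k" "k - 1 < t / 2 \<and> t / 2 \<le> k" for i k t :: real
      using that by auto
    ultimately have r1: "r \<ge> 1 / sqrt \<epsilon> + \<bar>x\<bar>" "r \<le> 1 / sqrt \<epsilon> + \<bar>x\<bar> + 2"
      unfolding r_def using ceiling_correct by blast+
    have sq: "\<epsilon> * (r + \<bar>d\<bar>)\<^sup>2 \<le> (1 + y)\<^sup>2"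
    proof -
      have "(r + \<bar>d\<bar>)\<^sup>2 \<le> (1 / sqrt \<epsilon> + y)\<^sup>2"
        using r1 nn unfolding y_def by (intro power_mono) auto
      then have "\<epsilon> * (r + \<bar>d\<bar>)\<^sup>2 \<le> \<epsilon> * (1 / sqrt \<epsilon> + y)\<^sup>2"
        using \<epsilon> by simp
      also have "\<dots> \<le> (1 + y)\<^sup>2"
        by (rule scaled_square_le[OF \<epsilon>]) (simp add: y_def)
      finally show ?thesis .
    qed
    have r0: "r \<ge> 0"
      by (simp add: r_def)
    have "d\<^sup>2 + (1 + a) * r\<^sup>2 \<le> (1 + a) * (r + \<bar>d\<bar>)\<^sup>2"
    proof -
      have "(1 + a) * (r + \<bar>d\<bar>)\<^sup>2 - (d\<^sup>2 + (1 + a) * r\<^sup>2) = a * d\<^sup>2 + 2 * (1 + a) * (r * \<bar>d\<bar>)"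
        by (simp add: power2_eq_square algebra_simps)
      moreover have "a * d\<^sup>2 \<ge> 0" "2 * (1 + a) * (r * \<bar>d\<bar>) \<ge> 0"
        using a r0 by auto
      ultimately show ?thesis by linarith
    qed
    then have "\<epsilon> * (d\<^sup>2 + (1 + a) * r\<^sup>2) \<le> \<epsilon> * ((1 + a) * (r + \<bar>d\<bar>)\<^sup>2)"
      using \<epsilon> by simp
    also have "\<dots> \<le> (1 + a) * (1 + y)\<^sup>2"
      using mult_left_mono[OF sq, of "1 + a"] a by (simp add: algebra_simps)
    also have "\<dots> \<le> (1 + (a + 1)) * (a + 1) * (1 + y)\<^sup>2 + (a + 1) * (1 + y)\<^sup>2"
      using a by (simp add: add.commute)
    finally have "exp (\<epsilon> * (d\<^sup>2 + (1 + a) * r\<^sup>2)) \<le> exp ((1 + (a + 1)) * (a + 1) * (1 + y)\<^sup>2 + (a + 1) * (1 + y)\<^sup>2)"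
      by (rule exp_le_cancel_iff[THEN iffD2])
    then have 1: "gnahm a r d \<epsilon> \<le> C"
      using gnahm_even_le[OF \<epsilon>(1), of j d, folded r_def] unfolding C_def by linarith
    have "((a + 1) * r + \<bar>d\<bar>)\<^sup>2 \<le> ((a + 1) * (r + \<bar>d\<bar>))\<^sup>2"
      using a r0 by (intro power_mono) (auto simp: algebra_simps)
    then have "\<epsilon> * ((a + 1) * r + \<bar>d\<bar>)\<^sup>2 \<le> \<epsilon> * ((a + 1) * (r + \<bar>d\<bar>))\<^sup>2"
      using \<epsilon> by simp
    also have "\<dots> \<le> (a + 1)\<^sup>2 * (1 + y)\<^sup>2"
      using mult_left_mono[OF sq, of "(a + 1)\<^sup>2"] by (simp only: power_mult_distrib mult.left_commute[of \<epsilon>] zero_le_power2)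
    also have "\<dots> \<le> (1 + (a + 1)) * (a + 1) * (1 + y)\<^sup>2 + (a + 1) * (1 + y)\<^sup>2"
    proof -
      have "(1 + (a + 1)) * (a + 1) * (1 + y)\<^sup>2 + (a + 1) * (1 + y)\<^sup>2 - (a + 1)\<^sup>2 * (1 + y)\<^sup>2 = 2 * (a + 1) * (1 + y)\<^sup>2"
        by (simp add: power2_eq_square algebra_simps)
      moreover have "0 \<le> 2 * (a + 1) * (1 + y)\<^sup>2"
        using a by simp
      ultimately show ?thesis
        by linarith
    qed
    finally have "exp (\<epsilon> * ((a + 1) * r + \<bar>d\<bar>)\<^sup>2) \<le> exp ((1 + (a + 1)) * (a + 1) * (1 + y)\<^sup>2 + (a + 1) * (1 + y)\<^sup>2)"
      by (rule exp_le_cancel_iff[THEN iffD2])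
    moreover have "gnahm a (- r) d \<epsilon> \<le> 2 * exp (\<epsilon> * ((a + 1) * r + \<bar>d\<bar>)\<^sup>2)"
      using gnahm_neg_le[OF \<epsilon>(1), of "2 * j" d] by (simp only: r_def of_nat_mult of_nat_numeral)
    ultimately have 2: "gnahm a (- r) d \<epsilon> \<le> C"
      unfolding C_def by linarith
    show ?thesis
      using r1 1 2 by (intro exI[of _ r]) auto
  qed
  then show "\<exists>C. \<forall>\<epsilon>. 0 < \<epsilon> \<longrightarrow> \<epsilon> < 1 \<longrightarrow> (\<exists>r\<ge>1 / sqrt \<epsilon> + \<bar>x\<bar>. gnahm a r d \<epsilon> + gnahm a (- r) d \<epsilon> \<le> C)"
    by blast
qed fact

end

section \<open>The asymptotic expansion\<close>

lemma continuous_imp_bigo_1: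
  fixes f :: "real \<Rightarrow> real"
  assumes "isCont f 0"
  shows "f \<in> O[at_right 0](\<lambda>_. 1)"
proof -
  have "(f \<longlongrightarrow> f 0) (at_right 0)"
    using assms unfolding isCont_def by (rule filterlim_mono) (auto simp: at_le)
  then show ?thesis
    by (intro bigoI_tendsto[of _ _ "f 0"]) auto
qed

lemma exp_expansion:
  fixes a1 a2 a3 a4 :: real
  shows "(\<lambda>\<epsilon>. exp (a1 * \<epsilon> + a2 * \<epsilon> ^ 2 + a3 * \<epsilon> ^ 3 + a4 * \<epsilon> ^ 4) -
    (1 + a1 * \<epsilon> + (a2 + a1 ^ 2 / 2) * \<epsilon> ^ 2 + (a3 + a1 * a2 + a1 ^ 3 / 6) * \<epsilon> ^ 3
      + (a4 + a1 * a3 + a2 ^ 2 / 2 + a1 ^ 2 * a2 / 2 + a1 ^ 4 / 24) * \<epsilon> ^ 4))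
    \<in> O[at_right 0](\<lambda>\<epsilon>. \<epsilon> ^ 5)"
proof -
  define f where "f = (\<lambda>\<epsilon>. a1 * \<epsilon> + a2 * \<epsilon> ^ 2 + a3 * \<epsilon> ^ 3 + a4 * \<epsilon> ^ 4)"
  \<comment> \<open>Writing f = \<epsilon> (a1 + \<epsilon> u) makes the remainders of f^3 and f^4
    explicit multiples of \<epsilon>^5 with continuous cofactors.\<close>
  define u where "u = (\<lambda>\<epsilon>. a2 + a3 * \<epsilon> + a4 * \<epsilon> ^ 2)"
  define R where "R = (\<lambda>\<epsilon>. ((2 * a1 * a4 + 2 * a2 * a3) + (a3 ^ 2 + 2 * a2 * a4) * \<epsilon> + 2 * a3 * a4 * \<epsilon> ^ 2 + a4 ^ 2 * \<epsilon> ^ 3) / 2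
    + (3 * a1 ^ 2 * (a3 + a4 * \<epsilon>) + 3 * a1 * u \<epsilon> ^ 2 + \<epsilon> * u \<epsilon> ^ 3) / 6
    + (4 * a1 ^ 3 * u \<epsilon> + 6 * a1 ^ 2 * \<epsilon> * u \<epsilon> ^ 2 + 4 * a1 * \<epsilon> ^ 2 * u \<epsilon> ^ 3 + \<epsilon> ^ 3 * u \<epsilon> ^ 4) / 24)"
  have "f = (\<lambda>\<epsilon>. \<epsilon> * (a1 + a2 * \<epsilon> + a3 * \<epsilon> ^ 2 + a4 * \<epsilon> ^ 3))"
    by (simp add: f_def fun_eq_iff eval_nat_numeral algebra_simps)
  moreover have "(\<lambda>\<epsilon>. \<epsilon> * (a1 + a2 * \<epsilon> + a3 * \<epsilon> ^ 2 + a4 * \<epsilon> ^ 3)) \<in> O[at_right 0](\<lambda>\<epsilon>. \<epsilon> * 1)"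
    by (intro landau_o.big.mult continuous_imp_bigo_1 continuous_intros) auto
  ultimately have "f \<in> O[at_right 0](\<lambda>\<epsilon>. \<epsilon>)"
    by simp
  then have 1: "(\<lambda>\<epsilon>. exp (f \<epsilon>) - (\<Sum>j<5. f \<epsilon> ^ j / fact j)) \<in> O[at_right 0](\<lambda>\<epsilon>. \<epsilon> ^ 5)"
    by (rule exp_partial_sum_bigo)
  have "(\<lambda>\<epsilon>. \<epsilon> ^ 5 * R \<epsilon>) \<in> O[at_right 0](\<lambda>\<epsilon>. \<epsilon> ^ 5 * 1)"
    unfolding R_def u_def by (intro landau_o.big.mult continuous_imp_bigo_1 continuous_intros) auto
  then have 2: "(\<lambda>\<epsilon>. \<epsilon> ^ 5 * R \<epsilon>) \<in> O[at_right 0](\<lambda>\<epsilon>. \<epsilon> ^ 5)"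
    by simp
  have fu: "f \<epsilon> = \<epsilon> * (a1 + \<epsilon> * u \<epsilon>)" for \<epsilon>
    by (simp add: f_def u_def eval_nat_numeral algebra_simps)
  have "(\<Sum>j<5. f \<epsilon> ^ j / fact j) = 1 + f \<epsilon> + f \<epsilon> ^ 2 / 2 + f \<epsilon> ^ 3 / 6 + f \<epsilon> ^ 4 / 24" for \<epsilon>
    by (simp add: eval_nat_numeral)
  moreover have "f \<epsilon> ^ 2 = a1 ^ 2 * \<epsilon> ^ 2 + 2 * a1 * a2 * \<epsilon> ^ 3 + (a2 ^ 2 + 2 * a1 * a3) * \<epsilon> ^ 4
      + \<epsilon> ^ 5 * ((2 * a1 * a4 + 2 * a2 * a3) + (a3 ^ 2 + 2 * a2 * a4) * \<epsilon> + 2 * a3 * a4 * \<epsilon> ^ 2 + a4 ^ 2 * \<epsilon> ^ 3)" for \<epsilon>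
    by (simp add: f_def eval_nat_numeral algebra_simps)
  moreover have "f \<epsilon> ^ 3 = a1 ^ 3 * \<epsilon> ^ 3 + 3 * a1 ^ 2 * a2 * \<epsilon> ^ 4
      + \<epsilon> ^ 5 * (3 * a1 ^ 2 * (a3 + a4 * \<epsilon>) + 3 * a1 * u \<epsilon> ^ 2 + \<epsilon> * u \<epsilon> ^ 3)" for \<epsilon>
  proof -
    have a2: "a2 = u \<epsilon> - a3 * \<epsilon> - a4 * \<epsilon> ^ 2"
      by (simp add: u_def)
    show ?thesis
      unfolding fu by (subst a2) (simp add: eval_nat_numeral algebra_simps)
  qed
  moreover have "f \<epsilon> ^ 4 = a1 ^ 4 * \<epsilon> ^ 4
      + \<epsilon> ^ 5 * (4 * a1 ^ 3 * u \<epsilon> + 6 * a1 ^ 2 * \<epsilon> * u \<epsilon> ^ 2 + 4 * a1 * \<epsilon> ^ 2 * u \<epsilon> ^ 3 + \<epsilon> ^ 3 * u \<epsilon> ^ 4)" for \<epsilon>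
    unfolding fu by (simp add: eval_nat_numeral algebra_simps)
  ultimately have "(\<Sum>j<5. f \<epsilon> ^ j / fact j) = (1 + a1 * \<epsilon> + (a2 + a1 ^ 2 / 2) * \<epsilon> ^ 2 + (a3 + a1 * a2 + a1 ^ 3 / 6) * \<epsilon> ^ 3
      + (a4 + a1 * a3 + a2 ^ 2 / 2 + a1 ^ 2 * a2 / 2 + a1 ^ 4 / 24) * \<epsilon> ^ 4) + \<epsilon> ^ 5 * R \<epsilon>" for \<epsilon>
    by (simp add: R_def f_def algebra_simps add_divide_distrib)
  then show ?thesis
    using sum_in_bigo(1)[OF 1 2] by (simp add: f_def algebra_simps)
qed

text \<open>The hypotheses are the vanishing of the coefficients of \<epsilon>, ..., \<epsilon>^4 in
  the sum of the two exponentials, simplified by b1 = -a1.\<close>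

lemma exp_pair_bigo:
  fixes a1 a2 a3 a4 b1 b2 b3 b4 :: real
  assumes "a1 + b1 = 0" "a2 + b2 + a1\<^sup>2 = 0" "a3 + b3 + a1 * (a2 - b2) = 0"
    "a4 + b4 + a1 * (a3 - b3) + (a2\<^sup>2 + b2\<^sup>2) / 2 + a1\<^sup>2 * (a2 + b2) / 2 + a1 ^ 4 / 12 = 0"
  shows "(\<lambda>\<epsilon>. exp (a1 * \<epsilon> + a2 * \<epsilon>^2 + a3 * \<epsilon>^3 + a4 * \<epsilon>^4) + exp (b1 * \<epsilon> + b2 * \<epsilon>^2 + b3 * \<epsilon>^3 + b4 * \<epsilon>^4) - 2)
    \<in> O[at_right 0](\<lambda>\<epsilon>. \<epsilon> ^ 5)"
proof -
  have b1: "b1 = - a1"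
    using assms(1) by simp
  have "(1 + a1 * \<epsilon> + (a2 + a1 ^ 2 / 2) * \<epsilon> ^ 2 + (a3 + a1 * a2 + a1 ^ 3 / 6) * \<epsilon> ^ 3
      + (a4 + a1 * a3 + a2 ^ 2 / 2 + a1 ^ 2 * a2 / 2 + a1 ^ 4 / 24) * \<epsilon> ^ 4)
    + (1 + b1 * \<epsilon> + (b2 + b1 ^ 2 / 2) * \<epsilon> ^ 2 + (b3 + b1 * b2 + b1 ^ 3 / 6) * \<epsilon> ^ 3
      + (b4 + b1 * b3 + b2 ^ 2 / 2 + b1 ^ 2 * b2 / 2 + b1 ^ 4 / 24) * \<epsilon> ^ 4)
    = 2 + (a1 + b1) * \<epsilon> + (a2 + b2 + a1\<^sup>2) * \<epsilon> ^ 2 + (a3 + b3 + a1 * (a2 - b2)) * \<epsilon> ^ 3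
      + (a4 + b4 + a1 * (a3 - b3) + (a2\<^sup>2 + b2\<^sup>2) / 2 + a1\<^sup>2 * (a2 + b2) / 2 + a1 ^ 4 / 12) * \<epsilon> ^ 4" for \<epsilon>
    unfolding b1 by (simp add: field_simps)
  then have "(1 + a1 * \<epsilon> + (a2 + a1 ^ 2 / 2) * \<epsilon> ^ 2 + (a3 + a1 * a2 + a1 ^ 3 / 6) * \<epsilon> ^ 3
      + (a4 + a1 * a3 + a2 ^ 2 / 2 + a1 ^ 2 * a2 / 2 + a1 ^ 4 / 24) * \<epsilon> ^ 4)
    + (1 + b1 * \<epsilon> + (b2 + b1 ^ 2 / 2) * \<epsilon> ^ 2 + (b3 + b1 * b2 + b1 ^ 3 / 6) * \<epsilon> ^ 3
      + (b4 + b1 * b3 + b2 ^ 2 / 2 + b1 ^ 2 * b2 / 2 + b1 ^ 4 / 24) * \<epsilon> ^ 4) = 2" for \<epsilon>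
    unfolding assms by simp
  then have eq: "exp (a1 * \<epsilon> + a2 * \<epsilon>^2 + a3 * \<epsilon>^3 + a4 * \<epsilon>^4) + exp (b1 * \<epsilon> + b2 * \<epsilon>^2 + b3 * \<epsilon>^3 + b4 * \<epsilon>^4) - 2 =
    (exp (a1 * \<epsilon> + a2 * \<epsilon> ^ 2 + a3 * \<epsilon> ^ 3 + a4 * \<epsilon> ^ 4) -
    (1 + a1 * \<epsilon> + (a2 + a1 ^ 2 / 2) * \<epsilon> ^ 2 + (a3 + a1 * a2 + a1 ^ 3 / 6) * \<epsilon> ^ 3
      + (a4 + a1 * a3 + a2 ^ 2 / 2 + a1 ^ 2 * a2 / 2 + a1 ^ 4 / 24) * \<epsilon> ^ 4)) +
    (exp (b1 * \<epsilon> + b2 * \<epsilon> ^ 2 + b3 * \<epsilon> ^ 3 + b4 * \<epsilon> ^ 4) -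
    (1 + b1 * \<epsilon> + (b2 + b1 ^ 2 / 2) * \<epsilon> ^ 2 + (b3 + b1 * b2 + b1 ^ 3 / 6) * \<epsilon> ^ 3
      + (b4 + b1 * b3 + b2 ^ 2 / 2 + b1 ^ 2 * b2 / 2 + b1 ^ 4 / 24) * \<epsilon> ^ 4))" for \<epsilon>
    by (smt (verit))
  show ?thesis
    unfolding eq by (intro sum_in_bigo exp_expansion)
qed

text \<open>
  The coefficients \<open>\<kappa>\<^sub>p\<close> of the logarithm of the normalised sum, in the variables
  \<open>s = B\<^sub>1 + B\<^sub>2\<close>, \<open>e = (B\<^sub>1 - B\<^sub>2)/2a\<close> and \<open>u = 1 - 1/a\<close>. They are the solution of the recursion that
  the shift equation imposes, with \<open>\<kappa>\<^sub>p = 0\<close> for \<open>s = 0\<close> and \<open>p \<ge> 2\<close>.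
\<close>

definition kappa1 :: "real \<Rightarrow> real \<Rightarrow> real \<Rightarrow> real" where
  "kappa1 a s d = d\<^sup>2 / (2 * a) + s * (1 - 1 / a) / 8 + s\<^sup>2 / 8"

definition kappa2 :: "real \<Rightarrow> real \<Rightarrow> real \<Rightarrow> real" where
  "kappa2 u s e = s * (3 * u\<^sup>2 + 2) / 192 - s * e\<^sup>2 / 8 + s\<^sup>2 * u\<^sup>2 / 64 - s ^ 3 / 96"

definition kappa3 :: "real \<Rightarrow> real \<Rightarrow> real \<Rightarrow> real" where
  "kappa3 u s e = s * (2 * u ^ 3 + u) / 384 - s * u * e\<^sup>2 / 32 + s\<^sup>2 * u ^ 3 / 128 - s\<^sup>2 * u * e\<^sup>2 / 32
     + s ^ 3 * (u ^ 3 - u) / 384"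

definition kappa4 :: "real \<Rightarrow> real \<Rightarrow> real \<Rightarrow> real" where
  "kappa4 u s e = s * (255 * u ^ 4 + 120 * u\<^sup>2 + 14) / 92160 - s * e\<^sup>2 * (6 * u\<^sup>2 + 1) / 384 + s * e ^ 4 / 192
     + s\<^sup>2 * (8 * u ^ 4 + u\<^sup>2) / 1536 - 3 * s\<^sup>2 * e\<^sup>2 * u\<^sup>2 / 128 + s ^ 3 * (27 * u ^ 4 - 12 * u\<^sup>2 - 2) / 9216
     + s ^ 3 * e\<^sup>2 * (1 - 3 * u\<^sup>2) / 384 + s ^ 4 * (3 * u ^ 4 - 4 * u\<^sup>2) / 6144 + s ^ 5 / 15360"

definition log_expansion :: "real \<Rightarrow> real \<Rightarrow> real \<Rightarrow> real \<Rightarrow> real" where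
  "log_expansion a s d \<epsilon> = kappa1 a s d * \<epsilon> + kappa2 (1 - 1/a) s (d/a) * \<epsilon> ^ 2
     + kappa3 (1 - 1/a) s (d/a) * \<epsilon> ^ 3 + kappa4 (1 - 1/a) s (d/a) * \<epsilon> ^ 4"

text \<open>Once the exponent a/2 + s/2 + d of the prefactor in the shift equation is included, the
  first-order increments of its two terms are opposite, as the coefficient of \<epsilon>
  demands.\<close>

lemma kappa1_differences:
  fixes a s d :: real
  assumes "a \<noteq> 0"
  defines "u \<equiv> 1 - 1/a" and "e \<equiv> d/a"
  shows "kappa1 a (s + 1) (d + 1/2) - kappa1 a s d = e / 2 + s / 4 + 1 / 4"
    and "kappa1 a (s + 1) (d + a - 1/2) - kappa1 a s d - (a/2 + s/2 + d) = - (e / 2 + s / 4 + 1 / 4)"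
  using assms by (simp_all add: kappa1_def power2_eq_square field_simps)

text \<open>The fourth-order equation with the denominator 92160 cleared, in the centred variables S
  = s + 1 and m = e + 1/2. The two shifted points are m - u/2 and m + u/2; since
  \<open>kappa4\<close> is even in e, they enter only through their power sums \<open>P2\<close> and
  \<open>P4\<close>.\<close>

lemma kappa4_identity:
  fixes S m u e s a1 P2 P4 :: real
  assumes "e = m - 1/2" "s = S - 1" "a1 = (2*m + S - 1)/4" "P2 = 2*m^2 + u^2/2" "P4 = 2*m^4+3*m^2*u^2+u^4/8"
  shows "(2 * (S * (255 * u ^ 4 + 120 * u\<^sup>2 + 14)) - 240 * (S * (6 * u\<^sup>2 + 1)) * P2 + 480 * S * P4
     + 120 * S\<^sup>2 * (8 * u ^ 4 + u\<^sup>2) - 2160 * S\<^sup>2 * u\<^sup>2 * P2 + 20 * S ^ 3 * (27 * u ^ 4 - 12 * u\<^sup>2 - 2)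
     + 240 * S ^ 3 * (1 - 3 * u\<^sup>2) * P2 + 30 * S ^ 4 * (3 * u ^ 4 - 4 * u\<^sup>2) + 12 * S ^ 5) -
     2 * (s * (255 * u ^ 4 + 120 * u\<^sup>2 + 14) - 240 * (s * (6 * u\<^sup>2 + 1)) * e\<^sup>2 + 480 * s * e ^ 4
     + 60 * s\<^sup>2 * (8 * u ^ 4 + u\<^sup>2) - 2160 * s\<^sup>2 * u\<^sup>2 * e\<^sup>2 + 10 * s ^ 3 * (27 * u ^ 4 - 12 * u\<^sup>2 - 2)
     + 240 * s ^ 3 * (1 - 3 * u\<^sup>2) * e\<^sup>2 + 15 * s ^ 4 * (3 * u ^ 4 - 4 * u\<^sup>2) + 6 * s ^ 5)
   = 92160 * (- a1 * (S*(1+S)*u^2*m/16) - (S*m*u/4)^2/4 + a1^4/6)"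
  unfolding assms by (simp add: power2_eq_square power3_eq_cube power4_eq_xxxx field_simps power_numeral_reduce)

lemma kappa4_sum:
  fixes S m u e s a1 x y :: real
  assumes e: "e = m - 1/2" "s = S - 1" "a1 = (2 * m + S - 1) / 4"
    and P: "x\<^sup>2 + y\<^sup>2 = 2 * m\<^sup>2 + u\<^sup>2 / 2" "x ^ 4 + y ^ 4 = 2 * m ^ 4 + 3 * m\<^sup>2 * u\<^sup>2 + u ^ 4 / 8"
  shows "kappa4 u S x + kappa4 u S y - 2 * kappa4 u s e = - a1 * (S * (1 + S) * u\<^sup>2 * m / 16) - (S * m * u / 4)\<^sup>2 / 4 + a1 ^ 4 / 6"
proof -
  have "92160 * (kappa4 u S x + kappa4 u S y - 2 * kappa4 u s e) = ((2 * (S * (255 * u ^ 4 + 120 * u\<^sup>2 + 14)) - 240 * (S * (6 * u\<^sup>2 + 1)) * (x\<^sup>2 + y\<^sup>2) + 480 * S * (x ^ 4 + y ^ 4)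
     + 120 * S\<^sup>2 * (8 * u ^ 4 + u\<^sup>2) - 2160 * S\<^sup>2 * u\<^sup>2 * (x\<^sup>2 + y\<^sup>2) + 20 * S ^ 3 * (27 * u ^ 4 - 12 * u\<^sup>2 - 2)
     + 240 * S ^ 3 * (1 - 3 * u\<^sup>2) * (x\<^sup>2 + y\<^sup>2) + 30 * S ^ 4 * (3 * u ^ 4 - 4 * u\<^sup>2) + 12 * S ^ 5) -
     2 * (s * (255 * u ^ 4 + 120 * u\<^sup>2 + 14) - 240 * (s * (6 * u\<^sup>2 + 1)) * e\<^sup>2 + 480 * s * e ^ 4
     + 60 * s\<^sup>2 * (8 * u ^ 4 + u\<^sup>2) - 2160 * s\<^sup>2 * u\<^sup>2 * e\<^sup>2 + 10 * s ^ 3 * (27 * u ^ 4 - 12 * u\<^sup>2 - 2)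
     + 240 * s ^ 3 * (1 - 3 * u\<^sup>2) * e\<^sup>2 + 15 * s ^ 4 * (3 * u ^ 4 - 4 * u\<^sup>2) + 6 * s ^ 5))"
    by (simp add: kappa4_def algebra_simps add_divide_distrib diff_divide_distrib)
  also have "\<dots> = 92160 * (- a1 * (S * (1 + S) * u\<^sup>2 * m / 16) - (S * m * u / 4)\<^sup>2 / 4 + a1 ^ 4 / 6)"
    by (rule kappa4_identity[OF e P])
  finally show ?thesis
    by (rule mult_left_cancel[THEN iffD1, rotated]) simp
qed

text \<open>The points x and y are the values of d/a on the right of the shift equation. In the last
  equation a2^2 + b2^2 is expressed by a2 + b2 = -a1^2 and a2 - b2, so that only differences remain
  in orders 2 and 3. These are short, because \<open>kappa2\<close> and \<open>kappa3\<close> depend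
  on e through e^2 alone.\<close>

lemma kappa_recursion:
  fixes u s e :: real
  defines "x \<equiv> e + (1 - u) / 2" and "y \<equiv> e + (1 + u) / 2" and "a1 \<equiv> e / 2 + s / 4 + 1 / 4"
  defines "a2 \<equiv> kappa2 u (s + 1) x - kappa2 u s e" and "b2 \<equiv> kappa2 u (s + 1) y - kappa2 u s e"
    and "a3 \<equiv> kappa3 u (s + 1) x - kappa3 u s e" and "b3 \<equiv> kappa3 u (s + 1) y - kappa3 u s e"
    and "a4 \<equiv> kappa4 u (s + 1) x - kappa4 u s e" and "b4 \<equiv> kappa4 u (s + 1) y - kappa4 u s e"
  shows "a2 + b2 + a1\<^sup>2 = 0" "a3 + b3 + a1 * (a2 - b2) = 0"
    "a4 + b4 + a1 * (a3 - b3) + (a2\<^sup>2 + b2\<^sup>2) / 2 + a1\<^sup>2 * (a2 + b2) / 2 + a1 ^ 4 / 12 = 0"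
proof -
  show sum2: "a2 + b2 + a1\<^sup>2 = 0"
    unfolding a2_def b2_def a1_def x_def y_def kappa2_def by (simp add: eval_nat_numeral field_simps)
  show "a3 + b3 + a1 * (a2 - b2) = 0"
    unfolding a2_def b2_def a3_def b3_def a1_def x_def y_def kappa2_def kappa3_def by (simp add: eval_nat_numeral field_simps)
  define m where "m = e + 1/2"
  define S where "S = s + 1"
  have sq: "x\<^sup>2 - y\<^sup>2 = - (2 * m * u)"
    by (simp add: x_def y_def m_def power2_eq_square field_simps)
  have "a2 - b2 = - (S / 8) * (x\<^sup>2 - y\<^sup>2)"
    unfolding a2_def b2_def kappa2_def S_def by (simp add: field_simps)
  then have diff2: "a2 - b2 = S * m * u / 4"
    unfolding sq by simp
  have "a3 - b3 = - (S * u / 32 + S\<^sup>2 * u / 32) * (x\<^sup>2 - y\<^sup>2)"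
    unfolding a3_def b3_def kappa3_def S_def by (simp add: field_simps)
  then have diff3: "a3 - b3 = S * (1 + S) * u\<^sup>2 * m / 16"
    unfolding sq by (simp add: power2_eq_square algebra_simps)
  have P2: "x\<^sup>2 + y\<^sup>2 = 2 * m\<^sup>2 + u\<^sup>2 / 2"
    by (simp add: x_def y_def m_def power2_eq_square field_simps)
  have P4: "x ^ 4 + y ^ 4 = 2 * m ^ 4 + 3 * m\<^sup>2 * u\<^sup>2 + u ^ 4 / 8"
    by (simp add: x_def y_def m_def eval_nat_numeral field_simps)
  have "a4 + b4 = kappa4 u S x + kappa4 u S y - 2 * kappa4 u s e"
    by (simp add: a4_def b4_def S_def)
  also have "\<dots> = - a1 * (S * (1 + S) * u\<^sup>2 * m / 16) - (S * m * u / 4)\<^sup>2 / 4 + a1 ^ 4 / 6"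
    by (rule kappa4_sum[OF _ _ _ P2 P4]) (simp_all add: m_def S_def a1_def)
  finally have sum4: "a4 + b4 = - a1 * (a3 - b3) - (a2 - b2)\<^sup>2 / 4 + a1 ^ 4 / 6"
    unfolding diff2 diff3 .
  have "(a2\<^sup>2 + b2\<^sup>2) / 2 = ((a2 + b2)\<^sup>2 + (a2 - b2)\<^sup>2) / 4"
    by (simp add: power2_eq_square field_simps)
  moreover have "a2 + b2 = - a1\<^sup>2"
    using sum2 by simp
  ultimately have "a4 + b4 + a1 * (a3 - b3) + (a2\<^sup>2 + b2\<^sup>2) / 2 + a1\<^sup>2 * (a2 + b2) / 2 + a1 ^ 4 / 12
    = - a1 * (a3 - b3) - (a2 - b2)\<^sup>2 / 4 + a1 ^ 4 / 6 + a1 * (a3 - b3) + ((- a1\<^sup>2)\<^sup>2 + (a2 - b2)\<^sup>2) / 4 + a1\<^sup>2 * (- a1\<^sup>2) / 2 + a1 ^ 4 / 12"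
    unfolding sum4 by simp
  also have "\<dots> = 0"
    by (simp add: eval_nat_numeral field_simps)
  finally show "a4 + b4 + a1 * (a3 - b3) + (a2\<^sup>2 + b2\<^sup>2) / 2 + a1\<^sup>2 * (a2 + b2) / 2 + a1 ^ 4 / 12 = 0" .
qed

text \<open>After division by \<open>exp (log_expansion a s d \<epsilon>)\<close> the claim concerns
  two exponentials minus 2, whose low coefficients vanish by the recursion.\<close>

lemma log_expansion_shift:
  assumes "a \<noteq> 0"
  shows "(\<lambda>\<epsilon>. exp (log_expansion a (s + 1) (d + 1/2) \<epsilon>)
      + exp (- (\<epsilon> * (a/2 + s/2 + d))) * exp (log_expansion a (s + 1) (d + a - 1/2) \<epsilon>)
      - 2 * exp (log_expansion a s d \<epsilon>)) \<in> O[at_right 0](\<lambda>\<epsilon>. \<epsilon> ^ 5)"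
proof -
  define u where "u = 1 - 1/a"
  define e where "e = d/a"
  have x: "(d + 1/2) / a = e + (1 - u) / 2" and y: "(d + a - 1/2) / a = e + (1 + u) / 2"
    using assms by (simp_all add: u_def e_def field_simps)
  define a1 where "a1 = e / 2 + s / 4 + 1 / 4"
  define a2 where "a2 = kappa2 u (s + 1) (e + (1 - u) / 2) - kappa2 u s e"
  define b2 where "b2 = kappa2 u (s + 1) (e + (1 + u) / 2) - kappa2 u s e"
  define a3 where "a3 = kappa3 u (s + 1) (e + (1 - u) / 2) - kappa3 u s e"
  define b3 where "b3 = kappa3 u (s + 1) (e + (1 + u) / 2) - kappa3 u s e"
  define a4 where "a4 = kappa4 u (s + 1) (e + (1 - u) / 2) - kappa4 u s e"
  define b4 where "b4 = kappa4 u (s + 1) (e + (1 + u) / 2) - kappa4 u s e"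
  have A: "log_expansion a (s + 1) (d + 1/2) \<epsilon> = log_expansion a s d \<epsilon> + (a1 * \<epsilon> + a2 * \<epsilon>^2 + a3 * \<epsilon>^3 + a4 * \<epsilon>^4)" for \<epsilon>
  proof -
    have "kappa1 a (s + 1) (d + 1/2) = kappa1 a s d + a1"
      using kappa1_differences(1)[OF assms, of s d] by (simp add: a1_def e_def)
    then show ?thesis
      unfolding log_expansion_def x u_def[symmetric] e_def[symmetric]
      by (simp add: a2_def a3_def a4_def algebra_simps)
  qed
  have B: "- (\<epsilon> * (a/2 + s/2 + d)) + log_expansion a (s + 1) (d + a - 1/2) \<epsilon>
      = log_expansion a s d \<epsilon> + (- a1 * \<epsilon> + b2 * \<epsilon>^2 + b3 * \<epsilon>^3 + b4 * \<epsilon>^4)" for \<epsilon>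
  proof -
    have K: "kappa1 a (s + 1) (d + a - 1/2) = kappa1 a s d + (a/2 + s/2 + d) - a1"
      using kappa1_differences(2)[OF assms, of s d] by (simp add: a1_def e_def)
    show ?thesis
      unfolding log_expansion_def y u_def[symmetric] e_def[symmetric] K
      by (simp add: b2_def b3_def b4_def algebra_simps)
  qed
  have "(\<lambda>\<epsilon>. exp (a1 * \<epsilon> + a2 * \<epsilon>^2 + a3 * \<epsilon>^3 + a4 * \<epsilon>^4) + exp (- a1 * \<epsilon> + b2 * \<epsilon>^2 + b3 * \<epsilon>^3 + b4 * \<epsilon>^4) - 2)
    \<in> O[at_right 0](\<lambda>\<epsilon>. \<epsilon> ^ 5)"
    using kappa_recursion[of u s e]
    by (intro exp_pair_bigo) (simp_all only: a1_def a2_def a3_def a4_def b2_def b3_def b4_def add.right_inverse)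
  moreover have "(\<lambda>\<epsilon>. exp (log_expansion a s d \<epsilon>)) \<in> O[at_right 0](\<lambda>_. 1)"
    unfolding log_expansion_def by (intro continuous_imp_bigo_1 continuous_intros)
  ultimately have "(\<lambda>\<epsilon>. exp (log_expansion a s d \<epsilon>) * (exp (a1 * \<epsilon> + a2 * \<epsilon>^2 + a3 * \<epsilon>^3 + a4 * \<epsilon>^4) + exp (- a1 * \<epsilon> + b2 * \<epsilon>^2 + b3 * \<epsilon>^3 + b4 * \<epsilon>^4) - 2))
    \<in> O[at_right 0](\<lambda>\<epsilon>. 1 * \<epsilon> ^ 5)"
    by (intro landau_o.big.mult)
  moreover have "exp (log_expansion a s d \<epsilon>) * (exp (a1 * \<epsilon> + a2 * \<epsilon>^2 + a3 * \<epsilon>^3 + a4 * \<epsilon>^4) + exp (- a1 * \<epsilon> + b2 * \<epsilon>^2 + b3 * \<epsilon>^3 + b4 * \<epsilon>^4) - 2)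
      = exp (log_expansion a (s + 1) (d + 1/2) \<epsilon>)
      + exp (- (\<epsilon> * (a/2 + s/2 + d))) * exp (log_expansion a (s + 1) (d + a - 1/2) \<epsilon>)
      - 2 * exp (log_expansion a s d \<epsilon>)" for \<epsilon>
    unfolding exp_add[symmetric, of "- (\<epsilon> * (a/2 + s/2 + d))"] A B exp_add by (simp add: algebra_simps)
  ultimately show ?thesis
    by simp
qed

lemma log_expansion_0: "log_expansion a 0 d \<epsilon> = \<epsilon> * d\<^sup>2 / (2 * a)"
  by (simp add: log_expansion_def kappa1_def kappa2_def kappa3_def kappa4_def)

text \<open>In each of \<open>s\<close> and \<open>d\<close> the coefficient of \<open>\<epsilon>\<^sup>p\<close> has degree at most \<open>p + 1 \<le> 2p\<close>.\<close>

lemma tame_log_expansion_d: "tame (\<lambda>\<epsilon> d. log_expansion a s d \<epsilon>)"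
proof -
  define u where "u = 1 - 1/a"
  have "log_expansion a s d \<epsilon> =
      (1 / (2 * a) * (\<epsilon> * d\<^sup>2) + (s * u / 8 + s\<^sup>2 / 8) * \<epsilon>)
    + ((s * (3 * u\<^sup>2 + 2) / 192 + s\<^sup>2 * u\<^sup>2 / 64 - s ^ 3 / 96) * (\<epsilon> * \<epsilon>) + (- s / (8 * a\<^sup>2)) * (\<epsilon> * (\<epsilon> * d\<^sup>2)))
    + ((s * (2 * u ^ 3 + u) / 384 + s\<^sup>2 * u ^ 3 / 128 + s ^ 3 * (u ^ 3 - u) / 384) * (\<epsilon> * (\<epsilon> * \<epsilon>))
        + (- s * u / (32 * a\<^sup>2) - s\<^sup>2 * u / (32 * a\<^sup>2)) * (\<epsilon> * (\<epsilon> * (\<epsilon> * d\<^sup>2))))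
    + ((s * (255 * u ^ 4 + 120 * u\<^sup>2 + 14) / 92160 + s\<^sup>2 * (8 * u ^ 4 + u\<^sup>2) / 1536
        + s ^ 3 * (27 * u ^ 4 - 12 * u\<^sup>2 - 2) / 9216 + s ^ 4 * (3 * u ^ 4 - 4 * u\<^sup>2) / 6144 + s ^ 5 / 15360) * (\<epsilon> * (\<epsilon> * (\<epsilon> * \<epsilon>)))
      + (s ^ 3 * (1 - 3 * u\<^sup>2) / (384 * a\<^sup>2) - s * (6 * u\<^sup>2 + 1) / (384 * a\<^sup>2) - 3 * s\<^sup>2 * u\<^sup>2 / (128 * a\<^sup>2)) * (\<epsilon> * (\<epsilon> * (\<epsilon> * (\<epsilon> * d\<^sup>2))))
      + (s / (192 * a ^ 4)) * (\<epsilon> * (\<epsilon> * ((\<epsilon> * d\<^sup>2) * (\<epsilon> * d\<^sup>2)))))" for d \<epsilon>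
    unfolding log_expansion_def kappa1_def kappa2_def kappa3_def kappa4_def u_def[symmetric]
    by (simp add: power_divide eval_nat_numeral algebra_simps add_divide_distrib diff_divide_distrib)
  then show ?thesis
    by (simp only:) (rule tame_eps_x2 tame_eps tame_const tame_add tame_cmult tame_mult)+
qed

lemma tame_log_expansion_s: "tame (\<lambda>\<epsilon> s. log_expansion a s d \<epsilon>)"
proof -
  define u where "u = 1 - 1/a"
  define e where "e = d/a"
  have "log_expansion a s d \<epsilon> =
      (d\<^sup>2 / (2 * a) * \<epsilon> + u / 8 * (\<epsilon> * s) + 1 / 8 * (\<epsilon> * s\<^sup>2))
    + (((3 * u\<^sup>2 + 2) / 192 - e\<^sup>2 / 8) * (\<epsilon> * (\<epsilon> * s)) + u\<^sup>2 / 64 * (\<epsilon> * (\<epsilon> * s\<^sup>2)) + (- 1 / 96) * ((\<epsilon> * s) * (\<epsilon> * s\<^sup>2)))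
    + (((2 * u ^ 3 + u) / 384 - u * e\<^sup>2 / 32) * (\<epsilon> * (\<epsilon> * (\<epsilon> * s))) + (u ^ 3 / 128 - u * e\<^sup>2 / 32) * (\<epsilon> * (\<epsilon> * (\<epsilon> * s\<^sup>2)))
        + (u ^ 3 - u) / 384 * (\<epsilon> * ((\<epsilon> * s) * (\<epsilon> * s\<^sup>2))))
    + (((255 * u ^ 4 + 120 * u\<^sup>2 + 14) / 92160 - e\<^sup>2 * (6 * u\<^sup>2 + 1) / 384 + e ^ 4 / 192) * (\<epsilon> * (\<epsilon> * (\<epsilon> * (\<epsilon> * s))))
        + ((8 * u ^ 4 + u\<^sup>2) / 1536 - 3 * e\<^sup>2 * u\<^sup>2 / 128) * (\<epsilon> * (\<epsilon> * (\<epsilon> * (\<epsilon> * s\<^sup>2))))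
        + ((27 * u ^ 4 - 12 * u\<^sup>2 - 2) / 9216 + e\<^sup>2 * (1 - 3 * u\<^sup>2) / 384) * (\<epsilon> * (\<epsilon> * ((\<epsilon> * s) * (\<epsilon> * s\<^sup>2))))
        + (3 * u ^ 4 - 4 * u\<^sup>2) / 6144 * (\<epsilon> * (\<epsilon> * ((\<epsilon> * s\<^sup>2) * (\<epsilon> * s\<^sup>2))))
        + 1 / 15360 * (\<epsilon> * ((\<epsilon> * s) * ((\<epsilon> * s\<^sup>2) * (\<epsilon> * s\<^sup>2)))))" for s \<epsilon>
    unfolding log_expansion_def kappa1_def kappa2_def kappa3_def kappa4_def u_def[symmetric] e_def[symmetric]
    by (simp add: eval_nat_numeral algebra_simps add_divide_distrib diff_divide_distrib)
  then show ?thesis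
    by (simp only:) (rule tame_eps_x2 tame_eps_x tame_eps tame_const tame_add tame_cmult tame_mult)+
qed

lemma log_expansion_bigo: "log_expansion a s d \<in> O[at_right 0](\<lambda>\<epsilon>. \<epsilon>)"
proof -
  have "log_expansion a s d = (\<lambda>\<epsilon>. \<epsilon> * (kappa1 a s d + kappa2 (1 - 1/a) s (d/a) * \<epsilon>
     + kappa3 (1 - 1/a) s (d/a) * \<epsilon> ^ 2 + kappa4 (1 - 1/a) s (d/a) * \<epsilon> ^ 3))"
    by (simp add: log_expansion_def fun_eq_iff eval_nat_numeral algebra_simps)
  also have "\<dots> \<in> O[at_right 0](\<lambda>\<epsilon>. \<epsilon> * 1)"
    by (intro landau_o.big.mult continuous_imp_bigo_1 continuous_intros) auto
  finally show ?thesis by simp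
qed

text \<open>Cutting the exponential series after the fourth power gives a polynomial with the degree
  bounds of \<open>tame\<close>; since \<open>log_expansion\<close> is O(\<epsilon>), the error is
  O(\<epsilon>^5).\<close>

definition gapprox :: "real \<Rightarrow> real \<Rightarrow> real \<Rightarrow> real \<Rightarrow> real" where
  "gapprox a s d \<epsilon> = (\<Sum>j<5. log_expansion a s d \<epsilon> ^ j / fact j)"

lemma gapprox_bigo:
  "(\<lambda>\<epsilon>. exp (log_expansion a s d \<epsilon>) - gapprox a s d \<epsilon>) \<in> O[at_right 0](\<lambda>\<epsilon>. \<epsilon> ^ 5)"
  unfolding gapprox_def by (rule exp_partial_sum_bigo) (rule log_expansion_bigo)

lemma gapprox_near_poly:
  "near_poly 5 (\<lambda>\<epsilon> s. gapprox a s d \<epsilon>)" "near_poly 5 (\<lambda>\<epsilon> d. gapprox a s d \<epsilon>)"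
  unfolding gapprox_def divide_inverse
  by (intro tame_imp_near_poly tame_sum tame_mult tame_power tame_const tame_log_expansion_s tame_log_expansion_d; simp)+

lemma gapprox_bounded: "gapprox a s d \<in> O[at_right 0](\<lambda>_. 1)"
  unfolding gapprox_def log_expansion_def by (intro continuous_imp_bigo_1 continuous_intros) auto

text \<open>The induction starts from the theta series. By the induction hypothesis the error at
  level m + 1 satisfies the homogeneous shift equation up to O(\<epsilon>^5), an alternating
  relation under translation by a - 1; being bounded and approximately polynomial in d, it must be
  small.\<close>

lemma gnahm_expansion_nat:
  assumes a: "a > 1/2"
  shows "(\<lambda>\<epsilon>. gnahm a (real m) d \<epsilon> - gapprox a (real m) d \<epsilon>) \<in> O[at_right 0](\<lambda>\<epsilon>. \<epsilon> ^ 5)"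
proof (induction m arbitrary: d)
  case 0
  have "(\<lambda>\<epsilon>. rtheta a \<epsilon> d / rtheta a \<epsilon> 0 - exp (\<epsilon> * d\<^sup>2 / (2 * a))) \<in> O[at_right 0](\<lambda>\<epsilon>. \<epsilon> ^ 5)"
    by (rule rtheta_expansion) (use a in simp_all)
  moreover have "eventually (\<lambda>\<epsilon>. rtheta a \<epsilon> d / rtheta a \<epsilon> 0 - exp (\<epsilon> * d\<^sup>2 / (2 * a)) = gnahm a 0 d \<epsilon> - exp (log_expansion a 0 d \<epsilon>)) (at_right 0)"
    using eventually_at_right_0_pos by eventually_elim (simp add: gnahm_0[OF a] log_expansion_0)
  ultimately have "(\<lambda>\<epsilon>. gnahm a 0 d \<epsilon> - exp (log_expansion a 0 d \<epsilon>)) \<in> O[at_right 0](\<lambda>\<epsilon>. \<epsilon> ^ 5)"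
    by (subst (asm) landau_o.big.in_cong)
  from sum_in_bigo(1)[OF this gapprox_bigo[of a 0 d]] show ?case
    by simp
next
  case (Suc m)
  define g where "g = (\<lambda>\<epsilon> x. gnahm a (real (Suc m)) x \<epsilon> - gapprox a (real (Suc m)) x \<epsilon>)"
  have near: "near_poly 5 g"
    unfolding g_def by (intro near_poly_diff gnahm_near_poly_d[OF a] gapprox_near_poly) simp
  have bdd: "(\<lambda>\<epsilon>. g \<epsilon> x) \<in> O[at_right 0](\<lambda>_. 1)" for x
  proof -
    have "(\<lambda>\<epsilon>. gnahm a (real (Suc m)) x \<epsilon>) \<in> O[at_right 0](\<lambda>\<epsilon>. exp (\<epsilon> * (\<bar>x\<bar> + real (Suc m) / 2)\<^sup>2 / (2 * a)))"
    proof (rule bigoI[of _ "2 ^ Suc (Suc m)"])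
      show "\<forall>\<^sub>F \<epsilon> in at_right 0. norm (gnahm a (real (Suc m)) x \<epsilon>) \<le> 2 ^ Suc (Suc m) * norm (exp (\<epsilon> * (\<bar>x\<bar> + real (Suc m) / 2)\<^sup>2 / (2 * a)))"
        using eventually_at_right_0_pos
      proof eventually_elim
        case (elim \<epsilon>)
        then show ?case
          using gnahm_nat_le[OF a elim, of "Suc m" x] gnahm_pos[OF a elim, of "real (Suc m)" x]
          by (simp only: real_norm_def abs_exp_cancel abs_of_pos)
      qed
    qed
    also have "(\<lambda>\<epsilon>. exp (\<epsilon> * (\<bar>x\<bar> + real (Suc m) / 2)\<^sup>2 / (2 * a))) \<in> O[at_right 0](\<lambda>_. 1)"
      using a by (intro continuous_imp_bigo_1 continuous_intros) auto
    finally show ?thesis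
      unfolding g_def by (intro sum_in_bigo gapprox_bounded)
  qed
  have shift: "(\<lambda>\<epsilon>. g \<epsilon> (x + 1/2) + exp (- (\<epsilon> * (a/2 + real m/2 + x))) * g \<epsilon> (x + a - 1/2)) \<in> O[at_right 0](\<lambda>\<epsilon>. \<epsilon> ^ 5)" for x
  proof -
    define E where "E = (\<lambda>\<epsilon>. exp (- (\<epsilon> * (a/2 + real m/2 + x))))"
    have E: "E \<in> O[at_right 0](\<lambda>_. 1)"
      unfolding E_def by (intro continuous_imp_bigo_1 continuous_intros)
    let ?L = "\<lambda>s d \<epsilon>. exp (log_expansion a s d \<epsilon>)"
    let ?D = "\<lambda>s d \<epsilon>. ?L s d \<epsilon> - gapprox a s d \<epsilon>"
    have "(\<lambda>\<epsilon>. E \<epsilon> * ?D (real m + 1) (x + a - 1/2) \<epsilon>) \<in> O[at_right 0](\<lambda>\<epsilon>. 1 * \<epsilon> ^ 5)"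
      by (intro landau_o.big.mult E gapprox_bigo)
    then have EO: "(\<lambda>\<epsilon>. E \<epsilon> * ?D (real m + 1) (x + a - 1/2) \<epsilon>) \<in> O[at_right 0](\<lambda>\<epsilon>. \<epsilon> ^ 5)"
      by (simp only: mult_1_left)
    have IH: "(\<lambda>\<epsilon>. 2 * (gnahm a (real m) x \<epsilon> - gapprox a (real m) x \<epsilon>)) \<in> O[at_right 0](\<lambda>\<epsilon>. \<epsilon> ^ 5)"
      by (subst landau_o.big.cmult_in_iff) (simp, rule Suc.IH)
    have D0: "(\<lambda>\<epsilon>. 2 * ?D (real m) x \<epsilon>) \<in> O[at_right 0](\<lambda>\<epsilon>. \<epsilon> ^ 5)"
      by (subst landau_o.big.cmult_in_iff) (simp, rule gapprox_bigo)
    have L: "(\<lambda>\<epsilon>. ?L (real m + 1) (x + 1/2) \<epsilon> + E \<epsilon> * ?L (real m + 1) (x + a - 1/2) \<epsilon> - 2 * ?L (real m) x \<epsilon>) \<in> O[at_right 0](\<lambda>\<epsilon>. \<epsilon> ^ 5)"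
      unfolding E_def by (rule log_expansion_shift) (use a in simp)
    have "(\<lambda>\<epsilon>. 2 * (gnahm a (real m) x \<epsilon> - gapprox a (real m) x \<epsilon>) - 2 * ?D (real m) x \<epsilon>
        - (?L (real m + 1) (x + 1/2) \<epsilon> + E \<epsilon> * ?L (real m + 1) (x + a - 1/2) \<epsilon> - 2 * ?L (real m) x \<epsilon>)
        + ?D (real m + 1) (x + 1/2) \<epsilon> + E \<epsilon> * ?D (real m + 1) (x + a - 1/2) \<epsilon>) \<in> O[at_right 0](\<lambda>\<epsilon>. \<epsilon> ^ 5)"
      by (rule sum_in_bigo(1)[OF sum_in_bigo(1)[OF sum_in_bigo(2)[OF sum_in_bigo(2)[OF IH D0] L] gapprox_bigo] EO])
    moreover have "eventually (\<lambda>\<epsilon>. 2 * (gnahm a (real m) x \<epsilon> - gapprox a (real m) x \<epsilon>) - 2 * ?D (real m) x \<epsilon>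
        - (?L (real m + 1) (x + 1/2) \<epsilon> + E \<epsilon> * ?L (real m + 1) (x + a - 1/2) \<epsilon> - 2 * ?L (real m) x \<epsilon>)
        + ?D (real m + 1) (x + 1/2) \<epsilon> + E \<epsilon> * ?D (real m + 1) (x + a - 1/2) \<epsilon>
        = g \<epsilon> (x + 1/2) + E \<epsilon> * g \<epsilon> (x + a - 1/2)) (at_right 0)"
      using eventually_at_right_0_pos
    proof eventually_elim
      case (elim \<epsilon>)
      show ?case
        using gnahm_shift[OF a elim, of "real m" x]
        by (simp add: g_def E_def algebra_simps)
    qed
    ultimately show ?thesis
      unfolding E_def by (subst (asm) landau_o.big.in_cong)
  qed
  have "(\<lambda>\<epsilon>. g \<epsilon> x + exp (- (\<epsilon> * (a/2 + real m/2 + (x - 1/2)))) * g \<epsilon> (x + (a - 1))) \<in> O[at_right 0](\<lambda>\<epsilon>. \<epsilon> ^ 5)" for x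
    using shift[of "x - 1/2"] by (simp add: algebra_simps)
  from near_poly_alternating_imp_small[OF near bdd this] show ?case
    by (simp add: g_def)
qed

text \<open>Agreement at s = 0, ..., 9 suffices, because up to O(\<epsilon>^5) both sides are
  polynomials of degree below 10 in s.\<close>

lemma gnahm_expansion:
  assumes a: "a > 1/2"
  shows "(\<lambda>\<epsilon>. gnahm a s d \<epsilon> - exp (log_expansion a s d \<epsilon>)) \<in> O[at_right 0](\<lambda>\<epsilon>. \<epsilon> ^ 5)"
proof -
  have "near_poly 5 (\<lambda>\<epsilon> s. gnahm a s d \<epsilon> - gapprox a s d \<epsilon>)"
    by (intro near_poly_diff gnahm_near_poly_s[OF a] gapprox_near_poly) simp
  then have "(\<lambda>\<epsilon>. gnahm a s d \<epsilon> - gapprox a s d \<epsilon>) \<in> O[at_right 0](\<lambda>\<epsilon>. \<epsilon> ^ 5)"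
    by (rule near_poly_small_on_nats_imp_small) (rule gnahm_expansion_nat[OF a])
  from sum_in_bigo(2)[OF this gapprox_bigo[of a s d]] show ?thesis
    by simp
qed

section \<open>Consequences of modularity\<close>

lemma bigo_power_tendsto_0:
  fixes f :: "real \<Rightarrow> real"
  assumes "f \<in> O[at_right 0](\<lambda>\<epsilon>. \<epsilon> ^ Suc n)"
  shows "(f \<longlongrightarrow> 0) (at_right 0)"
proof -
  have "f \<in> o[at_right 0](\<lambda>_. 1)"
    by (rule landau_o.big_small_trans[OF assms]) real_asymp
  from smalloD_tendsto[OF this] show ?thesis
    by simp
qed

lemma bigo_scale:
  fixes f :: "real \<Rightarrow> real"
  assumes "f \<in> O[at_right 0](\<lambda>\<epsilon>. \<epsilon> ^ n)" "c > 0"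
  shows "(\<lambda>\<epsilon>. f (c * \<epsilon>)) \<in> O[at_right 0](\<lambda>\<epsilon>. \<epsilon> ^ n)"
proof -
  have "filterlim (\<lambda>\<epsilon>::real. c * \<epsilon>) (at_right 0) (at_right 0)"
    using assms(2) by real_asymp
  from landau_o.big.compose[OF assms(1) this]
  have "(\<lambda>\<epsilon>. f (c * \<epsilon>)) \<in> O[at_right 0](\<lambda>\<epsilon>. c ^ n * \<epsilon> ^ n)"
    by (simp add: power_mult_distrib)
  then show ?thesis
    using assms(2) by simp
qed

lemma ln_minus_bigo:
  fixes X k :: "real \<Rightarrow> real"
  assumes "(\<lambda>\<epsilon>. X \<epsilon> - exp (k \<epsilon>)) \<in> O[at_right 0](\<lambda>\<epsilon>. \<epsilon> ^ Suc n)" and "isCont k 0"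
    and "\<And>\<epsilon>. \<epsilon> > 0 \<Longrightarrow> X \<epsilon> > 0"
  shows "(\<lambda>\<epsilon>. ln (X \<epsilon>) - k \<epsilon>) \<in> O[at_right 0](\<lambda>\<epsilon>. \<epsilon> ^ Suc n)"
proof -
  define v where "v = (\<lambda>\<epsilon>. (X \<epsilon> - exp (k \<epsilon>)) * exp (- k \<epsilon>))"
  have "v \<in> O[at_right 0](\<lambda>\<epsilon>. \<epsilon> ^ Suc n * 1)"
    unfolding v_def by (intro landau_o.big.mult assms(1) continuous_imp_bigo_1 continuous_intros assms(2))
  then have v: "v \<in> O[at_right 0](\<lambda>\<epsilon>. \<epsilon> ^ Suc n)"
    by simp
  from ln_one_plus_bigo[OF v bigo_power_tendsto_0[OF v]]
  have "(\<lambda>\<epsilon>. ln (1 + v \<epsilon>)) \<in> O[at_right 0](\<lambda>\<epsilon>. \<epsilon> ^ Suc n)" .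
  moreover have "eventually (\<lambda>\<epsilon>. ln (1 + v \<epsilon>) = ln (X \<epsilon>) - k \<epsilon>) (at_right 0)"
    using eventually_at_right_0_pos
  proof eventually_elim
    case (elim \<epsilon>)
    have "1 + v \<epsilon> = X \<epsilon> * exp (- k \<epsilon>)"
      by (simp add: v_def algebra_simps flip: exp_add)
    then show ?case
      using assms(3)[OF elim] by (simp add: ln_mult)
  qed
  ultimately show ?thesis
    by (subst (asm) landau_o.big.in_cong)
qed

section \<open>Logarithms of theta series and of (q)_inf\<close>

text \<open>The odd part of the dissection carries exp(-\<epsilon> a/2), and the expansion of theta
  at d = a/2 and 4\<epsilon> carries exp(\<epsilon> a/2). These cancel, so the odd and even parts
  agree up to any power of \<epsilon>.\<close>

lemma ln_rtheta_dissection: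
  assumes "a > 0"
  shows "(\<lambda>\<epsilon>. ln (rtheta a \<epsilon> 0) - ln (rtheta a (4 * \<epsilon>) 0) - ln 2) \<in> O[at_right 0](\<lambda>\<epsilon>. \<epsilon> ^ Suc n)"
proof -
  define T where "T = (\<lambda>\<epsilon>. rtheta a \<epsilon> (a / 2) / rtheta a \<epsilon> 0)"
  have "(\<lambda>\<epsilon>. T \<epsilon> - exp (\<epsilon> * (a / 2)\<^sup>2 / (2 * a))) \<in> O[at_right 0](\<lambda>\<epsilon>. \<epsilon> ^ Suc n)"
    unfolding T_def by (rule rtheta_expansion[OF assms]) simp
  from bigo_scale[OF this, of 4]
  have 1: "(\<lambda>\<epsilon>. T (4 * \<epsilon>) - exp (\<epsilon> * a / 2)) \<in> O[at_right 0](\<lambda>\<epsilon>. \<epsilon> ^ Suc n)"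
    using assms by (simp add: power2_eq_square)
  have "(\<lambda>\<epsilon>. exp (- (\<epsilon> * a / 2)) * (T (4 * \<epsilon>) - exp (\<epsilon> * a / 2))) \<in> O[at_right 0](\<lambda>\<epsilon>. 1 * \<epsilon> ^ Suc n)"
    by (intro landau_o.big.mult 1 continuous_imp_bigo_1 continuous_intros) auto
  then have "(\<lambda>\<epsilon>. (1 + exp (- (\<epsilon> * a / 2)) * T (4 * \<epsilon>)) - exp (ln 2)) \<in> O[at_right 0](\<lambda>\<epsilon>. \<epsilon> ^ Suc n)"
    by (simp add: right_diff_distrib flip: exp_add)
  then have "(\<lambda>\<epsilon>. ln (1 + exp (- (\<epsilon> * a / 2)) * T (4 * \<epsilon>)) - ln 2) \<in> O[at_right 0](\<lambda>\<epsilon>. \<epsilon> ^ Suc n)"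
    by (rule ln_minus_bigo) (use rtheta_pos[OF assms] in \<open>auto simp: T_def intro!: add_pos_pos\<close>)
  moreover have "eventually (\<lambda>\<epsilon>. ln (1 + exp (- (\<epsilon> * a / 2)) * T (4 * \<epsilon>)) - ln 2
      = ln (rtheta a \<epsilon> 0) - ln (rtheta a (4 * \<epsilon>) 0) - ln 2) (at_right 0)"
    using eventually_at_right_0_pos
  proof eventually_elim
    case (elim \<epsilon>)
    have pos: "rtheta a (4 * \<epsilon>) 0 > 0" "rtheta a \<epsilon> 0 > 0"
      using rtheta_pos[OF assms] elim by auto
    have "1 + exp (- (\<epsilon> * a / 2)) * T (4 * \<epsilon>) = rtheta a \<epsilon> 0 / rtheta a (4 * \<epsilon>) 0"
      using pos unfolding rtheta_dissection[OF assms elim] by (simp add: T_def add_divide_distrib)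
    then show ?case
      using pos by (simp add: ln_div)
  qed
  ultimately show ?thesis
    by (subst (asm) landau_o.big.in_cong)
qed

text \<open>The logarithm of Gauss's identity, with theta at d = 1/2 compared to theta at 0; the
  term \<epsilon>/8 is \<epsilon> d^2/(2a) for a = 1 and d = 1/2.\<close>

lemma ln_rfact_inf_duplication:
  "(\<lambda>\<epsilon>. ln 2 + 2 * ln (rfact_inf (2 * \<epsilon>)) - ln (rfact_inf \<epsilon>) - ln (rtheta 1 \<epsilon> 0) - \<epsilon> / 8) \<in> O[at_right 0](\<lambda>\<epsilon>. \<epsilon> ^ Suc n)"
proof -
  have "(\<lambda>\<epsilon>. rtheta 1 \<epsilon> (1/2) / rtheta 1 \<epsilon> 0 - exp (\<epsilon> * (1/2)\<^sup>2 / (2 * 1))) \<in> O[at_right 0](\<lambda>\<epsilon>. \<epsilon> ^ Suc n)"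
    by (rule rtheta_expansion) simp_all
  then have "(\<lambda>\<epsilon>. rtheta 1 \<epsilon> (1/2) / rtheta 1 \<epsilon> 0 - exp (\<epsilon> / 8)) \<in> O[at_right 0](\<lambda>\<epsilon>. \<epsilon> ^ Suc n)"
    by (simp add: power2_eq_square)
  then have "(\<lambda>\<epsilon>. ln (rtheta 1 \<epsilon> (1/2) / rtheta 1 \<epsilon> 0) - \<epsilon> / 8) \<in> O[at_right 0](\<lambda>\<epsilon>. \<epsilon> ^ Suc n)"
    by (rule ln_minus_bigo) (auto intro!: divide_pos_pos rtheta_pos)
  moreover have "eventually (\<lambda>\<epsilon>. ln (rtheta 1 \<epsilon> (1/2) / rtheta 1 \<epsilon> 0) - \<epsilon> / 8
      = ln 2 + 2 * ln (rfact_inf (2 * \<epsilon>)) - ln (rfact_inf \<epsilon>) - ln (rtheta 1 \<epsilon> 0) - \<epsilon> / 8) (at_right 0)"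
    using eventually_at_right_0_pos
  proof eventually_elim
    case (elim \<epsilon>)
    have pos: "rfact_inf (2 * \<epsilon>) > 0" "rfact_inf \<epsilon> > 0" "rtheta 1 \<epsilon> 0 > 0"
      using rfact_inf_pos rtheta_pos elim by auto
    then show ?case
      unfolding rfact_inf_theta[OF elim, symmetric] by (simp add: ln_div ln_mult ln_realpow)
  qed
  ultimately show ?thesis
    by (subst (asm) landau_o.big.in_cong)
qed

text \<open>
  This combination of rescalings kills constants and \<open>1/\<epsilon>\<close> and turns \<open>ln \<epsilon>\<close> into a constant, so that
  neither the value of \<open>ln \<eta>\<close> nor the transformation formula of \<open>\<eta>\<close> is needed.
\<close>

definition rescale :: "(real \<Rightarrow> real) \<Rightarrow> real \<Rightarrow> real" where
  "rescale f \<epsilon> = 2 * f (8 * \<epsilon>) - f (4 * \<epsilon>) - 2 * f (2 * \<epsilon>) + f \<epsilon>"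

lemma bigo_cmult: "f \<in> O[F](g) \<Longrightarrow> (\<lambda>x. c * f x) \<in> O[F](g)" for f :: "real \<Rightarrow> real"
  by (cases "c = 0") simp_all

lemma rescale_bigo:
  assumes "f \<in> O[at_right 0](\<lambda>\<epsilon>. \<epsilon> ^ n)"
  shows "rescale f \<in> O[at_right 0](\<lambda>\<epsilon>. \<epsilon> ^ n)"
  unfolding rescale_def by (intro sum_in_bigo bigo_cmult bigo_scale assms) auto

text \<open>With T f(\<epsilon>) = f(2\<epsilon>), \<open>rescale\<close> is (2T - 1)(T^2 - 1): the
  factor T^2 - 1 fits the dissection of theta, and 2T - 1 the duplication of (q)_inf. The term
  -3\<epsilon>/8 is the rescaling of -\<epsilon>/24, since 16 - 4 - 4 + 1 = 9; it is the source of
  the 1/24 in C.\<close>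

lemma rescale_ln_rnahm:
  assumes a: "a > 1/2"
  shows "(\<lambda>\<epsilon>. rescale (\<lambda>\<epsilon>. ln (rnahm a \<epsilon> 0 0)) \<epsilon> + 3 * \<epsilon> / 8) \<in> O[at_right 0](\<lambda>\<epsilon>. \<epsilon> ^ Suc n)"
proof -
  define A where "A = (\<lambda>a \<epsilon>. ln (rtheta a \<epsilon> 0) - ln (rtheta a (4 * \<epsilon>) 0) - ln 2)"
  define D where "D = (\<lambda>\<epsilon>. ln 2 + 2 * ln (rfact_inf (2 * \<epsilon>)) - ln (rfact_inf \<epsilon>) - ln (rtheta 1 \<epsilon> 0) - \<epsilon> / 8)"
  have A: "A a \<in> O[at_right 0](\<lambda>\<epsilon>. \<epsilon> ^ Suc n)" if "a > 0" for a
    unfolding A_def by (rule ln_rtheta_dissection[OF that])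
  have D: "D \<in> O[at_right 0](\<lambda>\<epsilon>. \<epsilon> ^ Suc n)"
    unfolding D_def by (rule ln_rfact_inf_duplication)
  have "(\<lambda>\<epsilon>. A a \<epsilon> - 2 * A a (2 * \<epsilon>) - D (4 * \<epsilon>) + D \<epsilon> + A 1 \<epsilon>) \<in> O[at_right 0](\<lambda>\<epsilon>. \<epsilon> ^ Suc n)"
    using a by (intro sum_in_bigo bigo_cmult bigo_scale A D) auto
  moreover have "eventually (\<lambda>\<epsilon>. A a \<epsilon> - 2 * A a (2 * \<epsilon>) - D (4 * \<epsilon>) + D \<epsilon> + A 1 \<epsilon>
      = rescale (\<lambda>\<epsilon>. ln (rnahm a \<epsilon> 0 0)) \<epsilon> + 3 * \<epsilon> / 8) (at_right 0)"
    using eventually_at_right_0_pos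
  proof eventually_elim
    case (elim \<epsilon>)
    have "ln (rnahm a (c * \<epsilon>) 0 0) = ln (rtheta a (c * \<epsilon>) 0) - ln (rfact_inf (c * \<epsilon>))" if "c > 0" for c
      using rnahm_antidiagonal[OF a, of "c * \<epsilon>" 0] rtheta_pos[of a "c * \<epsilon>" 0] rfact_inf_pos[of "c * \<epsilon>"] a elim that
      by (simp add: ln_div)
    from this[of 1] this[of 2] this[of 4] this[of 8] show ?case
      by (simp add: rescale_def A_def D_def)
  qed
  ultimately show ?thesis
    by (subst (asm) landau_o.big.in_cong)
qed

section \<open>Comparison of coefficients\<close>

lemma bigo_power_cancel:
  fixes g :: "real \<Rightarrow> real"
  assumes "(\<lambda>\<epsilon>. c + \<epsilon> * g \<epsilon>) \<in> O[at_right 0](\<lambda>\<epsilon>. \<epsilon> ^ Suc n)" "isCont g 0"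
  shows "c = 0" "g \<in> O[at_right 0](\<lambda>\<epsilon>. \<epsilon> ^ n)"
proof -
  have "isCont (\<lambda>\<epsilon>. c + \<epsilon> * g \<epsilon>) 0"
    by (intro continuous_intros assms(2))
  then have "((\<lambda>\<epsilon>. c + \<epsilon> * g \<epsilon>) \<longlongrightarrow> c + 0 * g 0) (at_right 0)"
    unfolding isCont_def by (rule filterlim_mono) (auto simp: at_le)
  with bigo_power_tendsto_0[OF assms(1)] have "c + 0 * g 0 = 0"
    by (intro tendsto_unique[of "at_right (0::real)"]) auto
  then show "c = 0"
    by simp
  then have "(\<lambda>\<epsilon>. \<epsilon> * g \<epsilon>) \<in> O[at_right 0](\<lambda>\<epsilon>. \<epsilon> * \<epsilon> ^ n)"
    using assms(1) by simp
  moreover have "eventually (\<lambda>\<epsilon>::real. \<epsilon> \<noteq> 0) (at_right 0)"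
    using eventually_at_right_0_pos by (rule eventually_mono) simp
  ultimately show "g \<in> O[at_right 0](\<lambda>\<epsilon>. \<epsilon> ^ n)"
    by (subst (asm) landau_o.big.mult_cancel_left) auto
qed

lemma quartic_bigo_imp_0:
  fixes c0 c1 c2 c3 c4 :: real
  assumes "(\<lambda>\<epsilon>. c0 + \<epsilon> * (c1 + \<epsilon> * (c2 + \<epsilon> * (c3 + \<epsilon> * c4)))) \<in> O[at_right 0](\<lambda>\<epsilon>. \<epsilon> ^ 5)"
  shows "c1 = 0" "c2 = 0" "c3 = 0" "c4 = 0"
proof -
  have 1: "(\<lambda>\<epsilon>. c1 + \<epsilon> * (c2 + \<epsilon> * (c3 + \<epsilon> * c4))) \<in> O[at_right 0](\<lambda>\<epsilon>. \<epsilon> ^ Suc 3)"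
    using bigo_power_cancel(2)[of c0 "\<lambda>\<epsilon>. c1 + \<epsilon> * (c2 + \<epsilon> * (c3 + \<epsilon> * c4))" 4] assms
    by (simp add: eval_nat_numeral)
  show "c1 = 0"
    by (rule bigo_power_cancel(1)[OF 1]) simp
  have 2: "(\<lambda>\<epsilon>. c2 + \<epsilon> * (c3 + \<epsilon> * c4)) \<in> O[at_right 0](\<lambda>\<epsilon>. \<epsilon> ^ Suc 2)"
    using bigo_power_cancel(2)[OF 1] by (simp add: eval_nat_numeral)
  show "c2 = 0"
    by (rule bigo_power_cancel(1)[OF 2]) simp
  have 3: "(\<lambda>\<epsilon>. c3 + \<epsilon> * c4) \<in> O[at_right 0](\<lambda>\<epsilon>. \<epsilon> ^ Suc 1)"
    using bigo_power_cancel(2)[OF 2] by (simp add: eval_nat_numeral)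
  show "c3 = 0"
    by (rule bigo_power_cancel(1)[OF 3]) simp
  have 4: "(\<lambda>\<epsilon>. c4 + \<epsilon> * 0) \<in> O[at_right 0](\<lambda>\<epsilon>. \<epsilon> ^ Suc 0)"
    using bigo_power_cancel(2)[OF 3] by simp
  show "c4 = 0"
    by (rule bigo_power_cancel(1)[OF 4]) simp
qed

lemma modular_imp_kappa:
  fixes f :: "complex \<Rightarrow> complex"
  assumes a: "a > 1/2" and "is_modular f"
    and f: "\<And>\<epsilon>. \<epsilon> > 0 \<Longrightarrow> f (axis \<epsilon>) = of_real (exp (- (\<epsilon> * C)) * rnahm a \<epsilon> (s / 2 + d) (s / 2 - d))"
  defines "u \<equiv> 1 - 1 / a" and "e \<equiv> d / a"
  shows "kappa1 a s d = C + 1/24" "kappa2 u s e = 0" "kappa3 u s e = 0" "kappa4 u s e = 0"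
proof -
  define k1 k2 k3 k4 where "k1 = kappa1 a s d" and "k2 = kappa2 u s e" and "k3 = kappa3 u s e" and "k4 = kappa4 u s e"
  define F where "F = (\<lambda>\<epsilon>. ln (norm (f (axis \<epsilon>))))"
  define P where "P = (\<lambda>\<epsilon>. (k1 - C) * \<epsilon> + k2 * \<epsilon> ^ 2 + k3 * \<epsilon> ^ 3 + k4 * \<epsilon> ^ 4)"
  define N where "N = (\<lambda>\<epsilon>. ln (rnahm a \<epsilon> 0 0))"
  define K where "K = (\<lambda>\<epsilon>. ln (gnahm a s d \<epsilon>) - log_expansion a s d \<epsilon>)"
  have "f (\<i> * of_real (\<epsilon> / (2 * pi))) \<noteq> 0" if "\<epsilon> > 0" for \<epsilon>
    using f[OF that] rnahm_pos[OF a that, of "s / 2 + d" "s / 2 - d"] by (simp add: axis_def)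
  from modular_expansion_at_zero[OF assms(2) this, of 5]
  obtain c \<alpha> w where mod: "(\<lambda>\<epsilon>. F \<epsilon> - (c + \<alpha> / \<epsilon> + w * ln \<epsilon>)) \<in> O[at_right 0](\<lambda>\<epsilon>. \<epsilon> ^ 5)"
    unfolding F_def axis_def by blast
  have "isCont (log_expansion a s d) 0"
    unfolding log_expansion_def by (intro continuous_intros)
  then have K: "K \<in> O[at_right 0](\<lambda>\<epsilon>. \<epsilon> ^ 5)"
    unfolding K_def using ln_minus_bigo[of "gnahm a s d" "log_expansion a s d" 4] gnahm_expansion[OF a, of s d] gnahm_pos[OF a]
    by (simp add: eval_nat_numeral)
  have N: "(\<lambda>\<epsilon>. rescale N \<epsilon> + 3 * \<epsilon> / 8) \<in> O[at_right 0](\<lambda>\<epsilon>. \<epsilon> ^ 5)"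
    using rescale_ln_rnahm[OF a, of 4, folded N_def] by (simp add: eval_nat_numeral)
  have F: "F \<epsilon> = P \<epsilon> - s * ln 2 + N \<epsilon> + K \<epsilon>" if "\<epsilon> > 0" for \<epsilon>
  proof -
    have pos: "rnahm a \<epsilon> (s / 2 + d) (s / 2 - d) > 0" "rnahm a \<epsilon> 0 0 > 0"
      using rnahm_pos[OF a that] by auto
    have "F \<epsilon> = - (\<epsilon> * C) + ln (rnahm a \<epsilon> (s / 2 + d) (s / 2 - d))"
      unfolding F_def f[OF that] using pos by (simp add: norm_mult ln_mult)
    moreover have "ln (gnahm a s d \<epsilon>) = s * ln 2 + ln (rnahm a \<epsilon> (s / 2 + d) (s / 2 - d)) - N \<epsilon>"
      using pos by (simp add: gnahm_def N_def ln_div ln_mult ln_powr)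
    moreover have "log_expansion a s d \<epsilon> - \<epsilon> * C = P \<epsilon>"
      by (simp add: log_expansion_def P_def k1_def k2_def k3_def k4_def u_def e_def algebra_simps)
    ultimately show ?thesis
      by (simp add: K_def)
  qed
  have "(\<lambda>\<epsilon>. (rescale N \<epsilon> + 3 * \<epsilon> / 8) + rescale K \<epsilon> - rescale (\<lambda>\<epsilon>. F \<epsilon> - (c + \<alpha> / \<epsilon> + w * ln \<epsilon>)) \<epsilon>) \<in> O[at_right 0](\<lambda>\<epsilon>. \<epsilon> ^ 5)"
    by (rule sum_in_bigo(2)[OF sum_in_bigo(1)[OF N rescale_bigo[OF K]] rescale_bigo[OF mod]])
  \<comment> \<open>The factors 9, 105, 945 and 7905 are 2 * 8^p - 4^p - 2 * 2^p + 1 for p = 1, ...,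
    4. As none is zero, every coefficient can be recovered.\<close>
  moreover have "eventually (\<lambda>\<epsilon>. (rescale N \<epsilon> + 3 * \<epsilon> / 8) + rescale K \<epsilon> - rescale (\<lambda>\<epsilon>. F \<epsilon> - (c + \<alpha> / \<epsilon> + w * ln \<epsilon>)) \<epsilon>
      = w * (2 * ln 8 - ln 4 - 2 * ln 2) + \<epsilon> * ((3/8 - 9 * (k1 - C)) + \<epsilon> * (- 105 * k2 + \<epsilon> * (- 945 * k3 + \<epsilon> * (- 7905 * k4))))) (at_right 0)"
    using eventually_at_right_0_pos
  proof eventually_elim
    case (elim \<epsilon>)
    have F': "F (m * \<epsilon>) = P (m * \<epsilon>) - s * ln 2 + N (m * \<epsilon>) + K (m * \<epsilon>)" if "m > 0" for m
      using F[of "m * \<epsilon>"] elim that by simp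
    have L: "ln (m * \<epsilon>) = ln m + ln \<epsilon>" if "m > 0" for m
      using elim that by (simp add: ln_mult)
    have I: "\<alpha> / (8 * \<epsilon>) = (\<alpha> / \<epsilon>) / 8" "\<alpha> / (4 * \<epsilon>) = (\<alpha> / \<epsilon>) / 4" "\<alpha> / (2 * \<epsilon>) = (\<alpha> / \<epsilon>) / 2"
      by simp_all
    show ?case
      using F[OF elim] F'[of 2] F'[of 4] F'[of 8]
      unfolding rescale_def L[of 2, simplified] L[of 4, simplified] L[of 8, simplified] I
      by (simp add: P_def eval_nat_numeral algebra_simps)
  qed
  ultimately have "(\<lambda>\<epsilon>. w * (2 * ln 8 - ln 4 - 2 * ln 2) + \<epsilon> * ((3/8 - 9 * (k1 - C)) + \<epsilon> * (- 105 * k2 + \<epsilon> * (- 945 * k3 + \<epsilon> * (- 7905 * k4)))))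
      \<in> O[at_right 0](\<lambda>\<epsilon>. \<epsilon> ^ 5)"
    by (subst (asm) landau_o.big.in_cong)
  from quartic_bigo_imp_0[OF this]
  show "kappa1 a s d = C + 1/24" "kappa2 u s e = 0" "kappa3 u s e = 0" "kappa4 u s e = 0"
    by (simp_all add: k1_def k2_def k3_def k4_def)
qed

text \<open>
  The equations \<open>\<kappa>\<^sub>2 = \<kappa>\<^sub>3 = 0\<close> have one further solution, with \<open>s = u\<^sup>2/2\<close>, which \<open>\<kappa>\<^sub>4 = 0\<close> excludes.
\<close>

lemma kappa_zero_cases:
  fixes u s e :: real
  assumes u: "u \<noteq> 0" "\<bar>u\<bar> < 1"
    and k2: "kappa2 u s e = 0" and k3: "kappa3 u s e = 0" and k4: "kappa4 u s e = 0"
  shows "s = 0 \<or> (s = -1 \<and> e = 0) \<or> (s = 1 \<and> e\<^sup>2 = u\<^sup>2 / 4)"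
proof (rule ccontr)
  assume contra: "\<not> ?thesis"
  then have s: "s \<noteq> 0" by simp
  have "192 * kappa2 u s e = s * (3 * u\<^sup>2 + 2 - 24 * e\<^sup>2 + 3 * s * u\<^sup>2 - 2 * s\<^sup>2)"
    by (simp add: kappa2_def eval_nat_numeral field_simps)
  then have 1: "3 * u\<^sup>2 + 2 - 24 * e\<^sup>2 + 3 * s * u\<^sup>2 - 2 * s\<^sup>2 = 0"
    using k2 s by simp
  have "384 * kappa3 u s e = s * u * ((1 + s) * (2 * u\<^sup>2 + 1 + s * (u\<^sup>2 - 1) - 12 * e\<^sup>2))"
    by (simp add: kappa3_def eval_nat_numeral field_simps)
  then have "1 + s = 0 \<or> 2 * u\<^sup>2 + 1 + s * (u\<^sup>2 - 1) - 12 * e\<^sup>2 = 0"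
    using k3 s u by simp
  then show False
  proof
    assume "1 + s = 0"
    then have "s = -1" by simp
    with 1 contra show False by simp
  next
    assume 2: "2 * u\<^sup>2 + 1 + s * (u\<^sup>2 - 1) - 12 * e\<^sup>2 = 0"
    \<comment> \<open>This combination of the two equations eliminates e.\<close>
    have "(s - 1) * (u\<^sup>2 - 2 * s) = (3 * u\<^sup>2 + 2 - 24 * e\<^sup>2 + 3 * s * u\<^sup>2 - 2 * s\<^sup>2) - 2 * (2 * u\<^sup>2 + 1 + s * (u\<^sup>2 - 1) - 12 * e\<^sup>2)"
      by (simp add: power2_eq_square algebra_simps)
    then have "s = 1 \<or> u\<^sup>2 - 2 * s = 0"
      using 1 2 by simp
    then show False
    proof
      assume "s = 1"
      with 2 contra show False by simp
    next
      assume "u\<^sup>2 - 2 * s = 0"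
      then have u2: "u\<^sup>2 = 2 * s" by simp
      have u4: "u ^ 4 = 4 * s\<^sup>2"
        using arg_cong[OF u2, of "\<lambda>x. x\<^sup>2"] by (simp add: power_mult_distrib)
      have e2: "e\<^sup>2 = (1 + 2 * s) * (1 + s) / 12"
        using 2 unfolding u2 by (simp add: power2_eq_square field_simps)
      have e4: "e ^ 4 = ((1 + 2 * s) * (1 + s) / 12)\<^sup>2"
        using arg_cong[OF e2, of "\<lambda>x. x\<^sup>2"] by simp
      have "0 < u\<^sup>2" "u\<^sup>2 < 1"
        using u abs_square_less_1[of u] by auto
      then have s01: "0 < s" "s < 1/2"
        using u2 by auto
      \<comment> \<open>On the curve u^2 = 2s the factor 2s - 1 is u^2 - 1, which is nonzero, so the
        quartic would have to vanish.\<close>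
      have "138240 * kappa4 u s e = - s * (2 * s - 1) * (45 * s ^ 4 + 68 * s ^ 3 - 41 * s\<^sup>2 - 68 * s - 4)"
        unfolding kappa4_def u2 u4 e2 e4 by (simp add: eval_nat_numeral field_simps)
      then have "45 * s ^ 4 + 68 * s ^ 3 - 41 * s\<^sup>2 - 68 * s - 4 = 0"
        using k4 s01 by simp
      \<comment> \<open>For 0 < s < 1/2 these bound the quartic by 72 s^2 - 68 s - 4 <= 4s - 4 <
        0.\<close>
      moreover have "s ^ 4 \<le> s\<^sup>2" "s ^ 3 \<le> s\<^sup>2" "s\<^sup>2 \<le> s"
        using s01 power_decreasing[of 2 4 s] power_decreasing[of 2 3 s] power_decreasing[of 1 2 s] by auto
      ultimately show False
        using s01 by linarith
    qed
  qed
qed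

lemma modular_nahm_sum_cases:
  fixes A :: "real^2^2" and B :: "real^2"
  assumes a: "a > 1/2" "a \<noteq> 1" and A: "A = vector [vector [a, 1 - a], vector [1 - a, a]]"
    and mod: "is_modular (nahm_sum A B C)"
  shows "(\<exists>b. B = vector [b, -b] \<and> C = b\<^sup>2 / (2*a) - 1/24) \<or>
        (B = vector [-1/2, -1/2] \<and> C = 1 / (8*a) - 1/24) \<or>
        ((B = vector [1 - a/2, a/2] \<or> B = vector [a/2, 1 - a/2]) \<and> C = a/8 - 1/24)"
proof -
  define s where "s = B$1 + B$2"
  define d where "d = (B$1 - B$2) / 2"
  have B: "B$1 = s / 2 + d" "B$2 = s / 2 - d"
    by (simp_all add: s_def d_def field_simps)
  have Bv: "B = vector [x, y] \<longleftrightarrow> B$1 = x \<and> B$2 = y" for x y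
    by (simp add: vec_eq_iff forall_2)
  have f: "nahm_sum A B C (axis \<epsilon>) = of_real (exp (- (\<epsilon> * C)) * rnahm a \<epsilon> (s / 2 + d) (s / 2 - d))" if "\<epsilon> > 0" for \<epsilon>
    by (simp add: nahm_sum_eq_nahm2[OF A] B nahm2_axis[OF a(1) that] qpow_axis)
  note k = modular_imp_kappa[OF a(1) mod f]
  have "1 - 1/a \<noteq> 0" "\<bar>1 - 1/a\<bar> < 1"
    using a by (auto simp: abs_less_iff field_simps)
  from kappa_zero_cases[OF this k(2-4)]
  consider "s = 0" | "s = -1" "d / a = 0" | "s = 1" "(d / a)\<^sup>2 = (1 - 1/a)\<^sup>2 / 4"
    by blast
  then show ?thesis
  proof cases
    case 1
    then have "B = vector [d, -d]" "C = d\<^sup>2 / (2*a) - 1/24"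
      using k(1) by (simp_all add: Bv B kappa1_def)
    then show ?thesis
      by blast
  next
    case 2
    then have "d = 0"
      using a by simp
    then have "B = vector [-1/2, -1/2]" "C = 1 / (8*a) - 1/24"
      using k(1) 2 a by (simp_all add: Bv B kappa1_def field_simps)
    then show ?thesis
      by blast
  next
    case 3
    have "d\<^sup>2 = ((a - 1) / 2)\<^sup>2"
      using 3(2) a by (simp add: power_divide field_simps power2_eq_square)
    then have "d = (a - 1) / 2 \<or> d = - ((a - 1) / 2)"
      by (simp add: power2_eq_iff)
    then have "B = vector [a/2, 1 - a/2] \<or> B = vector [1 - a/2, a/2]"
      by (auto simp: Bv B 3 field_simps)
    moreover have "C = ((a - 1) / 2)\<^sup>2 / (2 * a) + (1 - 1/a) / 8 + 1/8 - 1/24"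
      using k(1) 3 \<open>d\<^sup>2 = ((a - 1) / 2)\<^sup>2\<close> by (simp add: kappa1_def)
    then have "C = a/8 - 1/24"
      using a by (simp add: field_simps power2_eq_square)
    ultimately show ?thesis
      by blast
  qed
qed

section \<open>The theorem\<close>

text \<open>The -1/24 in C is absorbed by the factor q^(1/24) of \<eta>, and the rest of C cancels
  the power of q left over from completing the square.\<close>

lemma qpow_eta_cancel:
  assumes "Im z > 0"
  shows "qpow z (x - 1/24) * (qpow z (- x) * T / qfact_inf z) = 1 / dedekind_eta z * T"
proof -
  have "qpow z (x - 1/24) * qpow z (- x) * qpow z (1/24) = 1"
    by (simp flip: qpow_add)
  then have *: "qpow z (x - 1/24) * qpow z (- x) = 1 / qpow z (1/24)"
    by (simp add: field_simps)
  have "qpow z (x - 1/24) * (qpow z (- x) * T / qfact_inf z) = qpow z (x - 1/24) * qpow z (- x) * T / qfact_inf z"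
    by simp
  then show ?thesis
    unfolding * by (simp add: dedekind_eta_eq)
qed

theorem mainTheorem5:
  fixes a :: real and A :: "real^2^2"
  assumes "a > 1/2" and "a \<noteq> 1"
    and "A = vector [vector [a, 1 - a], vector [1 - a, a]]"
  shows
    "(\<forall>(B :: real^2) (C :: real). is_modular (nahm_sum A B C) \<longrightarrow>
        (\<exists>b. B = vector [b, -b] \<and> C = b\<^sup>2 / (2*a) - 1/24) \<or>
        (B = vector [-1/2, -1/2] \<and> C = 1 / (8*a) - 1/24) \<or>
        ((B = vector [1 - a/2, a/2] \<or> B = vector [a/2, 1 - a/2]) \<and> C = a/8 - 1/24)) \<and>
     (\<forall>z. Im z > 0 \<longrightarrow>
        (\<forall>b. nahm_sum A (vector [b, -b]) (b\<^sup>2 / (2*a) - 1/24) z =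
           1 / dedekind_eta z * (\<Sum>\<^sub>\<infinity>n\<in>{n. n - b/a \<in> \<int>}. qpow z (a * n\<^sup>2 / 2))) \<and>
        nahm_sum A (vector [-1/2, -1/2]) (1 / (8*a) - 1/24) z =
           2 / dedekind_eta z * (\<Sum>\<^sub>\<infinity>n\<in>{n. n - 1/(2*a) \<in> \<int>}. qpow z (a * n\<^sup>2 / 2)) \<and>
        (\<forall>B \<in> {vector [1 - a/2, a/2], vector [a/2, 1 - a/2]}.
           nahm_sum A B (a/8 - 1/24) z =
           1 / (2 * dedekind_eta z) * (\<Sum>\<^sub>\<infinity>n\<in>{n. n - 1/2 \<in> \<int>}. qpow z (a * n\<^sup>2 / 2))))"
proof (intro conjI allI impI ballI)
  fix B :: "real^2" and C :: real
  assume "is_modular (nahm_sum A B C)"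
  then show "(\<exists>b. B = vector [b, -b] \<and> C = b\<^sup>2 / (2*a) - 1/24) \<or>
        (B = vector [-1/2, -1/2] \<and> C = 1 / (8*a) - 1/24) \<or>
        ((B = vector [1 - a/2, a/2] \<or> B = vector [a/2, 1 - a/2]) \<and> C = a/8 - 1/24)"
    by (rule modular_nahm_sum_cases[OF assms])
next
  fix z :: complex and b :: real
  assume z: "Im z > 0"
  show "nahm_sum A (vector [b, -b]) (b\<^sup>2 / (2*a) - 1/24) z =
      1 / dedekind_eta z * (\<Sum>\<^sub>\<infinity>n\<in>{n. n - b/a \<in> \<int>}. qpow z (a * n\<^sup>2 / 2))"
    unfolding nahm_sum_eq_nahm2[OF assms(3)] vector_2 nahm2_antidiagonal[OF assms(1) z] theta_coset_def
    by (rule qpow_eta_cancel[OF z])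
next
  fix z :: complex
  assume z: "Im z > 0"
  let ?T = "\<Sum>\<^sub>\<infinity>n\<in>{n. n - 1/(2*a) \<in> \<int>}. qpow z (a * n\<^sup>2 / 2)"
  have "nahm_sum A (vector [-1/2, -1/2]) (1 / (8*a) - 1/24) z =
      qpow z (1 / (8*a) - 1/24) * (qpow z (- (1 / (8*a))) * (2 * ?T) / qfact_inf z)"
    unfolding nahm_sum_eq_nahm2[OF assms(3)] vector_2 nahm2_shift_antidiagonal_neg[OF assms(1) z] theta_coset_def
    by simp
  also have "\<dots> = 1 / dedekind_eta z * (2 * ?T)"
    by (rule qpow_eta_cancel[OF z])
  finally show "nahm_sum A (vector [-1/2, -1/2]) (1 / (8*a) - 1/24) z = 2 / dedekind_eta z * ?T"
    by simp
next
  fix z :: complex and B :: "real^2"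
  assume z: "Im z > 0" and B: "B \<in> {vector [1 - a/2, a/2], vector [a/2, 1 - a/2]}"
  let ?T = "\<Sum>\<^sub>\<infinity>n\<in>{n. n - 1/2 \<in> \<int>}. qpow z (a * n\<^sup>2 / 2)"
  have "nahm2 z a (B$1) (B$2) = qpow z (- (a / 8)) * theta_coset z a (1 / 2) / (2 * qfact_inf z)"
    using B nahm2_shift_antidiagonal_pos[OF assms(1) z] nahm2_commute[of z a "1 - a/2" "a/2"] by auto
  then have "nahm_sum A B (a/8 - 1/24) z = qpow z (a/8 - 1/24) * (qpow z (- (a/8)) * (?T / 2) / qfact_inf z)"
    unfolding nahm_sum_eq_nahm2[OF assms(3)] theta_coset_def by simp
  also have "\<dots> = 1 / dedekind_eta z * (?T / 2)"
    by (rule qpow_eta_cancel[OF z])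
  finally show "nahm_sum A B (a/8 - 1/24) z = 1 / (2 * dedekind_eta z) * ?T"
    by simp
qed

end
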